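(* Let $\gamma\in[0,1)$ and $T>0$. For $\varepsilon>0$ let $\mu^\varepsilon$ be the law on $C_0[0,T]$ of a weak solution $(X^\varepsilon_t)_{0\le t\le T}$ of $$dX^\varepsilon_t=\operatorname{sgn}(X^\varepsilon_t)\,|X^\varepsilon_t|^\gamma\,dt+\varepsilon\,dW_t,\qquad X^\varepsilon_0=0.$$ Then the weak limit $\mu=\lim_{\varepsilon\to0}\mu^\varepsilon$ (weak convergence of probability measures on $C_0[0,T]$) exists and is given by $$\mu=\tfrac12\,\delta_{H_\gamma}+\tfrac12\,\delta_{-H_\gamma}.$$
   Context: Here $\operatorname{sgn}(x)=I_{\{x>0\}}-I_{\{x<0\}}$ (so $\operatorname{sgn}(0)=0$, and for $\gamma=0$ the drift is $\operatorname{sgn}(x)$). The function $H_\gamma$ is defined by $H_\gamma(s)=[(1-\gamma)s^+]^{1/(1-\gamma)}$, where $s^+=\max(s,0)$, and is regarded as an element of $C_0[0,T]$ by restriction to $[0,T]$. $C_0[0,T]$ is the space of continuous real functions on $[0,T]$ vanishing at $0$, with the uniform norm and its Borel $\sigma$-algebra. $\delta_x$ is the Dirac mass at $x$. $W$ is a standard one-dimensional Brownian motion. A weak solution is a continuous adapted process $X^\varepsilon$, defined together with a Brownian motion $W$ on some filtered probability space, that satisfies the equation in integral form on $[0,T]$. For each $\varepsilon>0$ weak existence and uniqueness in law hold, so $\mu^\varepsilon$ is well defined. *)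

theory Defs
  imports "HOL-Probability.Probability"
begin

section \<open>Weak convergence on the path space\<close>

definition borel_of :: "'a topology \<Rightarrow> 'a measure" where
  "borel_of S = sigma (topspace S) {U. openin S U}"

definition weak_convergence ::
    "'a topology \<Rightarrow> ('i \<Rightarrow> 'a measure) \<Rightarrow> 'a measure \<Rightarrow> 'i filter \<Rightarrow> bool" where
  "weak_convergence S \<nu> \<mu> G \<longleftrightarrow>
     (\<forall>\<^sub>F i in G. prob_space (\<nu> i) \<and> sets (\<nu> i) = sets (borel_of S)) \<and>
     prob_space \<mu> \<and> sets \<mu> = sets (borel_of S) \<and>
     (\<forall>f. continuous_map S euclideanreal f \<and> bounded (f ` topspace S) \<longrightarrow>
        ((\<lambda>i. \<integral>x. f x \<partial>\<nu> i) \<longlongrightarrow> (\<integral>x. f x \<partial>\<mu>)) G)"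

text \<open>A function on \<open>{0..T}\<close> is represented by its extension that is \<^const>\<open>undefined\<close> outside
  this interval, as everywhere in \<^const>\<open>cfunspace\<close>; the metric is the supremum distance.\<close>

definition C0_space :: "real \<Rightarrow> (real \<Rightarrow> real) metric" where
  "C0_space T = submetric (cfunspace (top_of_set {0..T}) euclidean_metric) {f. f 0 = 0}"

abbreviation C0_topology :: "real \<Rightarrow> (real \<Rightarrow> real) topology" where
  "C0_topology T \<equiv> mtopology_of (C0_space T)"

lemma mspace_C0_space:
  assumes "0 \<le> T"
  shows "mspace (C0_space T) = {f \<in> extensional {0..T}. continuous_on {0..T} f \<and> f 0 = 0}"
proof -
  have "bounded (f ` {0..T})" if "continuous_on {0..T} f" for f :: "real \<Rightarrow> real"
    using that by (intro compact_imp_bounded compact_continuous_image) auto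
  moreover have "Metric_space.mbounded (UNIV :: real set) dist = bounded"
    by (rule ext) (simp add: Met_TC.mbounded_def bounded_def Ball_def subset_iff)
  ultimately show ?thesis
    by (auto simp: C0_space_def)
qed

lemma mdist_C0_space:
  assumes "0 \<le> T" "f \<in> mspace (C0_space T)" "g \<in> mspace (C0_space T)"
  shows "mdist (C0_space T) f g = (SUP t\<in>{0..T}. \<bar>f t - g t\<bar>)"
  using assms
  by (auto simp: C0_space_def cfunspace_def Met_TC.fdist_def Met_TC.fspace_def dist_real_def)

definition add_measure :: "'a measure \<Rightarrow> 'a measure \<Rightarrow> 'a measure" where
  "add_measure M N = measure_of (space M) (sets M) (\<lambda>A. emeasure M A + emeasure N A)"

lemma sets_add_measure [simp]: "sets (add_measure M N) = sets M"
  by (simp add: add_measure_def)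

lemma emeasure_add_measure:
  assumes "sets N = sets M" "A \<in> sets M"
  shows "emeasure (add_measure M N) A = emeasure M A + emeasure N A"
  unfolding add_measure_def
proof (rule emeasure_measure_of_sigma)
  show "countably_additive (sets M) (\<lambda>A. emeasure M A + emeasure N A)"
    using assms(1) by (auto intro!: countably_additiveI
        simp: suminf_add [symmetric] suminf_emeasure)
qed (use assms in \<open>auto simp: positive_def sets.sigma_algebra_axioms\<close>)


section \<open>The stochastic differential equation\<close>

text \<open>The filtration \<open>F\<close> is indexed by all real times, but only its values on \<open>{0..T}\<close> matter:
  a filtration \<open>(F t)\<close>, \<open>t \<in> {0..T}\<close>, can be continued by \<open>F 0\<close> to the left and by \<open>F T\<close> to the
  right. Likewise \<open>W\<close> is only required to be a Brownian motion up to time \<open>T\<close>. No completeness or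
  right continuity of the filtration is assumed.\<close>

locale brownian_motion = prob_space M + filtration "space M" F
  for M :: "'w measure" and F :: "real \<Rightarrow> 'w measure" +
  fixes T :: real and W :: "real \<Rightarrow> 'w \<Rightarrow> real"
  assumes subalgebra_F: "subalgebra M (F t)"
    and W_adapted: "t \<in> {0..T} \<Longrightarrow> W t \<in> borel_measurable (F t)"
    and W_start: "AE \<omega> in M. W 0 \<omega> = 0"
    and W_continuous: "AE \<omega> in M. continuous_on {0..T} (\<lambda>t. W t \<omega>)"
    and W_increment_normal: "0 \<le> s \<Longrightarrow> s < t \<Longrightarrow> t \<le> T \<Longrightarrow>
      distributed M lborel (\<lambda>\<omega>. W t \<omega> - W s \<omega>) (normal_density 0 (sqrt (t - s)))"
    and W_increment_indep: "0 \<le> s \<Longrightarrow> s < t \<Longrightarrow> t \<le> T \<Longrightarrow>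
      indep_set (sets (F s)) {(\<lambda>\<omega>. W t \<omega> - W s \<omega>) -` A \<inter> space M | A. A \<in> sets borel}"

text \<open>Since \<open>0 powr 0 = 0\<close> and \<open>sgn 0 = 0\<close>, this is \<open>sgn x\<close> for \<open>\<gamma> = 0\<close>.\<close>

definition drift :: "real \<Rightarrow> real \<Rightarrow> real" where
  "drift \<gamma> x = sgn x * \<bar>x\<bar> powr \<gamma>"

locale weak_solution = brownian_motion M F T W
  for M :: "'w measure" and F :: "real \<Rightarrow> 'w measure" and T :: real
    and W :: "real \<Rightarrow> 'w \<Rightarrow> real" +
  fixes \<gamma> \<epsilon> :: real and X :: "real \<Rightarrow> 'w \<Rightarrow> real"
  assumes X_adapted: "t \<in> {0..T} \<Longrightarrow> X t \<in> borel_measurable (F t)"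
    and X_continuous: "\<omega> \<in> space M \<Longrightarrow> continuous_on {0..T} (\<lambda>t. X t \<omega>)"
    and X_start: "\<omega> \<in> space M \<Longrightarrow> X 0 \<omega> = 0"
    and X_equation: "AE \<omega> in M. \<forall>t\<in>{0..T}.
      X t \<omega> = (LBINT s:{0..t}. drift \<gamma> (X s \<omega>)) + \<epsilon> * W t \<omega>"

definition path_law :: "real \<Rightarrow> 'w measure \<Rightarrow> (real \<Rightarrow> 'w \<Rightarrow> real) \<Rightarrow> (real \<Rightarrow> real) measure" where
  "path_law T M X = distr M (borel_of (C0_topology T)) (\<lambda>\<omega>. restrict (\<lambda>t. X t \<omega>) {0..T})"

definition H :: "real \<Rightarrow> real \<Rightarrow> real" where
  "H \<gamma> s = ((1 - \<gamma>) * max s 0) powr (1 / (1 - \<gamma>))"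

definition dirac_C0 :: "real \<Rightarrow> (real \<Rightarrow> real) \<Rightarrow> (real \<Rightarrow> real) measure" where
  "dirac_C0 T x = return (borel_of (C0_topology T)) (restrict x {0..T})"

end

theory Submission
  imports Defs
begin

text \<open>Write \<open>b = drift \<gamma>\<close>, \<open>L f = b f' + (\<epsilon>\<^sup>2 / 2) f''\<close> for the generator, and let the travel time
  \<open>\<phi>(x) = x\<^bsup>1-\<gamma>\<^esup> / (1 - \<gamma>)\<close> be the inverse of \<open>H \<gamma>\<close>. As long as a solution of \<open>x' = b(x)\<close> is
  not \<open>0\<close>, the quantity \<open>\<phi>(\<bar>x\<bar>)\<close> grows at unit speed, and the limit \<open>\<mu>\<close> says that the noisy solution leaves \<open>0\<close> at
  once, up or down with equal probability.

  Up to a small error no path is faster than \<open>H \<gamma>\<close>. The noise is additive, so that a comparison argument works path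
  by path: \<open>\<phi>(\<bar>X t\<bar>) \<le> \<phi>(\<bar>X s\<bar>) + (t - s) + P\<close> with the error \<open>P = \<phi>(2 \<epsilon> V)\<close>, where \<open>V\<close> bounds
  \<open>\<bar>W\<bar>\<close> on \<open>{0..T}\<close> (\<open>travel_time_growth\<close>). By Doob's inequality the second moment of \<open>V\<close> is at most \<open>8 T\<close>,
  and so the expectation of \<open>P\<close> tends to \<open>0\<close>.

  In the mean no path is slower than \<open>H \<gamma>\<close> either. The even function \<open>u\<close> with \<open>u(0) = 0\<close> and \<open>L u = 1\<close>
  satisfies \<open>E u(X T) = T\<close> by Dynkin's formula, and \<open>u(x) \<le> \<phi>(\<bar>x\<bar>)\<close> for every \<open>\<epsilon>\<close>
  (\<open>exit_function_le_travel_time\<close>). Hence \<open>T + P - u(X T)\<close> is a nonnegative variable with the same small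
  expectation as \<open>P\<close>. By Markov's inequality \<open>\<phi>(\<bar>X T\<bar>)\<close> is close to its largest possible value \<open>T\<close> with
  high probability, and the speed limit on \<open>{t..T}\<close> then forces \<open>\<phi>(\<bar>X t\<bar>)\<close> to be close to \<open>t\<close> for all \<open>t\<close>
  at once (\<open>prob_not_extremal_le\<close>). A continuous path of this kind cannot change sign except near
  time \<open>0\<close>, so that it is uniformly close to \<open>H \<gamma>\<close> or to \<open>- H \<gamma>\<close> (\<open>near_H_or_minus_H\<close>).

  The two signs are balanced by the scale function \<open>s\<close>, the odd function with \<open>L s = 0\<close>: it satisfies
  \<open>E s(X T) = 0\<close>, and for small \<open>\<epsilon>\<close> it is nearly constant on each side away from \<open>0\<close>
  (\<open>scale_function_upper\<close>). Therefore neither sign can carry asymptotically more than half of the mass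
  (\<open>prob_one_sided_le\<close>), and as both together carry almost all of it, each carries one half. For
  \<open>\<gamma> = 0\<close> the function \<open>s\<close> has no second derivative at \<open>0\<close>; it is reached as a limit of smooth functions
  \<open>\<psi>\<close> for which \<open>L \<psi>\<close> tends to \<open>0\<close> everywhere, also at the point \<open>0\<close>, where the drift is \<open>0\<close>.

  Dynkin's formula is proved from the independence of the increments. Over a step of a fine grid
  \<open>f(X)\<close> changes first by the Gaussian increment, whose mean given the past is explicit, and then by
  the drift, which the mean value theorem controls on each path; both sums converge to integrals
  along the path, and dominated convergence transfers this to expectations.

  Finally, the masses of all small balls around \<open>H \<gamma>\<close> and \<open>- H \<gamma>\<close> tend to one half, which is weak
  convergence to the two-point measure (\<open>weak_convergence_two_point\<close>).\<close>

section \<open>Antiderivatives and powers\<close>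

text \<open>In contrast to an integral over \<open>{0..x}\<close>, this needs no case distinction on the sign of \<open>x\<close>.\<close>

definition antideriv :: "(real \<Rightarrow> real) \<Rightarrow> real \<Rightarrow> real" where
  "antideriv f = (SOME F. F 0 = 0 \<and> (\<forall>x. (F has_real_derivative f x) (at x)))"

lemma antideriv:
  assumes "continuous_on UNIV f"
  shows antideriv_0: "antideriv f 0 = 0"
    and DERIV_antideriv: "(antideriv f has_real_derivative f x) (at x)"
proof -
  have "\<exists>F. \<forall>x. -\<infinity> < ereal x \<longrightarrow> ereal x < \<infinity> \<longrightarrow> (F has_vector_derivative f x) (at x)"
    using assms by (intro einterval_antiderivative) (auto simp: continuous_on_eq_continuous_at)
  then obtain F where F: "\<And>x. (F has_real_derivative f x) (at x)"
    by (auto simp: has_real_derivative_iff_has_vector_derivative)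
  have "\<exists>F. F 0 = 0 \<and> (\<forall>x. (F has_real_derivative f x) (at x))"
    by (rule exI[of _ "\<lambda>x. F x - F 0"]) (auto intro!: derivative_eq_intros F)
  then have "antideriv f 0 = 0 \<and> (\<forall>x. (antideriv f has_real_derivative f x) (at x))"
    unfolding antideriv_def by (rule someI_ex)
  then show "antideriv f 0 = 0" "(antideriv f has_real_derivative f x) (at x)" by auto
qed

lemma DERIV_le_imp_le:
  fixes F G :: "real \<Rightarrow> real"
  assumes "a \<le> b" "\<And>x. (F has_real_derivative f x) (at x)" "\<And>x. (G has_real_derivative g x) (at x)"
    and "\<And>x. a \<le> x \<Longrightarrow> x \<le> b \<Longrightarrow> f x \<le> g x"
  shows "F b - F a \<le> G b - G a"
proof -
  have "G a - F a \<le> G b - F b"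
  proof (rule DERIV_nonneg_imp_nondecreasing[OF assms(1), where f="\<lambda>x. G x - F x"])
    fix x assume "a \<le> x" "x \<le> b"
    then show "\<exists>y. ((\<lambda>x. G x - F x) has_real_derivative y) (at x) \<and> 0 \<le> y"
      using assms(2,3)[of x] assms(4)[of x]
      by (intro exI[of _ "g x - f x"]) (auto intro!: derivative_eq_intros)
  qed
  then show ?thesis by simp
qed

text \<open>The cases \<open>s = 1\<close> and \<open>s = - 1\<close> exchange even and odd functions.\<close>

lemma antideriv_uminus:
  assumes f: "continuous_on UNIV f" and s: "\<And>x. f (- x) = s * f x"
  shows "antideriv f (- x) = - s * antideriv f x"
proof -
  have *: "((\<lambda>x. antideriv f (- x) + s * antideriv f x) has_real_derivative 0) (at x)" for x
    using s[of x]
    by (auto intro!: derivative_eq_intros DERIV_chain2[OF DERIV_antideriv[OF f]] DERIV_antideriv[OF f])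
  have "antideriv f (- x) + s * antideriv f x = antideriv f (- 0) + s * antideriv f 0"
    by (rule DERIV_isconst_all) (use * in auto)
  then show ?thesis using antideriv_0[OF f] by simp
qed

lemma powr_superadditive:
  fixes a b p :: real
  assumes "0 \<le> a" "0 \<le> b" "1 \<le> p"
  shows "a powr p + b powr p \<le> (a + b) powr p"
proof (cases "a + b = 0")
  case False
  then have ab: "a + b > 0" using assms by simp
  have *: "(y / (a+b)) powr p \<le> y / (a + b)" if "0 \<le> y" "y \<le> a + b" for y
    using powr_mono'[of 1 p "y / (a+b)"] that ab assms(3) by simp
  have "(a / (a+b)) powr p + (b / (a+b)) powr p \<le> a / (a+b) + b / (a+b)"
    using *[of a] *[of b] assms by simp
  also have "\<dots> = 1" using ab by (simp add: add_divide_distrib[symmetric])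
  finally show ?thesis
    using ab assms by (simp add: powr_divide field_simps)
next
  case True
  then have "a = 0" "b = 0" using assms by auto
  then show ?thesis by simp
qed

lemma powr_subadditive:
  fixes a b p :: real
  assumes "0 \<le> a" "0 \<le> b" "0 < p" "p \<le> 1"
  shows "(a + b) powr p \<le> a powr p + b powr p"
proof (cases "a + b = 0")
  case False
  then have ab: "a + b > 0" using assms by simp
  have *: "y / (a + b) \<le> (y / (a+b)) powr p" if "0 \<le> y" "y \<le> a + b" for y
    using powr_mono'[of p 1 "y / (a+b)"] that ab assms by simp
  have "1 = a / (a+b) + b / (a+b)" using ab by (simp add: add_divide_distrib[symmetric])
  also have "\<dots> \<le> (a / (a+b)) powr p + (b / (a+b)) powr p"
    using *[of a] *[of b] assms by simp
  finally show ?thesis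
    using ab assms by (simp add: powr_divide field_simps)
next
  case True
  then have "a = 0" "b = 0" using assms by auto
  then show ?thesis by simp
qed

section \<open>The speed limit for perturbed paths\<close>

text \<open>The time that the solution of \<open>y' = y\<^bsup>\<gamma>\<^esup>\<close> leaving \<open>0\<close> at once takes to reach \<open>x\<close>.\<close>

definition travel_time :: "real \<Rightarrow> real \<Rightarrow> real" where
  "travel_time \<gamma> x = x powr (1 - \<gamma>) / (1 - \<gamma>)"

lemma travel_time_nonneg: "\<gamma> < 1 \<Longrightarrow> 0 \<le> travel_time \<gamma> x"
  by (simp add: travel_time_def)

lemma travel_time_0 [simp]: "travel_time \<gamma> 0 = 0"
  by (simp add: travel_time_def)

lemma H_travel_time: "\<gamma> < 1 \<Longrightarrow> 0 \<le> y \<Longrightarrow> H \<gamma> (travel_time \<gamma> y) = y"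
  by (simp add: H_def travel_time_def powr_powr max_absorb1)

lemma H_0 [simp]: "H \<gamma> 0 = 0"
  by (simp add: H_def)

lemma H_nonneg: "0 \<le> H \<gamma> s"
  by (simp add: H_def)

lemma H_mono: "\<gamma> < 1 \<Longrightarrow> s \<le> t \<Longrightarrow> H \<gamma> s \<le> H \<gamma> t"
  unfolding H_def by (intro powr_mono2 mult_left_mono) auto

lemma H_pos: "\<gamma> < 1 \<Longrightarrow> 0 < s \<Longrightarrow> 0 < H \<gamma> s"
  by (simp add: H_def)

lemma continuous_on_H: "\<gamma> < 1 \<Longrightarrow> continuous_on A (H \<gamma>)"
  unfolding H_def by (intro continuous_on_powr' continuous_intros) auto

lemma travel_time_mono: "\<gamma> < 1 \<Longrightarrow> 0 \<le> x \<Longrightarrow> x \<le> y \<Longrightarrow> travel_time \<gamma> x \<le> travel_time \<gamma> y"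
  unfolding travel_time_def by (intro divide_right_mono powr_mono2) auto

lemma travel_time_add_le:
  "0 \<le> \<gamma> \<Longrightarrow> \<gamma> < 1 \<Longrightarrow> 0 \<le> x \<Longrightarrow> 0 \<le> y \<Longrightarrow> travel_time \<gamma> (x + y) \<le> travel_time \<gamma> x + travel_time \<gamma> y"
  using powr_subadditive[of x y "1 - \<gamma>"]
  by (simp add: travel_time_def add_divide_distrib[symmetric] divide_right_mono)

lemma drift_uminus: "drift \<gamma> (- x) = - drift \<gamma> x"
  by (simp add: drift_def sgn_if)

lemma drift_pos: "0 < x \<Longrightarrow> drift \<gamma> x = x powr \<gamma>"
  by (simp add: drift_def)

lemma drift_0 [simp]: "drift \<gamma> 0 = 0"
  by (simp add: drift_def)

lemma abs_drift: "\<bar>drift \<gamma> x\<bar> = \<bar>x\<bar> powr \<gamma>"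
  by (cases "x = 0") (auto simp: drift_def abs_mult)

lemma powr_le_one_plus: "0 \<le> p \<Longrightarrow> p \<le> 1 \<Longrightarrow> 0 \<le> x \<Longrightarrow> x powr p \<le> 1 + (x::real)"
  using powr_mono[of p 1 x] powr_le1[of p x] by (cases "x \<le> 1") auto

lemma abs_drift_le: "0 \<le> \<gamma> \<Longrightarrow> \<gamma> < 1 \<Longrightarrow> \<bar>drift \<gamma> x\<bar> \<le> 1 + \<bar>x\<bar>"
  by (simp add: abs_drift powr_le_one_plus)

lemma drift_measurable [measurable]: "drift \<gamma> \<in> borel_measurable borel"
  unfolding drift_def by measurable

lemma set_integrable_comp_bounded:
  fixes x :: "real \<Rightarrow> real" and g :: "real \<Rightarrow> real"
  assumes x: "continuous_on {a..b} x" and g[measurable]: "g \<in> borel_measurable borel"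
    and bd: "\<And>s. s \<in> {a..b} \<Longrightarrow> \<bar>g (x s)\<bar> \<le> C"
  shows "set_integrable lborel {a..b} (\<lambda>s. g (x s))"
proof -
  have [measurable]: "(\<lambda>s. indicator {a..b} s *\<^sub>R x s) \<in> borel_measurable borel"
    using borel_measurable_continuous_on_indicator[OF _ x] by simp
  have "(\<lambda>s. indicator {a..b} s *\<^sub>R g (indicator {a..b} s *\<^sub>R x s)) \<in> borel_measurable borel"
    by measurable
  also have "(\<lambda>s. indicator {a..b} s *\<^sub>R g (indicator {a..b} s *\<^sub>R x s)) =
      (\<lambda>s. indicator {a..b} s *\<^sub>R g (x s))"
    by (auto simp: indicator_def)
  finally have "(\<lambda>s. indicator {a..b} s *\<^sub>R g (x s)) \<in> borel_measurable borel" .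
  then show ?thesis
    unfolding set_integrable_def
    by (intro integrableI_bounded_set[where A="{a..b}" and B=C])
       (use bd in \<open>auto simp: emeasure_lborel_Icc_eq indicator_def simp del: scaleR_conv_of_real of_bool_def\<close>)
qed

lemma bounded_drift_path:
  fixes x :: "real \<Rightarrow> real"
  assumes "0 \<le> \<gamma>" "\<gamma> < 1" "continuous_on {a..b} x"
  obtains K where "\<And>s. s \<in> {a..b} \<Longrightarrow> \<bar>x s\<bar> \<le> K" "\<And>s. s \<in> {a..b} \<Longrightarrow> \<bar>drift \<gamma> (x s)\<bar> \<le> 1 + K"
proof -
  have "bounded (x ` {a..b})"
    using assms by (intro compact_imp_bounded compact_continuous_image) auto
  then obtain K where "\<And>s. s \<in> {a..b} \<Longrightarrow> \<bar>x s\<bar> \<le> K"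
    by (force simp: bounded_iff)
  with abs_drift_le[OF assms(1,2)] show thesis
    by (intro that[of K]) (auto intro: order_trans[OF _ add_left_mono])
qed

lemma set_integrable_drift:
  fixes x :: "real \<Rightarrow> real"
  assumes "0 \<le> \<gamma>" "\<gamma> < 1" "continuous_on {a..b} x"
  shows "set_integrable lborel {a..b} (\<lambda>s. drift \<gamma> (x s))"
  using bounded_drift_path[OF assms] set_integrable_comp_bounded[OF assms(3), of "drift \<gamma>"] by auto

lemma LBINT_Icc_split:
  fixes f :: "real \<Rightarrow> real"
  assumes f: "set_integrable lborel {a..c} f" and "a \<le> b" "b \<le> c"
  shows "(LBINT s:{a..c}. f s) = (LBINT s:{a..b}. f s) + (LBINT s:{b..c}. f s)"
proof -
  have i: "set_integrable lborel {a..b} f" "set_integrable lborel {b..c} f"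
    using assms by (auto intro: set_integrable_subset)
  have "(LBINT s:{a..b} \<union> {b..c}. f s) = (LBINT s:{a..b}. f s) + (LBINT s:{b..c}. f s)"
  proof (rule set_integral_Un_AE)
    have "AE x in lborel. x \<noteq> b" by (rule AE_lborel_singleton)
    then show "AE x in lborel. \<not> (x \<in> {a..b} \<and> x \<in> {b..c})"
      by eventually_elim auto
  qed (use i in auto)
  moreover have "{a..b} \<union> {b..c} = {a..c}" using assms by auto
  ultimately show ?thesis by simp
qed

text \<open>A nonlinear Gronwall argument. The path \<open>\<bar>x\<bar>\<close> stays below \<open>y = \<bar>x s\<bar> + 2 \<eta> + \<integral> \<bar>x\<bar>\<^bsup>\<gamma>\<^esup>\<close>, which
  therefore satisfies \<open>y' \<le> y\<^bsup>\<gamma>\<^esup>\<close>, that is, \<open>(\<phi>(y))' \<le> 1\<close>; subadditivity of \<open>\<phi>\<close> then splits off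
  the perturbation. The factor \<open>2\<close> comes from comparing the equation at the two times \<open>s\<close> and \<open>t\<close>.\<close>

lemma travel_time_growth:
  fixes x :: "real \<Rightarrow> real"
  assumes \<gamma>: "0 \<le> \<gamma>" "\<gamma> < 1" and x: "continuous_on {0..T} x" and "0 \<le> \<eta>"
    and eq: "\<And>t. t \<in> {0..T} \<Longrightarrow> \<bar>x t - (LBINT s:{0..t}. drift \<gamma> (x s))\<bar> \<le> \<eta>"
    and st: "0 \<le> s" "s \<le> t" "t \<le> T"
  shows "travel_time \<gamma> \<bar>x t\<bar> \<le> travel_time \<gamma> \<bar>x s\<bar> + travel_time \<gamma> (2 * \<eta>) + (t - s)"
proof -
  (* Freezing the path outside [0, T] gives a function that is continuous on the whole line. *)
  define z where "z r = x (max 0 (min T r))" for r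
  have z: "continuous_on A z" for A
    unfolding z_def using st by (intro continuous_on_compose2[OF x] continuous_intros) auto
  have zx: "z r = x r" if "r \<in> {0..T}" for r using that by (simp add: z_def)
  have main: "travel_time \<gamma> \<bar>x t\<bar> \<le> travel_time \<gamma> (\<bar>x s\<bar> + 2 * \<eta> + e) + (t - s)" if e: "0 < e" for e
  proof -
    (* Truncation at e makes the majorant of the drift continuous, which matters for gamma = 0,
       and keeps y away from 0, where the travel time is not differentiable. *)
    define p where "p r = (max \<bar>z r\<bar> e) powr \<gamma>" for r
    have p: "continuous_on A p" for A
      unfolding p_def using e by (intro continuous_intros z) auto
    define y where "y r = \<bar>x s\<bar> + 2 * \<eta> + e + integral {s..r} p" for r
    have p0: "0 \<le> p r" for r by (simp add: p_def)
    have int0: "0 \<le> integral {s..r} p" for r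
      by (intro integral_nonneg integrable_continuous_real p) (simp add: p0)
    have ybd: "\<bar>z r\<bar> \<le> y r" if r: "r \<in> {s..t}" for r
    proof -
      have di: "set_integrable lborel {0..r} (\<lambda>s. drift \<gamma> (x s))"
        using r st by (intro set_integrable_drift \<gamma> continuous_on_subset[OF x]) auto
      have pi: "set_integrable lborel {s..r} p"
        by (intro borel_integrable_atLeastAtMost' p)
      have "\<bar>LBINT q:{s..r}. drift \<gamma> (x q)\<bar> \<le> (LBINT q:{s..r}. \<bar>drift \<gamma> (x q)\<bar>)"
        using set_integral_norm_bound[of lborel "{s..r}" "\<lambda>q. drift \<gamma> (x q)"]
          set_integrable_subset[OF di, of "{s..r}"] st by auto
      also have "\<dots> \<le> (LBINT q:{s..r}. p q)"
      proof (rule set_integral_mono)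
        show "set_integrable lborel {s..r} (\<lambda>q. \<bar>drift \<gamma> (x q)\<bar>)"
          using st by (intro set_integrable_abs set_integrable_subset[OF di]) auto
        fix q assume "q \<in> {s..r}"
        then have "q \<in> {0..T}" using r st by auto
        then show "\<bar>drift \<gamma> (x q)\<bar> \<le> p q"
          using \<gamma> by (auto simp: abs_drift p_def zx intro!: powr_mono2)
      qed (fact pi)
      also have "\<dots> = integral {s..r} p"
        by (rule set_borel_integral_eq_integral(2)[OF pi])
      finally have 1: "\<bar>LBINT q:{s..r}. drift \<gamma> (x q)\<bar> \<le> integral {s..r} p" .
      have "(LBINT q:{0..r}. drift \<gamma> (x q)) = (LBINT q:{0..s}. drift \<gamma> (x q)) + (LBINT q:{s..r}. drift \<gamma> (x q))"
        using r st by (intro LBINT_Icc_split[OF di]) auto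
      with 1 eq[of s] eq[of r] r st have "\<bar>x r\<bar> \<le> \<bar>x s\<bar> + 2 * \<eta> + integral {s..r} p"
        by auto
      then show ?thesis using r st e by (simp add: y_def zx)
    qed
    have ypos: "e \<le> y r" for r using int0[of r] \<open>0 \<le> \<eta>\<close> by (simp add: y_def)
    have ycont: "continuous_on {s..t} y"
      unfolding y_def by (intro continuous_intros indefinite_integral_continuous_1 integrable_continuous_real p)
    have "s - travel_time \<gamma> (y s) \<le> t - travel_time \<gamma> (y t)"
    proof (rule DERIV_nonneg_imp_increasing_open[OF \<open>s \<le> t\<close>, where f="\<lambda>r. r - travel_time \<gamma> (y r)"])
      fix r assume r: "s < r" "r < t"
      have "((\<lambda>r. integral {s..r} p) has_real_derivative p r) (at r within {s..t})"
        using r by (intro integral_has_real_derivative p) auto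
      then have "((\<lambda>r. integral {s..r} p) has_real_derivative p r) (at r)"
        using r at_within_Icc_at[of s r t] by simp
      then have dy: "(y has_real_derivative p r) (at r)"
        unfolding y_def by (auto intro!: derivative_eq_intros)
      have y0: "0 < y r" using ypos[of r] e by simp
      have "((\<lambda>r. travel_time \<gamma> (y r)) has_real_derivative y r powr (- \<gamma>) * p r) (at r)"
        unfolding travel_time_def
        using \<gamma> DERIV_cdivide[OF DERIV_chain2[OF has_real_derivative_powr[OF y0, of "1 - \<gamma>"] dy], of "1 - \<gamma>"]
        by simp
      then have d: "((\<lambda>r. r - travel_time \<gamma> (y r)) has_real_derivative 1 - y r powr (- \<gamma>) * p r) (at r)"
        by (auto intro!: derivative_eq_intros)
      have "p r \<le> y r powr \<gamma>"
        unfolding p_def using ybd[of r] ypos[of r] e r \<gamma> by (intro powr_mono2) auto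
      then have "y r powr (- \<gamma>) * p r \<le> y r powr (- \<gamma>) * y r powr \<gamma>"
        by (intro mult_left_mono) auto
      also have "\<dots> = 1" using y0 by (simp add: powr_add[symmetric])
      finally show "\<exists>d. ((\<lambda>r. r - travel_time \<gamma> (y r)) has_real_derivative d) (at r) \<and> 0 \<le> d"
        using d by (intro exI conjI) auto
    next
      show "continuous_on {s..t} (\<lambda>r. r - travel_time \<gamma> (y r))"
        unfolding travel_time_def using e ypos \<gamma>
        by (intro continuous_intros ycont) (use less_le_trans[OF e ypos] in \<open>auto simp: less_imp_neq[THEN not_sym]\<close>)
    qed
    moreover have "travel_time \<gamma> \<bar>x t\<bar> \<le> travel_time \<gamma> (y t)"
      using ybd[of t] st \<gamma> by (intro travel_time_mono) (auto simp: zx)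
    moreover have "y s = \<bar>x s\<bar> + 2 * \<eta> + e" by (simp add: y_def)
    ultimately show ?thesis by auto
  qed
  have "travel_time \<gamma> \<bar>x t\<bar> \<le> travel_time \<gamma> \<bar>x s\<bar> + travel_time \<gamma> (2 * \<eta>) + (t - s) + travel_time \<gamma> e"
    if "0 < e" for e
    using main[OF that] travel_time_add_le[OF \<gamma>, of "\<bar>x s\<bar> + 2 * \<eta>" e]
      travel_time_add_le[OF \<gamma>, of "\<bar>x s\<bar>" "2 * \<eta>"] that \<open>0 \<le> \<eta>\<close> by simp
  moreover have "((\<lambda>e. travel_time \<gamma> \<bar>x s\<bar> + travel_time \<gamma> (2 * \<eta>) + (t - s) + travel_time \<gamma> e) \<longlongrightarrow>
     travel_time \<gamma> \<bar>x s\<bar> + travel_time \<gamma> (2 * \<eta>) + (t - s) + 0) (at_right 0)"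
  proof -
    have "eventually (\<lambda>e::real. 0 \<le> e) (at_right 0)"
      by (rule eventually_mono[OF eventually_at_right_less]) auto
    then have lim: "((\<lambda>e. e powr (1 - \<gamma>)) \<longlongrightarrow> 0 powr (1 - \<gamma>)) (at_right 0)"
      using \<gamma> by (intro tendsto_powr' tendsto_intros) auto
    then show ?thesis
      using tendsto_divide[OF lim tendsto_const[of "1 - \<gamma>"]] \<gamma>
      unfolding travel_time_def by (intro tendsto_intros) simp
  qed
  ultimately show ?thesis
    by (intro tendsto_lowerbound[where F="at_right 0"])
       (auto simp: eventually_at_right_field intro!: exI[of _ 1])
qed

section \<open>The mean exit time\<close>

text \<open>An antiderivative of the drift; for \<open>\<gamma> = 0\<close> it is \<open>\<bar>x\<bar>\<close>, with no derivative at \<open>0\<close>.\<close>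

definition potential :: "real \<Rightarrow> real \<Rightarrow> real" where
  "potential \<gamma> x = \<bar>x\<bar> powr (1 + \<gamma>) / (1 + \<gamma>)"

lemma potential_0 [simp]: "potential \<gamma> 0 = 0"
  by (simp add: potential_def)

lemma potential_minus [simp]: "potential \<gamma> (- x) = potential \<gamma> x"
  by (simp add: potential_def)

lemma potential_nonneg: "0 \<le> \<gamma> \<Longrightarrow> 0 \<le> potential \<gamma> x"
  by (simp add: potential_def)

lemma potential_pos: "0 \<le> \<gamma> \<Longrightarrow> x \<noteq> 0 \<Longrightarrow> 0 < potential \<gamma> x"
  by (simp add: potential_def)

lemma potential_mono: "0 \<le> \<gamma> \<Longrightarrow> 0 \<le> x \<Longrightarrow> x \<le> y \<Longrightarrow> potential \<gamma> x \<le> potential \<gamma> y"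
  unfolding potential_def by (intro divide_right_mono powr_mono2) auto

lemma potential_superadditive:
  "0 \<le> \<gamma> \<Longrightarrow> 0 \<le> x \<Longrightarrow> 0 \<le> y \<Longrightarrow> potential \<gamma> x + potential \<gamma> y \<le> potential \<gamma> (x + y)"
  using powr_superadditive[of x y "1 + \<gamma>"]
  by (simp add: potential_def add_divide_distrib[symmetric] divide_right_mono)

lemma continuous_potential: "0 \<le> \<gamma> \<Longrightarrow> continuous_on A (potential \<gamma>)"
  unfolding potential_def by (intro continuous_intros continuous_on_powr') auto

lemma continuous_exp_potential: "0 \<le> \<gamma> \<Longrightarrow> continuous_on UNIV (\<lambda>y. exp (k * potential \<gamma> y))"
  by (intro continuous_intros continuous_potential)

lemma DERIV_potential:
  assumes "0 \<le> \<gamma>" "x \<noteq> 0"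
  shows "(potential \<gamma> has_real_derivative drift \<gamma> x) (at x)"
proof -
  have *: "(potential \<gamma> has_real_derivative drift \<gamma> x) (at x)" if x: "0 < x" for x
  proof (rule has_field_derivative_transform_within_open)
    show "((\<lambda>x. x powr (1 + \<gamma>) / (1 + \<gamma>)) has_real_derivative drift \<gamma> x) (at x)"
      using DERIV_cdivide[OF has_real_derivative_powr[OF x, of "1 + \<gamma>"], of "1 + \<gamma>"] x assms
      by (simp add: drift_pos)
  qed (use x in \<open>auto simp: potential_def intro: open_greaterThan\<close>)
  show ?thesis
  proof (cases "0 < x")
    case False
    with assms have "0 < - x" by simp
    have "((\<lambda>y. potential \<gamma> (- y)) has_real_derivative drift \<gamma> (- x) * - 1) (at x)"
      by (rule DERIV_chain2[where f="potential \<gamma>" and g=uminus, OF *[OF \<open>0 < - x\<close>]])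
         (auto intro!: derivative_eq_intros)
    then show ?thesis
      by (simp add: drift_uminus)
  qed (fact *)
qed

text \<open>For \<open>c = 2 / \<epsilon>\<^sup>2\<close> this is the solution of \<open>b g + g' / c = 1\<close> with \<open>g(0) = 0\<close>. Its antiderivative \<open>u\<close>
  solves \<open>L u = 1\<close>, and \<open>u(r)\<close> is the mean time that the diffusion started in \<open>0\<close> needs to leave
  the interval from \<open>- r\<close> to \<open>r\<close>.\<close>

definition exit_slope :: "real \<Rightarrow> real \<Rightarrow> real \<Rightarrow> real" where
  "exit_slope \<gamma> c x = c * exp (- c * potential \<gamma> x) * antideriv (\<lambda>y. exp (c * potential \<gamma> y)) x"

definition exit_function :: "real \<Rightarrow> real \<Rightarrow> real \<Rightarrow> real" where
  "exit_function \<gamma> c = antideriv (exit_slope \<gamma> c)"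

context
  fixes \<gamma> c :: real
  assumes \<gamma>: "0 \<le> \<gamma>" "\<gamma> < 1" and c: "0 < c"
begin

private abbreviation G where "G \<equiv> antideriv (\<lambda>y. exp (c * potential \<gamma> y))"

lemma DERIV_antideriv_exp: "(G has_real_derivative exp (c * potential \<gamma> x)) (at x)"
  by (rule DERIV_antideriv[OF continuous_exp_potential[OF \<gamma>(1)]])

lemma antideriv_exp_0: "G 0 = 0"
  by (rule antideriv_0[OF continuous_exp_potential[OF \<gamma>(1)]])

lemma antideriv_exp_nonneg: "0 \<le> x \<Longrightarrow> 0 \<le> G x"
  using DERIV_le_imp_le[of 0 x "\<lambda>_. 0" "\<lambda>_. 0" G] DERIV_antideriv_exp antideriv_exp_0 by fastforce

lemma antideriv_exp_le:
  assumes "0 \<le> x" shows "G x \<le> x * exp (c * potential \<gamma> x)"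
proof -
  have "G x - G 0 \<le> x * exp (c * potential \<gamma> x) - 0 * exp (c * potential \<gamma> x)"
    by (rule DERIV_le_imp_le[OF assms DERIV_antideriv_exp])
       (use potential_mono[OF \<gamma>(1)] c in \<open>auto intro!: derivative_eq_intros\<close>)
  then show ?thesis by (simp add: antideriv_exp_0)
qed

lemma exit_slope_minus: "exit_slope \<gamma> c (- x) = - exit_slope \<gamma> c x"
  using antideriv_uminus[OF continuous_exp_potential[OF \<gamma>(1)], of c 1 x] by (simp add: exit_slope_def)

lemma exit_slope_nonneg: "0 \<le> x \<Longrightarrow> 0 \<le> exit_slope \<gamma> c x"
  using antideriv_exp_nonneg c by (simp add: exit_slope_def)

lemma exit_slope_le_linear:
  assumes "0 \<le> x" shows "exit_slope \<gamma> c x \<le> c * x"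
proof -
  have "exit_slope \<gamma> c x \<le> c * exp (- c * potential \<gamma> x) * (x * exp (c * potential \<gamma> x))"
    unfolding exit_slope_def using antideriv_exp_le[OF assms] c by (intro mult_left_mono) auto
  also have "\<dots> = c * x * (exp (- c * potential \<gamma> x) * exp (c * potential \<gamma> x))"
    by (simp only: mult_ac)
  also have "\<dots> = c * x" by (simp add: exp_add[symmetric])
  finally show ?thesis .
qed

text \<open>Both \<open>g\<close> and \<open>g' = c (1 - b g)\<close> have to be bounded, and this product decides it. On
  \<open>{0..x}\<close> the convex potential lies below its chord, which has slope \<open>k / c\<close> with
  \<open>k = c x\<^bsup>\<gamma>\<^esup> / (1 + \<gamma>)\<close>. So the integral of \<open>exp (c * potential \<gamma> y)\<close> over \<open>{0..x}\<close> is at most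
  \<open>exp (k x) / k = exp (c * potential \<gamma> x) / k\<close>, and the product is at most \<open>1 + \<gamma>\<close>.\<close>

lemma drift_exit_slope_bounds: "0 \<le> drift \<gamma> x * exit_slope \<gamma> c x \<and> drift \<gamma> x * exit_slope \<gamma> c x \<le> 2"
proof -
  have *: "0 \<le> drift \<gamma> x * exit_slope \<gamma> c x \<and> drift \<gamma> x * exit_slope \<gamma> c x \<le> 2" if x: "0 < x" for x
  proof
    show "0 \<le> drift \<gamma> x * exit_slope \<gamma> c x"
      using exit_slope_nonneg[of x] x by (simp add: drift_pos)

    define k where "k = c * x powr \<gamma> / (1 + \<gamma>)"
    have k: "0 < k" using x c \<gamma> by (simp add: k_def)
    have pot: "c * potential \<gamma> y \<le> k * y" if y: "0 \<le> y" "y \<le> x" for y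
    proof (cases "y = 0")
      case False
      have "y powr (1 + \<gamma>) = y powr \<gamma> * y" using False y by (simp add: powr_add)
      also have "\<dots> \<le> x powr \<gamma> * y" using y \<gamma> by (intro mult_right_mono powr_mono2) auto
      finally have "c * y powr (1 + \<gamma>) / (1 + \<gamma>) \<le> c * (x powr \<gamma> * y) / (1 + \<gamma>)"
        using c \<gamma> by (intro divide_right_mono mult_left_mono) auto
      then show ?thesis using y by (simp add: potential_def k_def)
    qed simp
    have "G x - G 0 \<le> exp (k * x) / k - exp (k * 0) / k"
    proof (rule DERIV_le_imp_le[OF less_imp_le[OF x] DERIV_antideriv_exp])
      show "((\<lambda>y. exp (k * y) / k) has_real_derivative exp (k * y)) (at y)" for y
        using k by (auto intro!: derivative_eq_intros)
    qed (use pot in auto)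
    also have "\<dots> \<le> exp (k * x) / k" using k by simp
    also have "k * x = c * potential \<gamma> x"
      using x by (simp add: k_def potential_def powr_add)
    finally have "k * G x \<le> exp (c * potential \<gamma> x)" using k by (simp add: antideriv_exp_0 field_simps)
    then have "k * (exp (- c * potential \<gamma> x) * G x) \<le> exp (- c * potential \<gamma> x) * exp (c * potential \<gamma> x)"
      by (metis mult.left_commute mult_left_mono exp_ge_zero)
    also have "\<dots> = 1" by (simp add: exp_add[symmetric])
    finally have "(1 + \<gamma>) * (k * (exp (- c * potential \<gamma> x) * G x)) \<le> 1 + \<gamma>"
      using \<gamma> by simp
    moreover have "drift \<gamma> x * exit_slope \<gamma> c x = (1 + \<gamma>) * (k * (exp (- c * potential \<gamma> x) * G x))"
      using x \<gamma> by (simp add: k_def drift_pos exit_slope_def)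
    ultimately show "drift \<gamma> x * exit_slope \<gamma> c x \<le> 2" using \<gamma> by linarith
  qed
  then show ?thesis
    using *[of "- x"] by (cases "x > 0"; cases "x = 0") (auto simp: drift_uminus exit_slope_minus)
qed

lemma abs_exit_slope_le_linear: "\<bar>exit_slope \<gamma> c x\<bar> \<le> c * \<bar>x\<bar>"
  using exit_slope_le_linear[of "\<bar>x\<bar>"] exit_slope_nonneg[of "\<bar>x\<bar>"] exit_slope_minus[of "- x"]
  by (cases "0 \<le> x") auto

lemma exit_slope_bounded: "\<bar>exit_slope \<gamma> c x\<bar> \<le> c + 2"
proof (cases "\<bar>x\<bar> \<le> 1")
  case True
  then have "c * \<bar>x\<bar> \<le> c * 1" using c by (intro mult_left_mono) auto
  then show ?thesis
    using abs_exit_slope_le_linear[of x] by linarith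
next
  case False
  then have "1 \<le> \<bar>drift \<gamma> x\<bar>" using \<gamma> by (simp add: abs_drift ge_one_powr_ge_zero)
  then have "1 * \<bar>exit_slope \<gamma> c x\<bar> \<le> \<bar>drift \<gamma> x\<bar> * \<bar>exit_slope \<gamma> c x\<bar>"
    by (intro mult_right_mono) auto
  also have "\<dots> \<le> 2" using drift_exit_slope_bounds[of x] by (simp add: abs_mult[symmetric])
  finally show ?thesis using c by simp
qed

text \<open>The factor \<open>exp (- c * potential \<gamma> x)\<close> may fail to be differentiable at \<open>0\<close>, but there it is only
  multiplied by an antiderivative that vanishes, so that its continuity suffices. This makes
  \<open>u\<close> twice continuously differentiable even for \<open>\<gamma> = 0\<close>.\<close>

lemma DERIV_exit_slope:
  "(exit_slope \<gamma> c has_real_derivative c * (1 - drift \<gamma> x * exit_slope \<gamma> c x)) (at x)"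
proof (cases "x = 0")
  case False
  have "(exit_slope \<gamma> c has_real_derivative
      c * (exp (- c * potential \<gamma> x) * (- c * drift \<gamma> x)) * G x +
      c * exp (- c * potential \<gamma> x) * exp (c * potential \<gamma> x)) (at x)"
    unfolding exit_slope_def
    by (auto intro!: derivative_eq_intros DERIV_antideriv_exp DERIV_potential[OF \<gamma>(1) False])
  moreover have "exp (- c * potential \<gamma> x) * exp (c * potential \<gamma> x) = 1"
    by (simp add: exp_add[symmetric])
  ultimately show ?thesis
    by (simp add: exit_slope_def algebra_simps)
next
  case True
  have 1: "((\<lambda>h. G h / h) \<longlongrightarrow> 1) (at 0)"
    using DERIV_antideriv_exp[of 0] by (simp add: has_field_derivative_iff antideriv_exp_0)
  have "((\<lambda>h. c * exp (- c * potential \<gamma> h)) \<longlongrightarrow> c * exp (- c * potential \<gamma> 0)) (at 0)"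
    using continuous_potential[OF \<gamma>(1), of UNIV]
    by (intro tendsto_intros) (simp add: continuous_on_eq_continuous_at isCont_def del: potential_0)
  from tendsto_mult[OF this 1] show ?thesis
    using True by (simp add: has_field_derivative_iff exit_slope_def antideriv_exp_0)
qed

lemma continuous_exit_slope: "continuous_on A (exit_slope \<gamma> c)"
  by (meson DERIV_exit_slope DERIV_isCont continuous_at_imp_continuous_on)

lemma continuous_drift_exit_slope: "continuous_on UNIV (\<lambda>x. drift \<gamma> x * exit_slope \<gamma> c x)"
  unfolding continuous_on_eq_continuous_at[OF open_UNIV]
proof
  fix x :: real
  show "isCont (\<lambda>x. drift \<gamma> x * exit_slope \<gamma> c x) x"
  proof (cases "x = 0")
    case False
    have "continuous_on (- {0}) (\<lambda>x. drift \<gamma> x * exit_slope \<gamma> c x)"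
      unfolding drift_def by (intro continuous_intros continuous_exit_slope) auto
    then show ?thesis
      using False by (simp add: continuous_on_eq_continuous_at open_Compl)
  next
    case True
    have "((\<lambda>x. drift \<gamma> x * exit_slope \<gamma> c x) \<longlongrightarrow> 0) (at 0)"
    proof (rule Lim_null_comparison)
      show "((\<lambda>x. (1 + \<bar>x\<bar>) * (c * \<bar>x\<bar>)) \<longlongrightarrow> 0) (at 0)"
        by (auto intro!: tendsto_eq_intros)
      show "\<forall>\<^sub>F x in at 0. norm (drift \<gamma> x * exit_slope \<gamma> c x) \<le> (1 + \<bar>x\<bar>) * (c * \<bar>x\<bar>)"
        using abs_drift_le[OF \<gamma>] abs_exit_slope_le_linear
        by (intro always_eventually) (auto simp: abs_mult intro!: mult_mono)
    qed
    then show ?thesis using True by (simp add: isCont_def)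
  qed
qed

lemma DERIV_exit_function: "(exit_function \<gamma> c has_real_derivative exit_slope \<gamma> c x) (at x)"
  unfolding exit_function_def by (rule DERIV_antideriv[OF continuous_exit_slope])

lemma exit_function_0: "exit_function \<gamma> c 0 = 0"
  unfolding exit_function_def by (rule antideriv_0[OF continuous_exit_slope])

text \<open>For \<open>x > 0\<close> let \<open>k = \<phi> - u - x\<^bsup>-\<gamma>\<^esup> g / c\<close>. From \<open>g' / c = 1 - x\<^bsup>\<gamma>\<^esup> g\<close> all terms of \<open>k'\<close> cancel except
  \<open>\<gamma> x\<^bsup>-\<gamma>-1\<^esup> g / c \<ge> 0\<close>, and \<open>k\<close> vanishes at \<open>0\<close>. Hence \<open>\<phi> - u \<ge> x\<^bsup>-\<gamma>\<^esup> g / c \<ge> 0\<close>. The inequality holds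
  although \<open>g\<close> itself exceeds \<open>\<phi>' = x\<^bsup>-\<gamma>\<^esup>\<close> for large \<open>x\<close> if \<open>\<gamma> > 0\<close>.\<close>

lemma exit_function_le_travel_time: "exit_function \<gamma> c x \<le> travel_time \<gamma> \<bar>x\<bar>"
proof -
  have *: "exit_function \<gamma> c x \<le> travel_time \<gamma> x" if x: "0 < x" for x
  proof -
    define k where "k y = travel_time \<gamma> y - exit_function \<gamma> c y - y powr (- \<gamma>) * exit_slope \<gamma> c y / c" for y
    have low: "- exit_function \<gamma> c a - a powr (1 - \<gamma>) \<le> k x" if a: "0 < a" "a \<le> x" for a
    proof -
      have "k a \<le> k x"
      proof (rule DERIV_nonneg_imp_nondecreasing[OF \<open>a \<le> x\<close>])
        fix y assume "a \<le> y" "y \<le> x"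
        then have y: "0 < y" using a by simp
        let ?g = "exit_slope \<gamma> c y"
        have d1: "(travel_time \<gamma> has_real_derivative y powr (- \<gamma>)) (at y)"
          unfolding travel_time_def
          using DERIV_cdivide[OF has_real_derivative_powr[OF y, of "1 - \<gamma>"], of "1 - \<gamma>"] \<gamma> by simp
        have d2: "((\<lambda>y. y powr (- \<gamma>)) has_real_derivative (- \<gamma>) * y powr (- \<gamma> - 1)) (at y)"
          by (rule has_real_derivative_powr[OF y])
        have "(k has_real_derivative y powr (- \<gamma>) - ?g
            - ((- \<gamma>) * y powr (- \<gamma> - 1) * ?g + c * (1 - drift \<gamma> y * ?g) * y powr (- \<gamma>)) / c) (at y)"
          unfolding k_def
          by (intro DERIV_diff DERIV_cdivide DERIV_mult d1 d2 DERIV_exit_function DERIV_exit_slope)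
        moreover have "y powr (- \<gamma>) - ?g
            - ((- \<gamma>) * y powr (- \<gamma> - 1) * ?g + c * (1 - drift \<gamma> y * ?g) * y powr (- \<gamma>)) / c
            = \<gamma> * y powr (- \<gamma> - 1) * ?g / c - ?g * (1 - drift \<gamma> y * y powr (- \<gamma>))"
          using c by (simp add: field_simps)
        moreover have "drift \<gamma> y * y powr (- \<gamma>) = 1"
          using y by (simp add: drift_pos powr_add[symmetric])
        ultimately have "(k has_real_derivative \<gamma> * y powr (- \<gamma> - 1) * ?g / c) (at y)"
          by simp
        moreover have "0 \<le> \<gamma> * y powr (- \<gamma> - 1) * ?g / c"
          using exit_slope_nonneg[of y] y \<gamma> c by simp
        ultimately show "\<exists>d. (k has_real_derivative d) (at y) \<and> 0 \<le> d" by blast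
      qed
      moreover have "a powr (- \<gamma>) * exit_slope \<gamma> c a \<le> a powr (- \<gamma>) * (c * a)"
        using exit_slope_le_linear[of a] a by (intro mult_left_mono) auto
      then have "a powr (- \<gamma>) * exit_slope \<gamma> c a / c \<le> a powr (1 - \<gamma>)"
        using c a by (simp add: field_simps powr_diff powr_minus)
      ultimately show ?thesis
        using travel_time_nonneg[OF \<gamma>(2), of a] by (simp add: k_def)
    qed
    have "((\<lambda>a. - exit_function \<gamma> c a - a powr (1 - \<gamma>)) \<longlongrightarrow> - 0 - 0 powr (1 - \<gamma>)) (at_right 0)"
    proof (intro tendsto_intros tendsto_powr')
      show "(exit_function \<gamma> c \<longlongrightarrow> 0) (at_right 0)"
        using DERIV_isCont[OF DERIV_exit_function[of 0]]
        by (simp add: isCont_def exit_function_0 filterlim_at_split)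
      show "0 \<noteq> (0::real) \<or> 0 < 1 - \<gamma> \<and> (\<forall>\<^sub>F x::real in at_right 0. 0 \<le> x)"
        using \<gamma> by (auto intro!: eventually_mono[OF eventually_at_right_less])
    qed
    then have "0 \<le> k x"
      using low x by (intro tendsto_upperbound[where F="at_right 0"])
        (auto simp: eventually_at_right_field intro!: exI[of _ x])
    moreover have "0 \<le> x powr (- \<gamma>) * exit_slope \<gamma> c x / c"
      using exit_slope_nonneg[of x] x c by simp
    ultimately show ?thesis by (simp add: k_def)
  qed
  have "exit_function \<gamma> c (- x) = exit_function \<gamma> c x"
    using antideriv_uminus[OF continuous_exit_slope, of "-1"] by (simp add: exit_function_def exit_slope_minus)
  then show ?thesis
    using *[of x] *[of "- x"] by (cases "x = 0"; cases "0 < x") (auto simp: exit_function_0)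
qed

end

section \<open>The scale function and its smooth approximations\<close>

lemma power2_powr_half: "(x\<^sup>2) powr (p / 2) = \<bar>x\<bar> powr (p::real)"
proof (cases "x = 0")
  case False
  have "(x\<^sup>2) powr (p / 2) = (\<bar>x\<bar> powr 2) powr (p / 2)"
    using False by (simp add: powr_numeral)
  also have "\<dots> = \<bar>x\<bar> powr p"
    by (simp only: powr_powr) simp
  finally show ?thesis .
qed simp

text \<open>The function \<open>\<bar>x\<bar>\<close> is replaced by \<open>sqrt (x\<^sup>2 + \<delta>\<^sup>2)\<close> in the potential; \<open>smooth_drift\<close> is the derivative.\<close>

definition smooth_potential :: "real \<Rightarrow> real \<Rightarrow> real \<Rightarrow> real" where
  "smooth_potential \<gamma> \<delta> x = (x\<^sup>2 + \<delta>\<^sup>2) powr ((1 + \<gamma>) / 2) / (1 + \<gamma>)"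

definition smooth_drift :: "real \<Rightarrow> real \<Rightarrow> real \<Rightarrow> real" where
  "smooth_drift \<gamma> \<delta> x = x * (x\<^sup>2 + \<delta>\<^sup>2) powr ((\<gamma> - 1) / 2)"

text \<open>For \<open>c = 2 / \<epsilon>\<^sup>2\<close> and \<open>x \<noteq> 0\<close> this solves \<open>b s' + s'' / c = 0\<close>.\<close>

definition scale_function :: "real \<Rightarrow> real \<Rightarrow> real \<Rightarrow> real" where
  "scale_function \<gamma> c = antideriv (\<lambda>y. exp (- c * potential \<gamma> y))"

definition smooth_scale_function :: "real \<Rightarrow> real \<Rightarrow> real \<Rightarrow> real \<Rightarrow> real" where
  "smooth_scale_function \<gamma> c \<delta> = antideriv (\<lambda>y. exp (- c * smooth_potential \<gamma> \<delta> y))"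

context
  fixes \<gamma> :: real
  assumes \<gamma>: "0 \<le> \<gamma>" "\<gamma> < 1"
begin

lemma DERIV_smooth_potential:
  assumes "0 < \<delta>"
  shows "(smooth_potential \<gamma> \<delta> has_real_derivative smooth_drift \<gamma> \<delta> x) (at x)"
proof -
  have pos: "0 < x\<^sup>2 + \<delta>\<^sup>2" using assms by (intro add_nonneg_pos) auto
  have "((\<lambda>x. x\<^sup>2 + \<delta>\<^sup>2) has_real_derivative 2 * x) (at x)"
    by (auto intro!: derivative_eq_intros)
  from DERIV_cdivide[OF DERIV_chain2[OF has_real_derivative_powr[OF pos, of "(1 + \<gamma>) / 2"] this], of "1 + \<gamma>"]
  have "(smooth_potential \<gamma> \<delta> has_real_derivative
     (1 + \<gamma>) / 2 * (x\<^sup>2 + \<delta>\<^sup>2) powr ((1 + \<gamma>) / 2 - 1) * (2 * x) / (1 + \<gamma>)) (at x)"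
    unfolding smooth_potential_def .
  moreover have "(1 + \<gamma>) / 2 - 1 = (\<gamma> - 1) / 2" by (simp add: field_simps)
  ultimately show ?thesis
    using \<gamma> by (simp add: smooth_drift_def mult.commute)
qed

lemma continuous_smooth_drift: "0 < \<delta> \<Longrightarrow> continuous_on A (smooth_drift \<gamma> \<delta>)"
  unfolding smooth_drift_def
  by (intro continuous_intros) (auto simp: sum_power2_eq_zero_iff)

lemma continuous_smooth_potential: "0 < \<delta> \<Longrightarrow> continuous_on A (smooth_potential \<gamma> \<delta>)"
  by (meson DERIV_smooth_potential DERIV_isCont continuous_at_imp_continuous_on)

lemma smooth_drift_bounds:
  assumes "0 < \<delta>"
  shows "\<bar>smooth_drift \<gamma> \<delta> x\<bar> \<le> \<bar>drift \<gamma> x\<bar>" "\<bar>drift \<gamma> x - smooth_drift \<gamma> \<delta> x\<bar> \<le> \<bar>drift \<gamma> x\<bar>"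
proof -
  have *: "smooth_drift \<gamma> \<delta> x \<le> x powr \<gamma>" if "0 < x" for x
  proof -
    have "(x\<^sup>2 + \<delta>\<^sup>2) powr ((\<gamma> - 1) / 2) \<le> (x\<^sup>2) powr ((\<gamma> - 1) / 2)"
      using that \<gamma> by (intro powr_mono2') auto
    also have "(x\<^sup>2) powr ((\<gamma> - 1) / 2) = x powr (\<gamma> - 1)"
      using that by (simp only: power2_powr_half abs_of_pos)
    finally have "smooth_drift \<gamma> \<delta> x \<le> x * x powr (\<gamma> - 1)"
      unfolding smooth_drift_def using that by (intro mult_left_mono) auto
    also have "\<dots> = x powr \<gamma>"
      using that by (simp add: powr_diff)
    finally show ?thesis .
  qed
  have m: "smooth_drift \<gamma> \<delta> (- x) = - smooth_drift \<gamma> \<delta> x" for x by (simp add: smooth_drift_def)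
  have nn: "0 < x \<Longrightarrow> 0 \<le> smooth_drift \<gamma> \<delta> x" for x by (simp add: smooth_drift_def)
  show "\<bar>smooth_drift \<gamma> \<delta> x\<bar> \<le> \<bar>drift \<gamma> x\<bar>" "\<bar>drift \<gamma> x - smooth_drift \<gamma> \<delta> x\<bar> \<le> \<bar>drift \<gamma> x\<bar>"
    using *[of x] *[of "- x"] nn[of x] nn[of "- x"] m[of x] drift_pos[of x \<gamma>] drift_pos[of "- x" \<gamma>]
      drift_uminus[of \<gamma> x]
    by (cases "x = 0"; cases "0 < x"; simp add: smooth_drift_def)+
qed

lemma smooth_drift_tendsto: "(\<lambda>n. smooth_drift \<gamma> (1 / real (Suc n)) x) \<longlonglongrightarrow> drift \<gamma> x"
proof (cases "x = 0")
  case False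
  have "(\<lambda>n. x * (x\<^sup>2 + (1 / real (Suc n))\<^sup>2) powr ((\<gamma> - 1) / 2)) \<longlonglongrightarrow> x * (x\<^sup>2 + 0\<^sup>2) powr ((\<gamma> - 1) / 2)"
    using False by (intro tendsto_intros LIMSEQ_Suc lim_const_over_n) auto
  moreover have "x * (x\<^sup>2 + 0\<^sup>2) powr ((\<gamma> - 1) / 2) = drift \<gamma> x"
  proof -
    have "(x\<^sup>2) powr ((\<gamma> - 1) / 2) = \<bar>x\<bar> powr (\<gamma> - 1)"
      by (rule power2_powr_half)
    then show ?thesis
      using False by (simp add: drift_def powr_diff sgn_if)
  qed
  ultimately show ?thesis unfolding smooth_drift_def by simp
qed (simp add: smooth_drift_def)

lemma smooth_potential_bounds:
  assumes "0 < \<delta>"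
  shows "potential \<gamma> x \<le> smooth_potential \<gamma> \<delta> x" "smooth_potential \<gamma> \<delta> x \<le> potential \<gamma> x + potential \<gamma> \<delta>"
proof -
  have e: "potential \<gamma> y = (y\<^sup>2) powr ((1 + \<gamma>) / 2) / (1 + \<gamma>)" for y
    by (simp only: power2_powr_half potential_def)
  show "potential \<gamma> x \<le> smooth_potential \<gamma> \<delta> x"
    unfolding e smooth_potential_def using \<gamma> by (intro divide_right_mono powr_mono2) auto
  show "smooth_potential \<gamma> \<delta> x \<le> potential \<gamma> x + potential \<gamma> \<delta>"
    unfolding e smooth_potential_def add_divide_distrib[symmetric]
    using \<gamma> by (intro divide_right_mono powr_subadditive) auto
qed

end

context
  fixes \<gamma> c :: real
  assumes \<gamma>: "0 \<le> \<gamma>" "\<gamma> < 1" and c: "0 < c"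
begin

lemma continuous_exp_smooth_potential: "0 < \<delta> \<Longrightarrow> continuous_on UNIV (\<lambda>y. exp (- c * smooth_potential \<gamma> \<delta> y))"
  by (intro continuous_intros continuous_smooth_potential \<gamma>)

lemma DERIV_scale_function: "(scale_function \<gamma> c has_real_derivative exp (- c * potential \<gamma> x)) (at x)"
  unfolding scale_function_def by (rule DERIV_antideriv[OF continuous_exp_potential[OF \<gamma>(1)]])

lemma scale_function_0: "scale_function \<gamma> c 0 = 0"
  unfolding scale_function_def by (rule antideriv_0[OF continuous_exp_potential[OF \<gamma>(1)]])

lemma scale_function_minus: "scale_function \<gamma> c (- x) = - scale_function \<gamma> c x"
  using antideriv_uminus[OF continuous_exp_potential[OF \<gamma>(1)], of "- c" 1 x] by (simp add: scale_function_def)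

lemma DERIV_smooth_scale_function:
  "0 < \<delta> \<Longrightarrow> (smooth_scale_function \<gamma> c \<delta> has_real_derivative exp (- c * smooth_potential \<gamma> \<delta> x)) (at x)"
  unfolding smooth_scale_function_def by (rule DERIV_antideriv[OF continuous_exp_smooth_potential])

lemma smooth_scale_function_0: "0 < \<delta> \<Longrightarrow> smooth_scale_function \<gamma> c \<delta> 0 = 0"
  unfolding smooth_scale_function_def by (rule antideriv_0[OF continuous_exp_smooth_potential])

lemma smooth_scale_function_minus:
  "0 < \<delta> \<Longrightarrow> smooth_scale_function \<gamma> c \<delta> (- x) = - smooth_scale_function \<gamma> c \<delta> x"
  using antideriv_uminus[OF continuous_exp_smooth_potential, of \<delta> 1]
  by (simp add: smooth_scale_function_def smooth_potential_def)

lemma scale_function_mono: "x \<le> y \<Longrightarrow> scale_function \<gamma> c x \<le> scale_function \<gamma> c y"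
  using DERIV_le_imp_le[of x y "\<lambda>_. 0" "\<lambda>_. 0" "scale_function \<gamma> c"] DERIV_scale_function by fastforce

lemma scale_function_pos: assumes "0 < x" shows "0 < scale_function \<gamma> c x"
proof -
  have "scale_function \<gamma> c 0 < scale_function \<gamma> c x"
    by (rule DERIV_pos_imp_increasing[OF assms]) (use DERIV_scale_function in force)
  then show ?thesis by (simp add: scale_function_0)
qed

text \<open>Superadditivity of the potential gives \<open>s' (x0 + y) \<le> q * s' y\<close> with \<open>q = exp (- c * potential \<gamma> x0)\<close>, so
  that \<open>s (x0 + x) - s x0 \<le> q * s x \<le> q * s (x0 + x)\<close>. As \<open>c\<close> grows, \<open>q\<close> tends to \<open>0\<close>, and \<open>s / s x0\<close>
  tends to the sign function, uniformly outside the interval from \<open>- x0\<close> to \<open>x0\<close>.\<close>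

lemma scale_function_upper:
  assumes x0: "0 < x0"
  shows "(1 - exp (- c * potential \<gamma> x0)) * \<bar>scale_function \<gamma> c x\<bar> \<le> scale_function \<gamma> c x0"
proof -
  let ?s = "scale_function \<gamma> c" and ?q = "exp (- c * potential \<gamma> x0)"
  have q: "0 \<le> ?q" "?q \<le> 1" using c potential_nonneg[OF \<gamma>(1)] by auto
  have *: "(1 - ?q) * ?s x \<le> ?s x0" if x: "0 \<le> x" for x
  proof -
    have "?s (x0 + x) - ?s (x0 + 0) \<le> ?q * ?s x - ?q * ?s 0"
    proof (rule DERIV_le_imp_le[OF x])
      show "((\<lambda>y. ?s (x0 + y)) has_real_derivative exp (- c * potential \<gamma> (x0 + y))) (at y)" for y
        using DERIV_chain2[OF DERIV_scale_function, of "\<lambda>y. x0 + y" 1 y UNIV]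
          DERIV_add[OF DERIV_const DERIV_ident, of x0 y UNIV] by simp
      show "((\<lambda>y. ?q * ?s y) has_real_derivative ?q * exp (- c * potential \<gamma> y)) (at y)" for y
        by (intro DERIV_cmult DERIV_scale_function)
      show "exp (- c * potential \<gamma> (x0 + y)) \<le> ?q * exp (- c * potential \<gamma> y)" if "0 \<le> y" for y
        using mult_left_mono[OF potential_superadditive[OF \<gamma>(1), of x0 y] less_imp_le[OF c]] x0 that
        by (simp add: exp_add[symmetric] distrib_left)
    qed
    moreover have "?s x \<le> ?s (x0 + x)" using x0 by (intro scale_function_mono) simp
    ultimately show ?thesis using scale_function_0 by (simp add: algebra_simps)
  qed
  have "\<bar>?s x\<bar> = ?s \<bar>x\<bar>"
    using scale_function_mono[of 0 "\<bar>x\<bar>"] scale_function_minus[of x] scale_function_0 by (cases "0 \<le> x") auto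
  then show ?thesis using *[of "\<bar>x\<bar>"] by simp
qed

lemma smooth_scale_function_bounds:
  assumes \<delta>: "0 < \<delta>" and x: "0 \<le> x"
  shows "smooth_scale_function \<gamma> c \<delta> x \<le> scale_function \<gamma> c x"
    and "exp (- c * potential \<gamma> \<delta>) * scale_function \<gamma> c x \<le> smooth_scale_function \<gamma> c \<delta> x"
    and "scale_function \<gamma> c x \<le> x" "0 \<le> smooth_scale_function \<gamma> c \<delta> x"
proof -
  show "smooth_scale_function \<gamma> c \<delta> x \<le> scale_function \<gamma> c x"
    using DERIV_le_imp_le[OF x DERIV_smooth_scale_function[OF \<delta>] DERIV_scale_function]
      smooth_potential_bounds[OF \<gamma> \<delta>] c smooth_scale_function_0[OF \<delta>] scale_function_0 by simp
  have "exp (- c * potential \<gamma> \<delta>) * scale_function \<gamma> c x - exp (- c * potential \<gamma> \<delta>) * scale_function \<gamma> c 0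
     \<le> smooth_scale_function \<gamma> c \<delta> x - smooth_scale_function \<gamma> c \<delta> 0"
    by (rule DERIV_le_imp_le[OF x DERIV_cmult[OF DERIV_scale_function] DERIV_smooth_scale_function[OF \<delta>]])
      (use mult_left_mono[OF smooth_potential_bounds(2)[OF \<gamma> \<delta>] less_imp_le[OF c]] in
        \<open>simp add: exp_add[symmetric] distrib_left algebra_simps\<close>)
  then show "exp (- c * potential \<gamma> \<delta>) * scale_function \<gamma> c x \<le> smooth_scale_function \<gamma> c \<delta> x"
    by (simp add: smooth_scale_function_0[OF \<delta>] scale_function_0)
  show "scale_function \<gamma> c x \<le> x"
    using DERIV_le_imp_le[OF x DERIV_scale_function DERIV_ident] c potential_nonneg[OF \<gamma>(1)] scale_function_0 by simp
  show "0 \<le> smooth_scale_function \<gamma> c \<delta> x"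
    using DERIV_le_imp_le[OF x DERIV_const DERIV_smooth_scale_function[OF \<delta>]] smooth_scale_function_0[OF \<delta>] by simp
qed

lemma abs_smooth_scale_function_le: "0 < \<delta> \<Longrightarrow> \<bar>smooth_scale_function \<gamma> c \<delta> x\<bar> \<le> \<bar>x\<bar>"
  using smooth_scale_function_bounds[of \<delta> "\<bar>x\<bar>"] smooth_scale_function_minus[of \<delta> x]
  by (cases "0 \<le> x") auto

lemma smooth_scale_function_tendsto:
  "(\<lambda>n. smooth_scale_function \<gamma> c (1 / real (Suc n)) x) \<longlonglongrightarrow> scale_function \<gamma> c x"
proof -
  have *: "(\<lambda>n. smooth_scale_function \<gamma> c (1 / real (Suc n)) x) \<longlonglongrightarrow> scale_function \<gamma> c x" if "0 \<le> x" for x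
  proof (rule tendsto_sandwich)
    have "(\<lambda>n. potential \<gamma> (1 / real (Suc n))) \<longlonglongrightarrow> potential \<gamma> 0"
      using continuous_potential[OF \<gamma>(1), of UNIV]
      by (intro isCont_tendsto_compose[of 0 "potential \<gamma>"] LIMSEQ_Suc lim_const_over_n)
        (auto simp: continuous_on_eq_continuous_at)
    then have "(\<lambda>n. exp (- c * potential \<gamma> (1 / real (Suc n))) * scale_function \<gamma> c x)
        \<longlonglongrightarrow> exp (- c * potential \<gamma> 0) * scale_function \<gamma> c x"
      by (intro tendsto_intros)
    then show "(\<lambda>n. exp (- c * potential \<gamma> (1 / real (Suc n))) * scale_function \<gamma> c x) \<longlonglongrightarrow> scale_function \<gamma> c x"
      by simp
    show "\<forall>\<^sub>F n in sequentially. exp (- c * potential \<gamma> (1 / real (Suc n))) * scale_function \<gamma> c x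
        \<le> smooth_scale_function \<gamma> c (1 / real (Suc n)) x"
      by (intro always_eventually allI smooth_scale_function_bounds that) simp
    show "\<forall>\<^sub>F n in sequentially. smooth_scale_function \<gamma> c (1 / real (Suc n)) x \<le> scale_function \<gamma> c x"
      by (intro always_eventually allI smooth_scale_function_bounds that) simp
  qed (rule tendsto_const)
  show ?thesis
  proof (cases "0 \<le> x")
    case False
    have "smooth_scale_function \<gamma> c (1 / real (Suc n)) (- x) = - smooth_scale_function \<gamma> c (1 / real (Suc n)) x" for n
      by (rule smooth_scale_function_minus) simp
    then show ?thesis
      using tendsto_minus[OF *[of "- x"]] False by (simp add: scale_function_minus del: of_nat_Suc)
  qed (fact *)
qed

end

section \<open>Increments and maximum of the Brownian motion\<close>

context brownian_motion
begin

lemma F_measurable_imp: "Y \<in> borel_measurable (F t) \<Longrightarrow> Y \<in> borel_measurable M"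
  using measurable_from_subalg[OF subalgebra_F] .

lemma F_measurable_mono: "Y \<in> borel_measurable (F s) \<Longrightarrow> s \<le> t \<Longrightarrow> Y \<in> borel_measurable (F t)"
  using sets_F_mono[of s t] space_F by (auto simp: measurable_def)

lemma W_measurable: "t \<in> {0..T} \<Longrightarrow> W t \<in> borel_measurable M"
  using F_measurable_imp[OF W_adapted] .

lemma indep_var_increment:
  assumes Y: "Y \<in> borel_measurable (F s)" and st: "0 \<le> s" "s < t" "t \<le> T"
  shows "indep_var borel Y borel (\<lambda>\<omega>. W t \<omega> - W s \<omega>)"
proof -
  let ?A = "{Y -` A \<inter> space M |A. A \<in> sets borel}"
    and ?B = "{(\<lambda>\<omega>. W t \<omega> - W s \<omega>) -` A \<inter> space M |A. A \<in> sets borel}"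
  have stable: "Int_stable {f -` A \<inter> space M |A. A \<in> sets borel}" for f :: "_ \<Rightarrow> real"
  proof (safe intro!: Int_stableI)
    fix A B :: "real set" assume "A \<in> sets borel" "B \<in> sets borel"
    then show "\<exists>C. (f -` A \<inter> space M) \<inter> (f -` B \<inter> space M) = (f -` C \<inter> space M) \<and> C \<in> sets borel"
      by (intro exI[of _ "A \<inter> B"]) auto
  qed
  have "?A \<subseteq> sets (F s)"
    using measurable_sets[OF Y] by (auto simp: space_F)
  with W_increment_indep[OF st] have "indep_set ?A ?B"
    unfolding indep_sets2_eq by blast
  then show ?thesis
    unfolding indep_var_eq using F_measurable_imp[OF Y] W_measurable[of s] W_measurable[of t] st
    by (intro conjI indep_set_sigma_sets stable) auto
qed

lemma normalised_increment_distr: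
  assumes st: "0 \<le> s" "s < t" "t \<le> T"
  shows "distr M borel (\<lambda>\<omega>. (W t \<omega> - W s \<omega>) / sqrt (t - s)) = std_normal_distribution"
proof -
  have "distributed M lborel (\<lambda>\<omega>. (W t \<omega> - W s \<omega> - 0) / sqrt (t - s)) std_normal_density"
    using W_increment_normal[OF st] st by (subst (asm) normal_standard_normal_convert) auto
  then have "distr M lborel (\<lambda>\<omega>. (W t \<omega> - W s \<omega>) / sqrt (t - s)) = std_normal_distribution"
    by (simp add: distributed_distr_eq_density)
  moreover have "distr M lborel (\<lambda>\<omega>. (W t \<omega> - W s \<omega>) / sqrt (t - s))
      = distr M borel (\<lambda>\<omega>. (W t \<omega> - W s \<omega>) / sqrt (t - s))"
    by (rule distr_cong) auto
  ultimately show ?thesis by simp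
qed

text \<open>A variable known at time \<open>s\<close> may be frozen while the normalised increment after \<open>s\<close> is integrated
  out, since the joint law of the two is a product.\<close>

lemma expectation_freeze:
  fixes h :: "real \<times> real \<Rightarrow> real"
  assumes Y: "Y \<in> borel_measurable (F s)" and st: "0 \<le> s" "s < t" "t \<le> T"
    and h: "h \<in> borel_measurable (borel \<Otimes>\<^sub>M borel)"
    and int: "integrable M (\<lambda>\<omega>. h (Y \<omega>, (W t \<omega> - W s \<omega>) / sqrt (t - s)))"
  shows "(\<integral>\<omega>. h (Y \<omega>, (W t \<omega> - W s \<omega>) / sqrt (t - s)) \<partial>M)
       = (\<integral>\<omega>. (\<integral>z. h (Y \<omega>, z) \<partial>std_normal_distribution) \<partial>M)"
proof -
  let ?Z = "\<lambda>\<omega>. (W t \<omega> - W s \<omega>) / sqrt (t - s)" and ?N = "std_normal_distribution"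
  have [measurable]: "Y \<in> borel_measurable M" "W s \<in> borel_measurable M" "W t \<in> borel_measurable M"
    using F_measurable_imp[OF Y] W_measurable st by auto
  interpret N: prob_space ?N by (rule prob_space_normal_density) simp
  interpret D: prob_space "distr M borel Y" by (rule prob_space_distr) measurable
  interpret P: pair_prob_space "distr M borel Y" ?N ..
  have "indep_var borel (id \<circ> Y) borel ((\<lambda>x. x / sqrt (t - s)) \<circ> (\<lambda>\<omega>. W t \<omega> - W s \<omega>))"
    by (rule indep_var_compose[OF indep_var_increment[OF Y st]]) auto
  then have "indep_var borel Y borel ?Z" by (simp add: comp_def id_def)
  then have eq: "distr M borel Y \<Otimes>\<^sub>M ?N = distr M (borel \<Otimes>\<^sub>M borel) (\<lambda>\<omega>. (Y \<omega>, ?Z \<omega>))"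
    by (simp add: indep_var_distribution_eq normalised_increment_distr[OF st])
  have "(\<integral>\<omega>. h (Y \<omega>, ?Z \<omega>) \<partial>M) = integral\<^sup>L (distr M borel Y \<Otimes>\<^sub>M ?N) h"
    unfolding eq by (subst integral_distr) (use h in auto)
  also have "\<dots> = (\<integral>y. (\<integral>z. h (y, z) \<partial>?N) \<partial>distr M borel Y)"
  proof (rule P.integral_fst'[symmetric])
    show "integrable (distr M borel Y \<Otimes>\<^sub>M ?N) h"
      unfolding eq by (subst integrable_distr_eq) (use h int in auto)
  qed
  also have "\<dots> = (\<integral>\<omega>. (\<integral>z. h (Y \<omega>, z) \<partial>?N) \<partial>M)"
  proof (subst integral_distr)
    have h': "(\<lambda>(y, z). h (y, z)) \<in> borel_measurable (borel \<Otimes>\<^sub>M ?N)"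
    proof -
      have "sets (borel \<Otimes>\<^sub>M ?N) = sets (borel \<Otimes>\<^sub>M borel)"
        by (intro sets_pair_measure_cong) auto
      then show ?thesis using h by (simp cong: measurable_cong_sets)
    qed
    show "(\<lambda>y. \<integral>z. h (y, z) \<partial>?N) \<in> borel_measurable borel"
      by (rule N.borel_measurable_lebesgue_integral[OF h'])
  qed auto
  finally show ?thesis .
qed

lemma increment_moments:
  assumes st: "0 \<le> s" "s \<le> t" "t \<le> T"
  shows "integrable M (\<lambda>\<omega>. W t \<omega> - W s \<omega>)"
    and "expectation (\<lambda>\<omega>. W t \<omega> - W s \<omega>) = 0"
    and "integrable M (\<lambda>\<omega>. (W t \<omega> - W s \<omega>)\<^sup>2)"
    and "expectation (\<lambda>\<omega>. (W t \<omega> - W s \<omega>)\<^sup>2) = t - s"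
proof -
  have "integrable M (\<lambda>\<omega>. W t \<omega> - W s \<omega>) \<and> expectation (\<lambda>\<omega>. W t \<omega> - W s \<omega>) = 0 \<and>
    integrable M (\<lambda>\<omega>. (W t \<omega> - W s \<omega>)\<^sup>2) \<and> expectation (\<lambda>\<omega>. (W t \<omega> - W s \<omega>)\<^sup>2) = t - s"
  proof (cases "s = t")
    case False
    then have st': "0 \<le> s" "s < t" "t \<le> T" using st by auto
    let ?Z = "\<lambda>\<omega>. (W t \<omega> - W s \<omega>) / sqrt (t - s)"
    note D = normalised_increment_distr[OF st']
    have [measurable]: "W s \<in> borel_measurable M" "W t \<in> borel_measurable M"
      using W_measurable st by auto
    have i: "integrable M (\<lambda>\<omega>. (?Z \<omega>)^k)" for k
      using integrable_std_normal_distribution_moment[of k]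
      unfolding D[symmetric] by (subst (asm) integrable_distr_eq) auto
    have e: "expectation (\<lambda>\<omega>. (?Z \<omega>)^k) = (\<integral>z. z^k \<partial>std_normal_distribution)" for k
      unfolding D[symmetric] by (subst integral_distr) auto
    have W: "W t \<omega> - W s \<omega> = sqrt (t - s) * ?Z \<omega>" for \<omega> using st' by simp
    have W2: "(W t \<omega> - W s \<omega>)\<^sup>2 = (t - s) * (?Z \<omega>)\<^sup>2" for \<omega>
      using st' by (subst W, subst power_mult_distrib) simp
    have "integrable M (\<lambda>\<omega>. sqrt (t - s) * ?Z \<omega>)" using i[of 1] by (intro integrable_mult_right) simp
    moreover have "expectation (\<lambda>\<omega>. sqrt (t - s) * ?Z \<omega>) = 0"
      using e[of 1] integral_std_normal_distribution_moment_odd[of 1]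
      by (simp only: integral_mult_right_zero power_one_right) simp
    moreover have "integrable M (\<lambda>\<omega>. (t - s) * (?Z \<omega>)\<^sup>2)" by (intro integrable_mult_right i)
    moreover have "expectation (\<lambda>\<omega>. (t - s) * (?Z \<omega>)\<^sup>2) = t - s"
      using e[of 2] std_normal_distribution_even_moments(1)[of 1]
      by (simp only: integral_mult_right_zero) simp
    ultimately show ?thesis by (simp only: W[symmetric] W2[symmetric] simp_thms)
  qed simp
  then show "integrable M (\<lambda>\<omega>. W t \<omega> - W s \<omega>)"
    and "expectation (\<lambda>\<omega>. W t \<omega> - W s \<omega>) = 0"
    and "integrable M (\<lambda>\<omega>. (W t \<omega> - W s \<omega>)\<^sup>2)"
    and "expectation (\<lambda>\<omega>. (W t \<omega> - W s \<omega>)\<^sup>2) = t - s" by auto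
qed

end

lemma grid_step: "T * real (Suc i) / real (Suc n) = T * real i / real (Suc n) + T / real (Suc n)"
  by (simp add: add_divide_distrib[symmetric] algebra_simps del: of_nat_Suc) (simp add: algebra_simps)

lemma grid_le: "0 \<le> T \<Longrightarrow> i \<le> Suc n \<Longrightarrow> T * real i / real (Suc n) \<le> T"
  using mult_left_mono[of "real i" "real (Suc n)" T] by (simp add: divide_le_eq del: of_nat_Suc)

text \<open>The grid points are \<open>T * k / Suc n\<close>, and the expression rounds \<open>s\<close> down to the grid.\<close>

lemma floor_grid_bounds:
  assumes T: "0 < (T :: real)"
  shows "T * real_of_int \<lfloor>s * real (Suc n) / T\<rfloor> / real (Suc n) \<le> s"
    and "s - T / real (Suc n) \<le> T * real_of_int \<lfloor>s * real (Suc n) / T\<rfloor> / real (Suc n)"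
proof -
  let ?k = "real_of_int \<lfloor>s * real (Suc n) / T\<rfloor>"
  have "?k \<le> s * real (Suc n) / T" "s * real (Suc n) / T \<le> ?k + 1" by linarith+
  then have "?k * T \<le> s * real (Suc n)" "s * real (Suc n) \<le> (?k + 1) * T"
    using T by (simp_all only: pos_le_divide_eq pos_divide_le_eq)
  then have "?k * T / real (Suc n) \<le> s" "s \<le> (?k + 1) * T / real (Suc n)"
    by (simp_all only: pos_le_divide_eq pos_divide_le_eq of_nat_0_less_iff zero_less_Suc)
  moreover have "(?k + 1) * T / real (Suc n) = T * ?k / real (Suc n) + T / real (Suc n)"
    by (simp add: add_divide_distrib[symmetric] algebra_simps del: of_nat_Suc)
  ultimately show "T * ?k / real (Suc n) \<le> s" "s - T / real (Suc n) \<le> T * ?k / real (Suc n)"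
    by (simp_all add: mult.commute del: of_nat_Suc)
qed

lemma floor_grid_tendsto:
  assumes T: "0 < (T :: real)"
  shows "(\<lambda>n. T * real_of_int \<lfloor>s * real (Suc n) / T\<rfloor> / real (Suc n)) \<longlonglongrightarrow> s"
proof (rule tendsto_sandwich[OF _ _ _ tendsto_const, rotated 2])
  show "(\<lambda>n. s - T / real (Suc n)) \<longlonglongrightarrow> s"
    using tendsto_diff[OF tendsto_const LIMSEQ_Suc[OF lim_const_over_n], of s T] by simp
qed (intro always_eventually allI floor_grid_bounds[OF T])+

lemma square_le_add_squares: "(x::real) \<le> a \<Longrightarrow> - x \<le> b \<Longrightarrow> x\<^sup>2 \<le> a\<^sup>2 + b\<^sup>2"
proof -
  assume *: "x \<le> a" "- x \<le> b"
  show ?thesis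
  proof (cases "0 \<le> x")
    case True
    then have "x\<^sup>2 \<le> a\<^sup>2" using * by (intro power_mono) auto
    then show ?thesis using zero_le_power2[of b] by linarith
  next
    case False
    then have "(- x)\<^sup>2 \<le> b\<^sup>2" using * by (intro power_mono) auto
    then show ?thesis using zero_le_power2[of a] unfolding power2_minus by linarith
  qed
qed

primrec running_max :: "(nat \<Rightarrow> real) \<Rightarrow> nat \<Rightarrow> real" where
  "running_max S 0 = S 0"
| "running_max S (Suc n) = max (running_max S n) (S (Suc n))"

lemma le_running_max: "i \<le> n \<Longrightarrow> S i \<le> running_max S n"
  by (induction n) (auto simp: le_Suc_eq le_max_iff_disj)

lemma abs_running_max_le: "\<bar>running_max S n\<bar> \<le> (\<Sum>i\<le>n. \<bar>S i\<bar>)"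
  by (induction n) (auto simp: max_def)

text \<open>Doob's \<open>L\<^sup>2\<close> inequality in a form that holds for every real sequence: in the application the sum on
  the right has expectation \<open>0\<close>. While the maximum \<open>M\<close> stays put, both sides of
  \<open>M\<^sup>2 \<le> 2 M S - 2 \<Sum> M \<Delta>S\<close> change equally; when it jumps to the new value of \<open>S\<close>, the right side gains
  the square of the jump. Then \<open>2 M S \<le> M\<^sup>2 / 2 + 2 S\<^sup>2\<close>.\<close>

lemma running_max_square_le:
  assumes "S 0 = 0"
  shows "(running_max S n)\<^sup>2 \<le> 4 * (S n)\<^sup>2 - 4 * (\<Sum>i<n. running_max S i * (S (Suc i) - S i))"
proof -
  define M where "M = running_max S"
  have "(M n)\<^sup>2 \<le> 2 * M n * S n - 2 * (\<Sum>i<n. M i * (S (Suc i) - S i))"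
  proof (induction n)
    case (Suc n)
    show ?case
    proof (cases "S (Suc n) \<le> M n")
      case True
      then have "M (Suc n) = M n" by (simp add: M_def)
      with Suc show ?thesis by (simp add: algebra_simps)
    next
      case False
      then have "M (Suc n) = S (Suc n)" by (simp add: M_def)
      with Suc zero_le_power2[of "S (Suc n) - M n"] show ?thesis
        by (simp add: algebra_simps power2_eq_square)
    qed
  qed (simp add: M_def assms)
  moreover have "2 * M n * S n \<le> (M n)\<^sup>2 / 2 + 2 * (S n)\<^sup>2"
    using zero_le_power2[of "M n - 2 * S n"] by (simp add: power2_eq_square algebra_simps)
  ultimately show ?thesis by (simp add: M_def)
qed

context brownian_motion
begin

text \<open>The sign \<open>\<sigma>\<close> makes the same statement available for the running minimum.\<close>

lemma Doob_running_max:
  assumes \<sigma>: "\<bar>\<sigma>\<bar> = 1" and T: "0 < T" and n: "0 < n"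
  defines "S \<equiv> \<lambda>i \<omega>. \<sigma> * (W (T * real i / real n) \<omega> - W 0 \<omega>)"
  shows "(\<lambda>\<omega>. running_max (\<lambda>i. S i \<omega>) n) \<in> borel_measurable M"
    and "(\<integral>\<^sup>+\<omega>. ennreal ((running_max (\<lambda>i. S i \<omega>) n)\<^sup>2) \<partial>M) \<le> ennreal (4 * T)"
proof -
  define \<tau> where "\<tau> i = T * real i / real n" for i
  have \<tau>: "0 \<le> \<tau> i" "\<tau> i < \<tau> (Suc i)" "i \<le> n \<Longrightarrow> \<tau> i \<le> T" for i
    using T n by (auto simp: \<tau>_def field_simps)
  have \<tau>0: "\<tau> 0 = 0" and \<tau>n: "\<tau> n = T" using n by (auto simp: \<tau>_def)
  have S: "S i \<omega> = \<sigma> * (W (\<tau> i) \<omega> - W 0 \<omega>)" for i \<omega> by (simp add: S_def \<tau>_def)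
  let ?M = "\<lambda>i \<omega>. running_max (\<lambda>i. S i \<omega>) i"
  have SF: "S j \<in> borel_measurable (F (\<tau> i))" if "j \<le> i" "i \<le> n" for i j
  proof -
    have "\<tau> j \<le> \<tau> i" using that T n by (simp add: \<tau>_def divide_right_mono)
    then have "W (\<tau> j) \<in> borel_measurable (F (\<tau> i))" "W 0 \<in> borel_measurable (F (\<tau> i))"
      using \<tau>[of j] \<tau>[of i] that T by (auto intro!: F_measurable_mono[OF W_adapted])
    then show ?thesis unfolding S by measurable
  qed
  have MF: "?M j \<in> borel_measurable (F (\<tau> i))" if "j \<le> i" "i \<le> n" for i j
    using that
  proof (induction j)
    case 0 then show ?case using SF[of 0 i] by simp
  next
    case (Suc j)
    then have [measurable]: "?M j \<in> borel_measurable (F (\<tau> i))" "S (Suc j) \<in> borel_measurable (F (\<tau> i))"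
      using SF by auto
    show ?case by simp
  qed
  have Mm: "?M i \<in> borel_measurable M" if "i \<le> n" for i
    using F_measurable_imp[OF MF[of i i]] that by simp
  then show "?M n \<in> borel_measurable M" by simp
  have S2: "integrable M (\<lambda>\<omega>. (S i \<omega>)\<^sup>2)" "expectation (\<lambda>\<omega>. (S i \<omega>)\<^sup>2) = \<tau> i" if "i \<le> n" for i
  proof -
    have "\<sigma>\<^sup>2 = 1" using \<sigma> by (metis power2_abs one_power2)
    then have "(S i \<omega>)\<^sup>2 = (W (\<tau> i) \<omega> - W 0 \<omega>)\<^sup>2" for \<omega>
      by (simp add: S power_mult_distrib)
    then show "integrable M (\<lambda>\<omega>. (S i \<omega>)\<^sup>2)" "expectation (\<lambda>\<omega>. (S i \<omega>)\<^sup>2) = \<tau> i"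
      using increment_moments[of 0 "\<tau> i"] \<tau>[of i] that by auto
  qed
  have M2: "integrable M (\<lambda>\<omega>. (?M i \<omega>)\<^sup>2)" if "i \<le> n" for i
  proof (rule Bochner_Integration.integrable_bound)
    show "integrable M (\<lambda>\<omega>. (real i + 1) * (\<Sum>j\<le>i. (S j \<omega>)\<^sup>2))"
      using that by (intro integrable_mult_right Bochner_Integration.integrable_sum S2) auto
    show "AE \<omega> in M. norm ((?M i \<omega>)\<^sup>2) \<le> norm ((real i + 1) * (\<Sum>j\<le>i. (S j \<omega>)\<^sup>2))"
    proof (intro AE_I2)
      fix \<omega>
      have "(?M i \<omega>)\<^sup>2 \<le> (\<Sum>j\<le>i. \<bar>S j \<omega>\<bar>)\<^sup>2"
        using power_mono[OF abs_running_max_le abs_ge_zero, of "\<lambda>i. S i \<omega>" i 2] by simp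
      also have "\<dots> \<le> (real i + 1) * (\<Sum>j\<le>i. \<bar>S j \<omega>\<bar>\<^sup>2)"
        using sum_squared_le_sum_of_squares[of "\<lambda>j. \<bar>S j \<omega>\<bar>" "{..i}"] by (simp add: mult.commute add.commute)
      finally show "norm ((?M i \<omega>)\<^sup>2) \<le> norm ((real i + 1) * (\<Sum>j\<le>i. (S j \<omega>)\<^sup>2))"
        by (simp add: sum_nonneg)
    qed
  qed (use Mm that in measurable)
  have Mi: "integrable M (?M i)" if "i \<le> n" for i
    using square_integrable_imp_integrable[OF Mm[OF that] M2[OF that]] .
  have prod: "integrable M (\<lambda>\<omega>. ?M i \<omega> * (S (Suc i) \<omega> - S i \<omega>))"
     "expectation (\<lambda>\<omega>. ?M i \<omega> * (S (Suc i) \<omega> - S i \<omega>)) = 0" if "i < n" for i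
  proof -
    have t: "0 \<le> \<tau> i" "\<tau> i < \<tau> (Suc i)" "\<tau> (Suc i) \<le> T" using \<tau>[of i] \<tau>[of "Suc i"] that by auto
    have ind: "indep_var borel (?M i) borel (\<lambda>\<omega>. W (\<tau> (Suc i)) \<omega> - W (\<tau> i) \<omega>)"
      using that by (intro indep_var_increment MF t) auto
    have mom: "integrable M (\<lambda>\<omega>. W (\<tau> (Suc i)) \<omega> - W (\<tau> i) \<omega>)"
       "expectation (\<lambda>\<omega>. W (\<tau> (Suc i)) \<omega> - W (\<tau> i) \<omega>) = 0"
      using increment_moments(1,2)[of "\<tau> i" "\<tau> (Suc i)"] t by auto
    have eq: "?M i \<omega> * (S (Suc i) \<omega> - S i \<omega>) = \<sigma> * (?M i \<omega> * (W (\<tau> (Suc i)) \<omega> - W (\<tau> i) \<omega>))" for \<omega>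
      by (simp add: S algebra_simps)
    show "integrable M (\<lambda>\<omega>. ?M i \<omega> * (S (Suc i) \<omega> - S i \<omega>))"
      unfolding eq using that by (intro integrable_mult_right indep_var_integrable[OF ind] Mi mom) auto
    show "expectation (\<lambda>\<omega>. ?M i \<omega> * (S (Suc i) \<omega> - S i \<omega>)) = 0"
      unfolding eq using indep_var_lebesgue_integral[OF ind] Mi[of i] that mom by simp
  qed
  let ?B = "\<lambda>\<omega>. 4 * (S n \<omega>)\<^sup>2 - 4 * (\<Sum>i<n. ?M i \<omega> * (S (Suc i) \<omega> - S i \<omega>))"
  have "expectation (\<lambda>\<omega>. (?M n \<omega>)\<^sup>2) \<le> expectation ?B"
  proof (rule integral_mono)
    show "integrable M ?B"
      using S2[of n] prod(1)
      by (intro Bochner_Integration.integrable_diff integrable_mult_right Bochner_Integration.integrable_sum) auto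
    show "(?M n \<omega>)\<^sup>2 \<le> ?B \<omega>" for \<omega>
      by (rule running_max_square_le) (simp add: S \<tau>0)
  qed (use M2[of n] in simp)
  also have "expectation ?B = 4 * expectation (\<lambda>\<omega>. (S n \<omega>)\<^sup>2)
      - 4 * (\<Sum>i<n. expectation (\<lambda>\<omega>. ?M i \<omega> * (S (Suc i) \<omega> - S i \<omega>)))"
    using S2[of n] prod(1)
    by (subst Bochner_Integration.integral_diff) (auto intro!: Bochner_Integration.integrable_sum)
  also have "\<dots> = 4 * T"
    using S2[of n] prod(2) \<tau>n by simp
  finally show "(\<integral>\<^sup>+\<omega>. ennreal ((?M n \<omega>)\<^sup>2) \<partial>M) \<le> ennreal (4 * T)"
    using M2[of n] by (simp add: nn_integral_eq_integral ennreal_leI)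
qed

text \<open>The bound is the lower limit of the discrete maxima along grids with \<open>Suc n\<close> steps. Fatou's lemma
  transfers the moment bound, and by continuity each \<open>\<bar>W t\<bar>\<close> is the limit of values that
  the discrete maxima dominate. The constant is \<open>4 T\<close> for the maximum and \<open>4 T\<close> for the minimum.\<close>

lemma sup_W_square_integrable:
  assumes T: "0 < T"
  obtains V where "V \<in> borel_measurable M" "\<And>\<omega>. 0 \<le> V \<omega>"
    "integrable M (\<lambda>\<omega>. (V \<omega>)\<^sup>2)" "expectation (\<lambda>\<omega>. (V \<omega>)\<^sup>2) \<le> 8 * T"
    "AE \<omega> in M. \<forall>t\<in>{0..T}. \<bar>W t \<omega>\<bar> \<le> V \<omega>"
proof -
  define S where "S \<sigma> n i \<omega> = \<sigma> * (W (T * real i / real (Suc n)) \<omega> - W 0 \<omega>)" for \<sigma> n i \<omega>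
  define A where "A n \<omega> = ennreal ((running_max (\<lambda>i. S 1 n i \<omega>) (Suc n))\<^sup>2) + ennreal ((running_max (\<lambda>i. S (-1) n i \<omega>) (Suc n))\<^sup>2)" for n \<omega>
  have Am [measurable]: "A n \<in> borel_measurable M" and Ai: "(\<integral>\<^sup>+\<omega>. A n \<omega> \<partial>M) \<le> ennreal (8 * T)" for n
  proof -
    note D = Doob_running_max[OF _ T, of _ "Suc n", folded S_def]
    have [measurable]: "(\<lambda>\<omega>. running_max (\<lambda>i. S 1 n i \<omega>) (Suc n)) \<in> borel_measurable M"
      "(\<lambda>\<omega>. running_max (\<lambda>i. S (-1) n i \<omega>) (Suc n)) \<in> borel_measurable M"
      using D(1)[of 1] D(1)[of "-1"] by auto
    show "A n \<in> borel_measurable M" unfolding A_def by measurable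
    have "(\<integral>\<^sup>+\<omega>. A n \<omega> \<partial>M) \<le> ennreal (4 * T) + ennreal (4 * T)"
      unfolding A_def using D(2)[of 1] D(2)[of "-1"]
      by (subst nn_integral_add) (auto intro!: add_mono simp del: running_max.simps)
    also have "\<dots> = ennreal (8 * T)" using T by (subst ennreal_plus[symmetric]) auto
    finally show "(\<integral>\<^sup>+\<omega>. A n \<omega> \<partial>M) \<le> ennreal (8 * T)" .
  qed
  define L where "L \<omega> = liminf (\<lambda>n. A n \<omega>)" for \<omega>
  have Lm [measurable]: "L \<in> borel_measurable M" unfolding L_def by measurable
  have "(\<integral>\<^sup>+\<omega>. L \<omega> \<partial>M) \<le> liminf (\<lambda>n. \<integral>\<^sup>+\<omega>. A n \<omega> \<partial>M)"
    unfolding L_def by (rule nn_integral_liminf) simp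
  also have "\<dots> \<le> liminf (\<lambda>n. ennreal (8 * T))"
    using Ai by (intro Liminf_mono always_eventually) simp
  also have "\<dots> = ennreal (8 * T)" by (simp add: Liminf_const)
  finally have Li: "(\<integral>\<^sup>+\<omega>. L \<omega> \<partial>M) \<le> ennreal (8 * T)" .
  have fin: "AE \<omega> in M. L \<omega> \<noteq> \<infinity>"
    by (rule nn_integral_noteq_infinite) (use Li in \<open>auto simp: top_unique\<close>)
  define V where "V \<omega> = sqrt (enn2real (L \<omega>))" for \<omega>
  have V2: "(V \<omega>)\<^sup>2 = enn2real (L \<omega>)" for \<omega> by (simp add: V_def)
  show thesis
  proof
    show "V \<in> borel_measurable M" unfolding V_def by measurable
    show V0: "0 \<le> V \<omega>" for \<omega> by (simp add: V_def)
    have nn: "(\<integral>\<^sup>+\<omega>. ennreal ((V \<omega>)\<^sup>2) \<partial>M) \<le> ennreal (8 * T)"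
    proof -
      have "(\<integral>\<^sup>+\<omega>. ennreal ((V \<omega>)\<^sup>2) \<partial>M) = (\<integral>\<^sup>+\<omega>. L \<omega> \<partial>M)"
        by (rule nn_integral_cong_AE) (use fin in \<open>auto simp: V2 less_top\<close>)
      then show ?thesis using Li by simp
    qed
    show int: "integrable M (\<lambda>\<omega>. (V \<omega>)\<^sup>2)"
    proof (rule integrableI_bounded)
      have "(\<integral>\<^sup>+\<omega>. ennreal (norm ((V \<omega>)\<^sup>2)) \<partial>M) = (\<integral>\<^sup>+\<omega>. ennreal ((V \<omega>)\<^sup>2) \<partial>M)" by simp
      also have "\<dots> \<le> ennreal (8 * T)" by (rule nn)
      finally show "(\<integral>\<^sup>+\<omega>. ennreal (norm ((V \<omega>)\<^sup>2)) \<partial>M) < \<infinity>"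
        by (rule le_less_trans) simp
    qed (simp add: V2)
    show "expectation (\<lambda>\<omega>. (V \<omega>)\<^sup>2) \<le> 8 * T"
      using nn T nn_integral_eq_integral[OF int] by (simp add: ennreal_le_iff)
    show "AE \<omega> in M. \<forall>t\<in>{0..T}. \<bar>W t \<omega>\<bar> \<le> V \<omega>"
      using fin W_start W_continuous
    proof eventually_elim
      case (elim \<omega>)
      show ?case
      proof
        fix t assume t: "t \<in> {0..T}"
        define j where "j n = nat \<lfloor>t * real (Suc n) / T\<rfloor>" for n
        have j_int: "real (j n) = real_of_int \<lfloor>t * real (Suc n) / T\<rfloor>" for n
          using t T by (simp add: j_def)
        have grid_le: "T * real (j n) / real (Suc n) \<le> t" for n
          unfolding j_int by (rule floor_grid_bounds[OF T])
        have j_lim: "(\<lambda>n. T * real (j n) / real (Suc n)) \<longlonglongrightarrow> t"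
          unfolding j_int by (rule floor_grid_tendsto[OF T])
        have j_le: "j n \<le> Suc n" for n
        proof -
          have "T * real (j n) / real (Suc n) \<le> T" using grid_le[of n] t by simp
          then have "T * real (j n) \<le> T * real (Suc n)"
            by (simp only: pos_divide_le_eq of_nat_0_less_iff zero_less_Suc)
          then show ?thesis using T by simp
        qed
        define w where "w n = W (T * real (j n) / real (Suc n)) \<omega>" for n
        have grid: "T * real (j n) / real (Suc n) \<in> {0..T}" for n
          using grid_le[of n] t T by simp
        have w: "w \<longlonglongrightarrow> W t \<omega>"
          unfolding w_def
          by (rule continuous_on_tendsto_compose[OF elim(3) j_lim t always_eventually]) (use grid in blast)
        (* W starts at 0 almost surely, so that S is W or - W at the grid points. *)
        have "ennreal ((w n)\<^sup>2) \<le> A n \<omega>" for n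
        proof -
          have "S 1 n (j n) \<omega> = w n" "S (-1) n (j n) \<omega> = - w n"
            using elim(2) by (simp_all add: S_def w_def del: of_nat_Suc)
          then have "w n \<le> running_max (\<lambda>i. S 1 n i \<omega>) (Suc n)"
            "- w n \<le> running_max (\<lambda>i. S (-1) n i \<omega>) (Suc n)"
            using le_running_max[OF j_le[of n], of "\<lambda>i. S 1 n i \<omega>"]
              le_running_max[OF j_le[of n], of "\<lambda>i. S (-1) n i \<omega>"] by (simp_all only:)
          then have "(w n)\<^sup>2 \<le> (running_max (\<lambda>i. S 1 n i \<omega>) (Suc n))\<^sup>2 + (running_max (\<lambda>i. S (-1) n i \<omega>) (Suc n))\<^sup>2"
            by (rule square_le_add_squares)
          then show ?thesis
            unfolding A_def ennreal_plus[OF zero_le_power2 zero_le_power2, symmetric] by (rule ennreal_leI)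
        qed
        then have "liminf (\<lambda>n. ennreal ((w n)\<^sup>2)) \<le> L \<omega>"
          unfolding L_def by (intro Liminf_mono always_eventually) simp
        moreover have "(\<lambda>n. ennreal ((w n)\<^sup>2)) \<longlonglongrightarrow> ennreal ((W t \<omega>)\<^sup>2)"
          by (intro tendsto_ennrealI tendsto_intros w)
        ultimately have "ennreal ((W t \<omega>)\<^sup>2) \<le> L \<omega>"
          by (simp add: lim_imp_Liminf)
        also have "\<dots> = ennreal (enn2real (L \<omega>))" using elim(1) by (simp add: less_top)
        finally have "(W t \<omega>)\<^sup>2 \<le> (V \<omega>)\<^sup>2" by (simp add: V2)
        then show "\<bar>W t \<omega>\<bar> \<le> V \<omega>"
          using V0[of \<omega>] abs_le_square_iff[of "W t \<omega>" "V \<omega>"] by simp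
      qed
    qed
  qed
qed

end

section \<open>One step of the Euler scheme\<close>

lemma Taylor_second_order:
  fixes f :: "real \<Rightarrow> real"
  assumes f: "\<And>x. (f has_real_derivative f' x) (at x)" and f': "\<And>x. (f' has_real_derivative f'' x) (at x)"
  shows "\<exists>\<xi>. \<bar>\<xi> - x\<bar> \<le> \<bar>d\<bar> \<and> f (x + d) = f x + f' x * d + f'' \<xi> / 2 * d\<^sup>2"
proof (cases "d = 0")
  case False
  define df where "df = (\<lambda>n::nat. if n = 0 then f else if n = 1 then f' else f'')"
  have "\<exists>t. (if x + d < x then x + d < t \<and> t < x else x < t \<and> t < x + d) \<and>
     f (x + d) = (\<Sum>m<2. df m x / fact m * (x + d - x) ^ m) + df 2 t / fact 2 * (x + d - x) ^ 2"
    by (rule Taylor[of 2 df f "min x (x + d)" "max x (x + d)"])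
       (use False f f' in \<open>auto simp: df_def less_2_cases_iff\<close>)
  then obtain t where "if x + d < x then x + d < t \<and> t < x else x < t \<and> t < x + d"
     "f (x + d) = (\<Sum>m<2. df m x / fact m * (x + d - x) ^ m) + df 2 t / fact 2 * (x + d - x) ^ 2" by blast
  then show ?thesis
    by (intro exI[of _ t]) (auto simp: df_def numeral_2_eq_2 split: if_splits)
qed (auto intro: exI[of _ x])

lemma expectation_std_normal_square: "(\<integral>z. z\<^sup>2 \<partial>std_normal_distribution) = 1"
  using std_normal_distribution_even_moments(1)[of 1] by simp

text \<open>The mean change of \<open>f\<close> when \<open>x\<close> is moved by \<open>\<epsilon>\<close> times a Brownian increment over a time of length \<open>h\<close>.\<close>

definition gaussian_increment :: "(real \<Rightarrow> real) \<Rightarrow> real \<Rightarrow> real \<Rightarrow> real \<Rightarrow> real" where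
  "gaussian_increment f \<epsilon> h x = (\<integral>z. (f (x + \<epsilon> * sqrt h * z) - f x) \<partial>std_normal_distribution)"

text \<open>The class of functions to which Dynkin's formula is applied. The functions themselves may be
  unbounded, as \<open>u\<close> is.\<close>

locale bounded_C2 =
  fixes f f' f'' :: "real \<Rightarrow> real" and C1 C2 :: real
  assumes DERIV_f: "(f has_real_derivative f' x) (at x)"
    and DERIV_f': "(f' has_real_derivative f'' x) (at x)"
    and cont_f'': "continuous_on UNIV f''"
    and f'_bound: "\<bar>f' x\<bar> \<le> C1"
    and f''_bound: "\<bar>f'' x\<bar> \<le> C2"
begin

lemma cont_f: "continuous_on A f"
  by (meson DERIV_f DERIV_isCont continuous_at_imp_continuous_on)

lemma cont_f': "continuous_on A f'"
  by (meson DERIV_f' DERIV_isCont continuous_at_imp_continuous_on)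

lemma f_measurable [measurable]: "f \<in> borel_measurable borel" "f' \<in> borel_measurable borel"
  "f'' \<in> borel_measurable borel"
  using cont_f cont_f' cont_f'' by (auto intro: borel_measurable_continuous_onI)

lemma f_diff_MVT: "\<exists>\<xi>. \<bar>\<xi> - x\<bar> \<le> \<bar>y - x\<bar> \<and> f x - f y = f' \<xi> * (x - y)"
proof (cases x y rule: linorder_cases)
  case less
  then obtain \<xi> where "x < \<xi>" "\<xi> < y" "f y - f x = (y - x) * f' \<xi>" using MVT2[of x y f f'] DERIV_f by blast
  then show ?thesis by (intro exI[of _ \<xi>]) (auto simp: algebra_simps)
next
  case greater
  then obtain \<xi> where "y < \<xi>" "\<xi> < x" "f x - f y = (x - y) * f' \<xi>" using MVT2[of y x f f'] DERIV_f by blast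
  then show ?thesis by (intro exI[of _ \<xi>]) (auto simp: algebra_simps)
qed auto

lemma f_Lipschitz: "\<bar>f x - f y\<bar> \<le> C1 * \<bar>x - y\<bar>"
proof -
  obtain \<xi> where "f x - f y = f' \<xi> * (x - y)" using f_diff_MVT by blast
  then show ?thesis using mult_right_mono[OF f'_bound[of \<xi>] abs_ge_zero[of "x - y"]] by (simp add: abs_mult)
qed

lemma f'_Lipschitz: "\<bar>f' x - f' y\<bar> \<le> C2 * \<bar>x - y\<bar>"
  using field_differentiable_bound[of UNIV f' f'' C2 x y] DERIV_f' f''_bound by auto

lemma f_linear_growth: "\<bar>f x\<bar> \<le> \<bar>f 0\<bar> + C1 * \<bar>x\<bar>"
  using f_Lipschitz[of x 0] by simp

lemma C1_nonneg: "0 \<le> C1" and C2_nonneg: "0 \<le> C2"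
  using f'_bound[of 0] f''_bound[of 0] by auto

lemma gaussian_increment_measurable [measurable]:
  "gaussian_increment f \<epsilon> h \<in> borel_measurable borel"
proof -
  interpret N: prob_space std_normal_distribution by (rule prob_space_normal_density) simp
  have [measurable]: "(\<lambda>(x, z). f (x + \<epsilon> * sqrt h * z) - f x) \<in> borel_measurable (borel \<Otimes>\<^sub>M std_normal_distribution)"
  proof -
    have "sets (borel \<Otimes>\<^sub>M std_normal_distribution) = sets (borel \<Otimes>\<^sub>M borel)"
      by (intro sets_pair_measure_cong) auto
    moreover have "(\<lambda>(x, z). f (x + \<epsilon> * sqrt h * z) - f x) \<in> borel_measurable (borel \<Otimes>\<^sub>M borel)" by measurable
    ultimately show ?thesis by (simp cong: measurable_cong_sets)
  qed
  show ?thesis unfolding gaussian_increment_def by (rule N.borel_measurable_lebesgue_integral) fact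
qed

lemma
  shows gaussian_increment_remainder: "gaussian_increment f \<epsilon> h x =
      (\<integral>z. (f (x + \<epsilon> * sqrt h * z) - f x - f' x * (\<epsilon> * sqrt h * z)) \<partial>std_normal_distribution)"
    and gaussian_increment_bound: "0 \<le> h \<Longrightarrow> \<bar>gaussian_increment f \<epsilon> h x\<bar> \<le> C2 * \<epsilon>\<^sup>2 / 2 * h"
proof -
  let ?N = std_normal_distribution and ?r = "\<lambda>z. f (x + \<epsilon> * sqrt h * z) - f x - f' x * (\<epsilon> * sqrt h * z)"
  have r: "\<bar>?r z\<bar> \<le> C2 / 2 * (\<epsilon> * sqrt h * z)\<^sup>2" for z
  proof -
    obtain \<xi> where "f (x + \<epsilon> * sqrt h * z) = f x + f' x * (\<epsilon> * sqrt h * z) + f'' \<xi> / 2 * (\<epsilon> * sqrt h * z)\<^sup>2"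
      using Taylor_second_order[OF DERIV_f DERIV_f', of x "\<epsilon> * sqrt h * z"] by blast
    then have "\<bar>?r z\<bar> = \<bar>f'' \<xi>\<bar> / 2 * (\<epsilon> * sqrt h * z)\<^sup>2" by (simp add: abs_mult)
    also have "\<dots> \<le> C2 / 2 * (\<epsilon> * sqrt h * z)\<^sup>2"
      using f''_bound[of \<xi>] by (intro mult_right_mono divide_right_mono) auto
    finally show ?thesis .
  qed
  have i2: "integrable ?N (\<lambda>z. C2 / 2 * (\<epsilon> * sqrt h * z)\<^sup>2)"
    unfolding power_mult_distrib by (intro integrable_mult_right integrable_std_normal_distribution_moment)
  have ir: "integrable ?N ?r"
    by (rule Bochner_Integration.integrable_bound[OF i2]) (use r in \<open>auto intro: order_trans[OF _ abs_ge_self]\<close>)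
  have i1: "integrable ?N (\<lambda>z. f' x * (\<epsilon> * sqrt h * z))"
    using integrable_std_normal_distribution_moment[of 1] by (intro integrable_mult_right) simp
  have "gaussian_increment f \<epsilon> h x = (\<integral>z. ?r z + f' x * (\<epsilon> * sqrt h * z) \<partial>?N)"
    by (simp add: gaussian_increment_def)
  also have "\<dots> = (\<integral>z. ?r z \<partial>?N) + (\<integral>z. f' x * (\<epsilon> * sqrt h * z) \<partial>?N)"
    by (rule Bochner_Integration.integral_add[OF ir i1])
  also have "(\<integral>z. f' x * (\<epsilon> * sqrt h * z) \<partial>?N) = 0"
    using integral_std_normal_distribution_moment_odd[of 1] by (simp add: mult.assoc)
  finally show eq: "gaussian_increment f \<epsilon> h x = (\<integral>z. ?r z \<partial>?N)" by simp
  assume h: "0 \<le> h"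
  have "\<bar>\<integral>z. ?r z \<partial>?N\<bar> \<le> (\<integral>z. \<bar>?r z\<bar> \<partial>?N)" by (rule integral_abs_bound)
  also have "\<dots> \<le> (\<integral>z. C2 / 2 * (\<epsilon> * sqrt h * z)\<^sup>2 \<partial>?N)"
    by (intro integral_mono integrable_abs ir i2 r)
  also have "\<dots> = C2 / 2 * (\<epsilon>\<^sup>2 * h)"
    using h by (simp add: power_mult_distrib expectation_std_normal_square)
  finally show "\<bar>gaussian_increment f \<epsilon> h x\<bar> \<le> C2 * \<epsilon>\<^sup>2 / 2 * h" by (simp add: eq)
qed

text \<open>The argument \<open>x\<close> is allowed to move with \<open>h\<close> because along a path it is the value at the grid point
  before a fixed time. By Taylor's formula the quotient is \<open>f'' (\<xi>) / 2 * \<epsilon>\<^sup>2 * z\<^sup>2\<close> integrated over the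
  standard normal variable \<open>z\<close>, with \<open>\<xi>\<close> tending to the limit of \<open>x\<close>.\<close>

lemma gaussian_increment_limit:
  assumes x: "x \<longlonglongrightarrow> a" and h: "h \<longlonglongrightarrow> 0" "\<And>n. 0 < h n"
  shows "(\<lambda>n. gaussian_increment f \<epsilon> (h n) (x n) / h n) \<longlonglongrightarrow> \<epsilon>\<^sup>2 / 2 * f'' a"
proof -
  let ?N = std_normal_distribution
  let ?r = "\<lambda>n z. (f (x n + \<epsilon> * sqrt (h n) * z) - f (x n) - f' (x n) * (\<epsilon> * sqrt (h n) * z)) / h n"
  have "\<exists>\<xi>. \<bar>\<xi> - x n\<bar> \<le> \<bar>\<epsilon> * sqrt (h n) * z\<bar> \<and> ?r n z = f'' \<xi> / 2 * (\<epsilon>\<^sup>2 * z\<^sup>2)" for n z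
  proof -
    obtain \<xi> where \<xi>: "\<bar>\<xi> - x n\<bar> \<le> \<bar>\<epsilon> * sqrt (h n) * z\<bar>"
      "f (x n + \<epsilon> * sqrt (h n) * z) = f (x n) + f' (x n) * (\<epsilon> * sqrt (h n) * z) + f'' \<xi> / 2 * (\<epsilon> * sqrt (h n) * z)\<^sup>2"
      using Taylor_second_order[OF DERIV_f DERIV_f', of "x n" "\<epsilon> * sqrt (h n) * z"] by blast
    have "(\<epsilon> * sqrt (h n) * z)\<^sup>2 = h n * (\<epsilon>\<^sup>2 * z\<^sup>2)"
      using h(2)[of n] by (simp add: power_mult_distrib)
    with \<xi> h(2)[of n] show ?thesis by (intro exI[of _ \<xi>]) auto
  qed
  then obtain \<xi> where \<xi>: "\<And>n z. \<bar>\<xi> n z - x n\<bar> \<le> \<bar>\<epsilon> * sqrt (h n) * z\<bar>"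
    "\<And>n z. ?r n z = f'' (\<xi> n z) / 2 * (\<epsilon>\<^sup>2 * z\<^sup>2)" by metis
  have "(\<lambda>n. \<integral>z. ?r n z \<partial>?N) \<longlonglongrightarrow> (\<integral>z. f'' a / 2 * (\<epsilon>\<^sup>2 * z\<^sup>2) \<partial>?N)"
  proof (rule integral_dominated_convergence)
    show "integrable ?N (\<lambda>z. C2 / 2 * (\<epsilon>\<^sup>2 * z\<^sup>2))"
      by (intro integrable_mult_right integrable_std_normal_distribution_moment)
    show "AE z in ?N. norm (?r n z) \<le> C2 / 2 * (\<epsilon>\<^sup>2 * z\<^sup>2)" for n
    proof (rule AE_I2)
      fix z
      have "\<bar>f'' (\<xi> n z)\<bar> / 2 * (\<epsilon>\<^sup>2 * z\<^sup>2) \<le> C2 / 2 * (\<epsilon>\<^sup>2 * z\<^sup>2)"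
        using f''_bound by (intro mult_right_mono divide_right_mono) auto
      then show "norm (?r n z) \<le> C2 / 2 * (\<epsilon>\<^sup>2 * z\<^sup>2)"
        unfolding \<xi>(2) by (simp add: abs_mult)
    qed
    show "AE z in ?N. (\<lambda>n. ?r n z) \<longlonglongrightarrow> f'' a / 2 * (\<epsilon>\<^sup>2 * z\<^sup>2)"
    proof (rule AE_I2)
      fix z
      have "(\<lambda>n. \<bar>\<epsilon> * sqrt (h n) * z\<bar>) \<longlonglongrightarrow> \<bar>\<epsilon> * sqrt 0 * z\<bar>"
        by (intro tendsto_intros h)
      then have "(\<lambda>n. \<bar>\<epsilon> * sqrt (h n) * z\<bar>) \<longlonglongrightarrow> 0" by simp
      then have "(\<lambda>n. \<xi> n z - x n) \<longlonglongrightarrow> 0"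
        by (rule Lim_null_comparison[rotated]) (use \<xi>(1) in \<open>simp add: always_eventually\<close>)
      from tendsto_add[OF this x] have "(\<lambda>n. \<xi> n z) \<longlonglongrightarrow> a" by simp
      then have "(\<lambda>n. f'' (\<xi> n z)) \<longlonglongrightarrow> f'' a"
        using cont_f'' by (intro isCont_tendsto_compose[of a f'']) (auto simp: continuous_on_eq_continuous_at)
      then show "(\<lambda>n. ?r n z) \<longlonglongrightarrow> f'' a / 2 * (\<epsilon>\<^sup>2 * z\<^sup>2)"
        unfolding \<xi>(2) by (intro tendsto_intros) auto
    qed
  qed auto
  moreover have "(\<integral>z. f'' a / 2 * (\<epsilon>\<^sup>2 * z\<^sup>2) \<partial>?N) = \<epsilon>\<^sup>2 / 2 * f'' a"
    by (simp add: expectation_std_normal_square)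
  moreover have "(\<integral>z. ?r n z \<partial>?N) = gaussian_increment f \<epsilon> (h n) (x n) / h n" for n
    unfolding gaussian_increment_remainder by (rule integral_divide_zero)
  ultimately show ?thesis by (simp only:)
qed

end

lemma LBINT_grid_split:
  fixes g :: "real \<Rightarrow> real"
  assumes g: "set_integrable lborel {0..T} g" and T: "0 < T" and "k \<le> m" "0 < m"
  shows "(LBINT s:{0..T * real k / real m}. g s) =
      (\<Sum>i<k. LBINT s:{T * real i / real m..T * real (Suc i) / real m}. g s)"
  using \<open>k \<le> m\<close>
proof (induction k)
  case 0
  have "(LBINT s:{0..0}. g s) = 0"
    unfolding set_lebesgue_integral_def
    by (rule integral_eq_zero_AE, use AE_lborel_singleton[of 0] in eventually_elim) auto
  then show ?case by simp
next
  case (Suc k)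
  have le: "0 \<le> T * real k / real m" "T * real k / real m \<le> T * real (Suc k) / real m" "T * real (Suc k) / real m \<le> T"
    using T Suc.prems assms(4) by (auto intro!: divide_right_mono mult_left_mono simp: divide_le_eq)
  have "set_integrable lborel {0..T * real (Suc k) / real m} g"
    using le by (intro set_integrable_subset[OF g]) auto
  from LBINT_Icc_split[OF this le(1,2)] Suc show ?case by simp
qed


lemma set_integrable_const_Icc: "set_integrable lborel {a..b} (\<lambda>_. c :: real)" for a b :: real
  by (rule set_integrable_comp_bounded[where x="\<lambda>s. s" and g="\<lambda>_. c", OF continuous_on_id _ order_refl]) simp

lemma abs_LBINT_Icc_le:
  fixes g :: "real \<Rightarrow> real"
  assumes g: "set_integrable lborel {a..b} g" and "a \<le> b" and c: "\<And>s. s \<in> {a..b} \<Longrightarrow> \<bar>g s\<bar> \<le> c"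
  shows "\<bar>LBINT s:{a..b}. g s\<bar> \<le> c * (b - a)"
proof -
  have "\<bar>LBINT s:{a..b}. g s\<bar> \<le> (LBINT s:{a..b}. \<bar>g s\<bar>)"
    using set_integral_norm_bound[OF g] by simp
  also have "\<dots> \<le> (LBINT s:{a..b}. c)"
    by (rule set_integral_mono[OF set_integrable_abs[OF g] set_integrable_const_Icc c])
  also have "\<dots> = c * (b - a)"
    using \<open>a \<le> b\<close> by (simp add: set_lebesgue_integral_def mult.commute)
  finally show ?thesis .
qed

lemma set_integrable_drift_mult:
  fixes x :: "real \<Rightarrow> real"
  assumes \<gamma>: "0 \<le> \<gamma>" "\<gamma> < 1" and x: "continuous_on {a..b} x"
    and g[measurable]: "g \<in> borel_measurable borel" and bd: "\<And>y. \<bar>g y\<bar> \<le> C"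
  shows "set_integrable lborel {a..b} (\<lambda>s. drift \<gamma> (x s) * g (x s))"
proof -
  obtain K where K: "\<And>s. s \<in> {a..b} \<Longrightarrow> \<bar>drift \<gamma> (x s)\<bar> \<le> 1 + K"
    using bounded_drift_path[OF \<gamma> x] by blast
  show ?thesis
    by (rule set_integrable_comp_bounded[OF x, of "\<lambda>y. drift \<gamma> y * g y" "(1 + K) * C"])
      (use K bd in \<open>auto simp: abs_mult intro!: mult_mono intro: order_trans[OF abs_ge_zero]\<close>)
qed

context bounded_C2
begin

text \<open>Here \<open>y n i\<close> is the position at the \<open>i\<close>-th grid point after the noise of the step, but before its
  drift, has been added. The mean value theorem gives \<open>f' \<xi>\<close> times the drift of the step, and \<open>\<xi>\<close> is
  close to every \<open>x s\<close> of the step, since the path is uniformly continuous and the drift is bounded along it. The drift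
  is not moved to a grid point, so that its discontinuity at \<open>0\<close> for \<open>\<gamma> = 0\<close> does no harm.\<close>

lemma drift_increments_limit:
  fixes x :: "real \<Rightarrow> real"
  assumes \<gamma>: "0 \<le> \<gamma>" "\<gamma> < 1" and T: "0 < T" and x: "continuous_on {0..T} x"
  defines "t \<equiv> \<lambda>n i. T * real i / real (Suc n)"
  assumes y: "\<And>n i. i < Suc n \<Longrightarrow> x (t n (Suc i)) - y n i = (LBINT s:{t n i..t n (Suc i)}. drift \<gamma> (x s))"
  shows "(\<lambda>n. \<Sum>i<Suc n. f (x (t n (Suc i))) - f (y n i)) \<longlonglongrightarrow> (LBINT s:{0..T}. drift \<gamma> (x s) * f' (x s))"
proof -
  obtain K where K: "\<And>s. s \<in> {0..T} \<Longrightarrow> \<bar>x s\<bar> \<le> K" "\<And>s. s \<in> {0..T} \<Longrightarrow> \<bar>drift \<gamma> (x s)\<bar> \<le> 1 + K"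
    using bounded_drift_path[OF \<gamma> x] by blast
  define B where "B = 1 + K"
  have B: "1 \<le> B" using K(1)[of 0] T by (simp add: B_def)
  have drift_B: "s \<in> {0..T} \<Longrightarrow> \<bar>drift \<gamma> (x s)\<bar> \<le> B" for s using K by (simp add: B_def)
  let ?I = "LBINT s:{0..T}. drift \<gamma> (x s) * f' (x s)"
  have close: "\<forall>\<^sub>F n in sequentially. \<bar>(\<Sum>i<Suc n. f (x (t n (Suc i))) - f (y n i)) - ?I\<bar> \<le> 2 * C2 * B * T * e"
    if e: "0 < e" for e
  proof -
    have "uniformly_continuous_on {0..T} x" by (rule compact_uniformly_continuous[OF x]) simp
    then obtain d where d: "0 < d" "\<And>s s'. s \<in> {0..T} \<Longrightarrow> s' \<in> {0..T} \<Longrightarrow> \<bar>s' - s\<bar> < d \<Longrightarrow> \<bar>x s' - x s\<bar> < e"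
      unfolding uniformly_continuous_on_def dist_real_def using e by metis
    have "(\<lambda>n. T / real (Suc n)) \<longlonglongrightarrow> 0" by (rule LIMSEQ_Suc[OF lim_const_over_n])
    then have "\<forall>\<^sub>F n in sequentially. T / real (Suc n) < min d (e / B)"
      using d(1) e B by (intro order_tendstoD) auto
    then show ?thesis
    proof eventually_elim
      case (elim n)
      define h where "h = T / real (Suc n)"
      have h: "0 < h" "h < d" "B * h < e"
        using elim T B by (auto simp: h_def less_divide_eq mult.commute simp del: of_nat_Suc)
      have step: "t n (Suc i) = t n i + h" for i unfolding t_def h_def by (rule grid_step)
      have grid: "0 \<le> t n i" "t n (Suc i) \<le> T" if "i < Suc n" for i
        using grid_le[of T "Suc i" n] that T by (simp_all add: t_def del: of_nat_Suc)
      have each: "\<bar>(f (x (t n (Suc i))) - f (y n i)) - (LBINT s:{t n i..t n (Suc i)}. drift \<gamma> (x s) * f' (x s))\<bar>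
          \<le> 2 * C2 * B * e * h" if i: "i < Suc n" for i
      proof -
        let ?J = "{t n i..t n (Suc i)}"
        note g = grid[OF i]
        have J: "?J \<subseteq> {0..T}" using g by auto
        have xJ: "continuous_on ?J x" by (rule continuous_on_subset[OF x J])
        have bi: "set_integrable lborel ?J (\<lambda>s. drift \<gamma> (x s))" by (rule set_integrable_drift[OF \<gamma> xJ])
        have bfi: "set_integrable lborel ?J (\<lambda>s. drift \<gamma> (x s) * f' (x s))"
          by (rule set_integrable_drift_mult[OF \<gamma> xJ _ f'_bound]) measurable
        have a: "\<bar>x (t n (Suc i)) - y n i\<bar> \<le> B * h"
          using abs_LBINT_Icc_le[OF bi, of B] J drift_B step h y[OF i] by auto
        obtain \<xi> where \<xi>: "\<bar>\<xi> - x (t n (Suc i))\<bar> \<le> \<bar>y n i - x (t n (Suc i))\<bar>"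
          "f (x (t n (Suc i))) - f (y n i) = f' \<xi> * (x (t n (Suc i)) - y n i)" using f_diff_MVT by blast
        have "(f (x (t n (Suc i))) - f (y n i)) - (LBINT s:?J. drift \<gamma> (x s) * f' (x s))
            = (LBINT s:?J. f' \<xi> * drift \<gamma> (x s) - drift \<gamma> (x s) * f' (x s))"
          unfolding \<xi>(2) y[OF i] set_integral_mult_right[symmetric]
          by (intro set_integral_diff(2)[symmetric] set_integrable_mult_right bi bfi)
        also have "\<bar>\<dots>\<bar> \<le> 2 * C2 * B * e * (t n (Suc i) - t n i)"
        proof (rule abs_LBINT_Icc_le[OF set_integral_diff(1)[OF set_integrable_mult_right[OF bi] bfi]])
          show "t n i \<le> t n (Suc i)" using step h by simp
        next
          fix s assume s: "s \<in> ?J"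
          have "\<bar>t n (Suc i) - s\<bar> < d" using s step h by auto
          then have "\<bar>x (t n (Suc i)) - x s\<bar> < e" using d(2)[of s "t n (Suc i)"] s J g step h by auto
          then have "\<bar>\<xi> - x s\<bar> \<le> 2 * e" using \<xi>(1) a h by linarith
          then have "\<bar>f' \<xi> - f' (x s)\<bar> \<le> C2 * (2 * e)"
            using f'_Lipschitz[of \<xi> "x s"] mult_left_mono[OF _ C2_nonneg] by (blast intro: order_trans)
          then have "\<bar>drift \<gamma> (x s)\<bar> * \<bar>f' \<xi> - f' (x s)\<bar> \<le> B * (C2 * (2 * e))"
            using drift_B s J B by (intro mult_mono) auto
          then show "\<bar>f' \<xi> * drift \<gamma> (x s) - drift \<gamma> (x s) * f' (x s)\<bar> \<le> 2 * C2 * B * e"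
            by (simp add: abs_mult[symmetric] algebra_simps)
        qed
        finally show ?thesis by (simp only: step add_diff_cancel_left')
      qed
      have "?I = (\<Sum>i<Suc n. LBINT s:{t n i..t n (Suc i)}. drift \<gamma> (x s) * f' (x s))"
        using LBINT_grid_split[OF set_integrable_drift_mult[OF \<gamma> x f_measurable(2) f'_bound] T, of "Suc n" "Suc n"]
        by (simp add: t_def del: sum.lessThan_Suc of_nat_Suc)
      then have "\<bar>(\<Sum>i<Suc n. f (x (t n (Suc i))) - f (y n i)) - ?I\<bar>
          = \<bar>\<Sum>i<Suc n. (f (x (t n (Suc i))) - f (y n i)) - (LBINT s:{t n i..t n (Suc i)}. drift \<gamma> (x s) * f' (x s))\<bar>"
        by (simp only: sum_subtractf)
      also have "\<dots> \<le> (\<Sum>i<Suc n. 2 * C2 * B * e * h)"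
        by (rule order_trans[OF sum_abs]) (intro sum_mono each, simp)
      also have "\<dots> = 2 * C2 * B * T * e" by (simp add: h_def del: of_nat_Suc)
      finally show ?case .
    qed
  qed
  show ?thesis
  proof (rule tendstoI)
    fix r :: real assume r: "0 < r"
    define e where "e = r / (2 * C2 * B * T + 1)"
    have pos: "0 < 2 * C2 * B * T + 1" using C2_nonneg B T by (simp add: add_nonneg_pos)
    have e: "0 < e" using r pos by (simp add: e_def)
    have "2 * C2 * B * T * e < (2 * C2 * B * T + 1) * e" using e by (simp add: distrib_right)
    also have "\<dots> = r" using pos by (simp add: e_def)
    finally have "2 * C2 * B * T * e < r" .
    then show "\<forall>\<^sub>F n in sequentially. dist (\<Sum>i<Suc n. f (x (t n (Suc i))) - f (y n i)) ?I < r"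
      using close[OF e] by (auto elim!: eventually_mono simp: dist_real_def)
  qed
qed

text \<open>The sum is the integral of the step function \<open>g n\<close>, which is bounded and converges pointwise by
  \<open>gaussian_increment_limit\<close>.\<close>

lemma gaussian_increments_limit:
  fixes x :: "real \<Rightarrow> real"
  assumes T: "0 < T" and x: "continuous_on {0..T} x"
  shows "(\<lambda>n. \<Sum>i<Suc n. gaussian_increment f \<epsilon> (T / real (Suc n)) (x (T * real i / real (Suc n))))
     \<longlonglongrightarrow> (LBINT s:{0..T}. \<epsilon>\<^sup>2 / 2 * f'' (x s))"
proof -
  define h where "h n = T / real (Suc n)" for n
  define k where "k n s = \<lfloor>s * real (Suc n) / T\<rfloor>" for n s
  define r where "r n s = T * real_of_int (k n s) / real (Suc n)" for n s
  define g where "g n s = gaussian_increment f \<epsilon> (h n) (x (r n s)) / h n" for n s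
  have h: "0 < h n" for n using T by (simp add: h_def)
  have h0: "h \<longlonglongrightarrow> 0" unfolding h_def by (rule LIMSEQ_Suc[OF lim_const_over_n])
  have gm [measurable]: "g n \<in> borel_measurable borel" for n
  proof -
    have "k n \<in> borel \<rightarrow>\<^sub>M count_space UNIV" unfolding k_def by measurable
    then have "(\<lambda>s. (\<lambda>j. gaussian_increment f \<epsilon> (h n) (x (T * real_of_int j / real (Suc n))) / h n) (k n s)) \<in> borel_measurable borel"
      by (rule measurable_compose) simp
    then show ?thesis unfolding g_def r_def .
  qed
  have gb: "\<bar>g n s\<bar> \<le> C2 * \<epsilon>\<^sup>2 / 2" for n s
    using gaussian_increment_bound[of "h n" \<epsilon> "x (r n s)"] h[of n]
    by (simp add: g_def divide_le_eq)
  have r_le: "r n s \<le> s" for n s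
    unfolding r_def k_def by (rule floor_grid_bounds[OF T])
  have r0: "0 \<le> r n s" if "0 \<le> s" for n s
    using that T by (simp add: r_def k_def)
  have r_lim: "(\<lambda>n. r n s) \<longlonglongrightarrow> s" for s
    unfolding r_def k_def by (rule floor_grid_tendsto[OF T])
  have x_lim: "(\<lambda>n. x (r n s)) \<longlonglongrightarrow> x s" if s: "s \<in> {0..T}" for s
  proof (rule continuous_on_tendsto_compose[OF x r_lim s])
    show "\<forall>\<^sub>F n in sequentially. r n s \<in> {0..T}"
      using r0[of s] r_le[of _ s] s by (intro always_eventually) (auto intro: order_trans)
  qed
  have "(\<lambda>n. LBINT s:{0..T}. g n s) \<longlonglongrightarrow> (LBINT s:{0..T}. \<epsilon>\<^sup>2 / 2 * f'' (x s))"
    unfolding set_lebesgue_integral_def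
  proof (rule integral_dominated_convergence)
    show "integrable lborel (\<lambda>s. indicator {0..T} s *\<^sub>R (C2 * \<epsilon>\<^sup>2 / 2))"
      by (intro integrable_scaleR_left integrable_real_indicator) (auto simp: emeasure_lborel_Icc_eq)
    have "set_integrable lborel {0..T} (\<lambda>s. \<epsilon>\<^sup>2 / 2 * f'' (x s))"
      by (intro set_integrable_mult_right set_integrable_comp_bounded[OF x _ f''_bound]) measurable
    then show "(\<lambda>s. indicator {0..T} s *\<^sub>R (\<epsilon>\<^sup>2 / 2 * f'' (x s))) \<in> borel_measurable lborel"
      unfolding set_integrable_def by (rule borel_measurable_integrable)
    show "AE s in lborel. (\<lambda>n. indicator {0..T} s *\<^sub>R g n s) \<longlonglongrightarrow> indicator {0..T} s *\<^sub>R (\<epsilon>\<^sup>2 / 2 * f'' (x s))"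
    proof (rule AE_I2)
      fix s
      show "(\<lambda>n. indicator {0..T} s *\<^sub>R g n s) \<longlonglongrightarrow> indicator {0..T} s *\<^sub>R (\<epsilon>\<^sup>2 / 2 * f'' (x s))"
        using gaussian_increment_limit[OF x_lim h0 h, of s \<epsilon>] by (cases "s \<in> {0..T}") (auto simp: g_def)
    qed
    show "AE s in lborel. norm (indicator {0..T} s *\<^sub>R g n s) \<le> indicator {0..T} s *\<^sub>R (C2 * \<epsilon>\<^sup>2 / 2)" for n
      using gb[of n] by (intro AE_I2) (auto simp: indicator_def)
  qed (use T in measurable)
  moreover have "(LBINT s:{0..T}. g n s) = (\<Sum>i<Suc n. gaussian_increment f \<epsilon> (T / real (Suc n)) (x (T * real i / real (Suc n))))" for n
  proof -
    have "set_integrable lborel {0..T} (g n)"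
      by (rule set_integrable_comp_bounded[where x="\<lambda>s. s", OF continuous_on_id gm gb])
    from LBINT_grid_split[OF this T, of "Suc n" "Suc n"]
    have "(LBINT s:{0..T}. g n s) = (\<Sum>i<Suc n. LBINT s:{T * real i / real (Suc n)..T * real (Suc i) / real (Suc n)}. g n s)"
      by (simp del: sum.lessThan_Suc of_nat_Suc)
    also have "\<dots> = (\<Sum>i<Suc n. gaussian_increment f \<epsilon> (h n) (x (T * real i / real (Suc n))))"
    proof (rule sum.cong[OF refl])
      fix i
      let ?a = "T * real i / real (Suc n)"
      let ?b = "T * real (Suc i) / real (Suc n)"
      let ?q = "gaussian_increment f \<epsilon> (h n) (x ?a)"
      have b: "?b = ?a + h n" unfolding h_def by (rule grid_step)
      have "g n s = ?q / h n" if s: "?a \<le> s" "s < ?b" for s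
      proof -
        have "T * real i \<le> s * real (Suc n)" "s * real (Suc n) < T * real (Suc i)"
          using s by (simp_all only: pos_divide_le_eq pos_less_divide_eq of_nat_0_less_iff zero_less_Suc)
        then have "real i \<le> s * real (Suc n) / T" "s * real (Suc n) / T < real i + 1"
          using T by (simp_all add: pos_le_divide_eq pos_divide_less_eq mult.commute del: of_nat_Suc) (simp add: algebra_simps)
        then have "k n s = int i" unfolding k_def by linarith
        then show ?thesis by (simp add: g_def r_def)
      qed
      then have "(LBINT s:{?a..?b}. g n s) = (LBINT s:{?a..?b}. ?q / h n)"
        unfolding set_lebesgue_integral_def
        by (intro integral_cong_AE) (auto simp: indicator_def intro!: eventually_mono[OF AE_lborel_singleton[of ?b]])
      also have "\<dots> = ?q / h n * h n"
        using h[of n] unfolding b by (simp add: set_lebesgue_integral_def measure_lborel_Icc)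
      finally show "(LBINT s:{?a..?b}. g n s) = ?q" using h[of n] by simp
    qed
    finally show ?thesis by (simp only: h_def)
  qed
  ultimately show ?thesis by simp
qed

end

section \<open>Dynkin's formula\<close>

locale small_noise_solution = weak_solution +
  assumes \<gamma>: "0 \<le> \<gamma>" "\<gamma> < 1" and T: "0 < T" and \<epsilon>: "0 < \<epsilon>"
begin

lemma X_measurable: "t \<in> {0..T} \<Longrightarrow> X t \<in> borel_measurable M"
  using F_measurable_imp[OF X_adapted] .

text \<open>The time is clamped to \<open>{0..T}\<close>, outside of which nothing is known about \<open>X\<close>. The paths being
  continuous, rounding the time down to a grid approximates \<open>X\<close> by functions of countably many
  values of the time.\<close>

lemma path_jointly_measurable:
  "(\<lambda>(s, \<omega>). X (max 0 (min T s)) \<omega>) \<in> borel_measurable (borel \<Otimes>\<^sub>M M)"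
proof -
  define c where "c s = max 0 (min T s)" for s
  have c: "c s \<in> {0..T}" for s using T by (auto simp: c_def)
  define k where "k n p = \<lfloor>fst p * real (Suc n) / T\<rfloor>" for n and p :: "real \<times> 'a"
  define Y where "Y n p = X (c (T * real_of_int (k n p) / real (Suc n))) (snd p)" for n and p :: "real \<times> 'a"
  have "(\<lambda>p. X (c (fst p)) (snd p)) \<in> borel_measurable (borel \<Otimes>\<^sub>M M)"
  proof (rule borel_measurable_LIMSEQ_real[where u=Y])
    fix n
    have "(\<lambda>p. (\<lambda>j p. X (c (T * real_of_int j / real (Suc n))) (snd p)) (k n p) p) \<in> borel_measurable (borel \<Otimes>\<^sub>M M)"
    proof (rule measurable_compose_countable[where f="\<lambda>j p. X (c (T * real_of_int j / real (Suc n))) (snd p)" and g="k n"])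
      fix j :: int
      have [measurable]: "X (c (T * real_of_int j / real (Suc n))) \<in> borel_measurable M"
        by (rule X_measurable[OF c])
      show "(\<lambda>p. X (c (T * real_of_int j / real (Suc n))) (snd p)) \<in> borel_measurable (borel \<Otimes>\<^sub>M M)" by measurable
    next
      show "k n \<in> borel \<Otimes>\<^sub>M M \<rightarrow>\<^sub>M count_space UNIV" unfolding k_def by measurable
    qed
    then show "Y n \<in> borel_measurable (borel \<Otimes>\<^sub>M M)" by (simp add: Y_def[abs_def])
  next
    fix p :: "real \<times> 'a" assume "p \<in> space ((borel :: real measure) \<Otimes>\<^sub>M M)"
    then have \<omega>: "snd p \<in> space M" by (auto simp: space_pair_measure)
    have "(\<lambda>n. T * real_of_int (k n p) / real (Suc n)) \<longlonglongrightarrow> fst p"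
      unfolding k_def by (rule floor_grid_tendsto[OF T])
    then have "(\<lambda>n. c (T * real_of_int (k n p) / real (Suc n))) \<longlonglongrightarrow> c (fst p)"
      unfolding c_def by (intro tendsto_intros)
    then show "(\<lambda>n. Y n p) \<longlonglongrightarrow> X (c (fst p)) (snd p)"
      unfolding Y_def using c
      by (intro continuous_on_tendsto_compose[OF X_continuous[OF \<omega>]]) auto
  qed
  then show ?thesis by (simp add: c_def case_prod_beta')
qed

lemma path_integral_measurable:
  fixes g :: "real \<Rightarrow> real"
  assumes g [measurable]: "g \<in> borel_measurable borel"
  shows "(\<lambda>\<omega>. LBINT s:{0..T}. g (X s \<omega>)) \<in> borel_measurable M"
proof -
  note [measurable] = path_jointly_measurable
  have "(\<lambda>(s, \<omega>). indicator {0..T} s *\<^sub>R g (X (max 0 (min T s)) \<omega>)) \<in> borel_measurable (borel \<Otimes>\<^sub>M M)"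
    by measurable
  then have "(\<lambda>(\<omega>, s). indicator {0..T} s *\<^sub>R g (X (max 0 (min T s)) \<omega>)) \<in> borel_measurable (M \<Otimes>\<^sub>M borel)"
    by (subst measurable_pair_swap_iff) (simp add: case_prod_beta')
  then have "(\<lambda>(\<omega>, s). indicator {0..T} s *\<^sub>R g (X (max 0 (min T s)) \<omega>)) \<in> borel_measurable (M \<Otimes>\<^sub>M lborel)"
    by (rule measurable_cong_sets[OF sets_pair_measure_cong refl, THEN equalityD1, THEN subsetD, rotated 2]) simp_all
  then have "(\<lambda>\<omega>. \<integral>s. indicator {0..T} s *\<^sub>R g (X (max 0 (min T s)) \<omega>) \<partial>lborel) \<in> borel_measurable M"
    by (rule lborel.borel_measurable_lebesgue_integral)
  also have "(\<lambda>\<omega>. \<integral>s. indicator {0..T} s *\<^sub>R g (X (max 0 (min T s)) \<omega>) \<partial>lborel)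
      = (\<lambda>\<omega>. LBINT s:{0..T}. g (X s \<omega>))"
    unfolding set_lebesgue_integral_def
    by (intro ext Bochner_Integration.integral_cong) (auto simp: indicator_def)
  finally show ?thesis .
qed

lemma path_noise_bound:
  obtains V where "V \<in> borel_measurable M" "\<And>\<omega>. 0 \<le> V \<omega>"
    "integrable M (\<lambda>\<omega>. (V \<omega>)\<^sup>2)" "expectation (\<lambda>\<omega>. (V \<omega>)\<^sup>2) \<le> 8 * T"
    "AE \<omega> in M. \<forall>s t. 0 \<le> s \<longrightarrow> s \<le> t \<longrightarrow> t \<le> T \<longrightarrow>
       travel_time \<gamma> \<bar>X t \<omega>\<bar> \<le> travel_time \<gamma> \<bar>X s \<omega>\<bar> + travel_time \<gamma> (2 * \<epsilon> * V \<omega>) + (t - s)"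
proof -
  obtain V where V: "V \<in> borel_measurable M" "\<And>\<omega>. 0 \<le> V \<omega>"
    "integrable M (\<lambda>\<omega>. (V \<omega>)\<^sup>2)" "expectation (\<lambda>\<omega>. (V \<omega>)\<^sup>2) \<le> 8 * T"
    "AE \<omega> in M. \<forall>t\<in>{0..T}. \<bar>W t \<omega>\<bar> \<le> V \<omega>"
    using sup_W_square_integrable[OF T] by blast
  have "AE \<omega> in M. \<omega> \<in> space M" by simp
  with V(5) X_equation have "AE \<omega> in M. \<forall>s t. 0 \<le> s \<longrightarrow> s \<le> t \<longrightarrow> t \<le> T \<longrightarrow>
       travel_time \<gamma> \<bar>X t \<omega>\<bar> \<le> travel_time \<gamma> \<bar>X s \<omega>\<bar> + travel_time \<gamma> (2 * \<epsilon> * V \<omega>) + (t - s)"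
  proof eventually_elim
    case (elim \<omega>)
    show ?case
    proof (intro allI impI)
      fix s t assume st: "0 \<le> s" "s \<le> t" "t \<le> T"
      have "travel_time \<gamma> \<bar>X t \<omega>\<bar> \<le> travel_time \<gamma> \<bar>X s \<omega>\<bar> + travel_time \<gamma> (2 * (\<epsilon> * V \<omega>)) + (t - s)"
      proof (rule travel_time_growth[OF \<gamma> X_continuous[OF elim(3)] _ _ st])
        show "0 \<le> \<epsilon> * V \<omega>" using \<epsilon> V(2) by simp
        fix r assume r: "r \<in> {0..T}"
        then have "X r \<omega> - (LBINT s:{0..r}. drift \<gamma> (X s \<omega>)) = \<epsilon> * W r \<omega>" using elim(2) by simp
        then show "\<bar>X r \<omega> - (LBINT s:{0..r}. drift \<gamma> (X s \<omega>))\<bar> \<le> \<epsilon> * V \<omega>"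
          using elim(1) r \<epsilon> by (simp add: abs_mult)
      qed
      then show "travel_time \<gamma> \<bar>X t \<omega>\<bar> \<le> travel_time \<gamma> \<bar>X s \<omega>\<bar> + travel_time \<gamma> (2 * \<epsilon> * V \<omega>) + (t - s)"
        by (simp add: mult.assoc)
    qed
  qed
  with V show thesis by (intro that) auto
qed

text \<open>The speed limit bounds \<open>\<bar>X t\<bar>\<close> by \<open>H \<gamma> (T + \<phi>(2 \<epsilon> V))\<close>, and this grows at most linearly in \<open>V\<close> because
  \<open>H \<gamma>\<close> is homogeneous and inverts \<open>\<phi>\<close>.\<close>

lemma X_dominated:
  obtains Y where "integrable M Y" "\<And>\<omega>. 0 \<le> Y \<omega>" "AE \<omega> in M. \<forall>t\<in>{0..T}. \<bar>X t \<omega>\<bar> \<le> Y \<omega>"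
proof -
  obtain V where V: "V \<in> borel_measurable M" "\<And>\<omega>. 0 \<le> V \<omega>"
    "integrable M (\<lambda>\<omega>. (V \<omega>)\<^sup>2)"
    "AE \<omega> in M. \<forall>s t. 0 \<le> s \<longrightarrow> s \<le> t \<longrightarrow> t \<le> T \<longrightarrow>
       travel_time \<gamma> \<bar>X t \<omega>\<bar> \<le> travel_time \<gamma> \<bar>X s \<omega>\<bar> + travel_time \<gamma> (2 * \<epsilon> * V \<omega>) + (t - s)"
    using path_noise_bound by blast
  define Y where "Y \<omega> = H \<gamma> (2 * T) + 2 powr (1 / (1 - \<gamma>)) * (2 * \<epsilon> * V \<omega>)" for \<omega>
  have "AE \<omega> in M. \<omega> \<in> space M" by simp
  with V(4) have "AE \<omega> in M. \<forall>t\<in>{0..T}. \<bar>X t \<omega>\<bar> \<le> Y \<omega>"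
  proof eventually_elim
    case (elim \<omega>)
    show ?case
    proof
      fix t assume t: "t \<in> {0..T}"
      let ?p = "travel_time \<gamma> (2 * \<epsilon> * V \<omega>)"
      have v: "0 \<le> 2 * \<epsilon> * V \<omega>" using \<epsilon> V(2) by simp
      have "travel_time \<gamma> \<bar>X t \<omega>\<bar> \<le> ?p + t"
        using elim(1)[rule_format, of 0 t] X_start[OF elim(2)] t by simp
      then have "travel_time \<gamma> \<bar>X t \<omega>\<bar> \<le> 2 * max T ?p" using t by auto
      then have "H \<gamma> (travel_time \<gamma> \<bar>X t \<omega>\<bar>) \<le> H \<gamma> (2 * max T ?p)" by (rule H_mono[OF \<gamma>(2)])
      also have "\<dots> \<le> H \<gamma> (2 * T) + H \<gamma> (2 * ?p)"
        using H_nonneg[of \<gamma> "2 * T"] H_nonneg[of \<gamma> "2 * ?p"] by (auto simp: max_def)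
      also have "H \<gamma> (2 * ?p) = 2 powr (1 / (1 - \<gamma>)) * H \<gamma> ?p"
        using travel_time_nonneg[OF \<gamma>(2), of "2 * \<epsilon> * V \<omega>"] \<gamma>
        unfolding H_def by (subst powr_mult[symmetric]) (auto simp: max_def mult_ac)
      finally show "\<bar>X t \<omega>\<bar> \<le> Y \<omega>"
        by (simp only: H_travel_time[OF \<gamma>(2) abs_ge_zero] H_travel_time[OF \<gamma>(2) v] Y_def)
    qed
  qed
  moreover have "integrable M Y"
    unfolding Y_def using square_integrable_imp_integrable[OF V(1,3)] by simp
  moreover have "0 \<le> Y \<omega>" for \<omega>
    using H_nonneg V(2) \<epsilon> by (simp add: Y_def)
  ultimately show thesis using that by blast
qed

lemma X_integrable:
  assumes t: "t \<in> {0..T}" shows "integrable M (X t)"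
proof -
  obtain Y where Y: "integrable M Y" "\<And>\<omega>. 0 \<le> Y \<omega>" "AE \<omega> in M. \<forall>t\<in>{0..T}. \<bar>X t \<omega>\<bar> \<le> Y \<omega>"
    using X_dominated by blast
  show ?thesis
    by (rule Bochner_Integration.integrable_bound[OF Y(1) X_measurable[OF t]])
      (use Y(3) in eventually_elim, use t Y(2) in auto)
qed

text \<open>The sum \<open>S n\<close> collects the mean Gaussian increments and \<open>R n\<close> the drift increments of one grid;
  \<open>E f(X T) - f(0) = E (S n) + E (R n)\<close> holds exactly for every \<open>n\<close>. The limits \<open>LS\<close> and \<open>LR\<close> are taken on each
  path. Domination comes from the bound on \<open>f''\<close> for \<open>S\<close>, and for \<open>R\<close> from the bound on \<open>f'\<close> together
  with an integrable bound on the drift along the path.\<close>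

lemma Dynkin_formula:
  assumes "bounded_C2 f f' f'' C1 C2"
  defines "L \<equiv> \<lambda>x. drift \<gamma> x * f' x + \<epsilon>\<^sup>2 / 2 * f'' x"
  shows "integrable M (\<lambda>\<omega>. f (X T \<omega>))"
    and "integrable M (\<lambda>\<omega>. LBINT s:{0..T}. L (X s \<omega>))"
    and "expectation (\<lambda>\<omega>. f (X T \<omega>)) = f 0 + expectation (\<lambda>\<omega>. LBINT s:{0..T}. L (X s \<omega>))"
proof -
  interpret bounded_C2 f f' f'' C1 C2 by fact
  define t where "t n i = T * real i / real (Suc n)" for n i
  define h where "h n = T / real (Suc n)" for n
  have h: "0 < h n" for n using T by (simp add: h_def)
  have step: "t n (Suc i) = t n i + h n" for n i unfolding t_def h_def by (rule grid_step)
  have grid: "t n i \<in> {0..T}" if "i \<le> Suc n" for n i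
    using grid_le[of T i n] that T by (simp add: t_def del: of_nat_Suc)
  have gridI: "0 \<le> t n i" "i \<le> Suc n \<Longrightarrow> t n i \<le> T" for n i
    using grid[of i n] T by (auto simp: t_def)
  have t0: "t n 0 = 0" and tT: "t n (Suc n) = T" for n by (simp_all add: t_def del: of_nat_Suc)
  define y where "y \<omega> n i = X (t n i) \<omega> + \<epsilon> * (W (t n (Suc i)) \<omega> - W (t n i) \<omega>)" for \<omega> n i
  have fX: "integrable M (\<lambda>\<omega>. f (Z \<omega>))" if "integrable M Z" for Z
  proof (rule Bochner_Integration.integrable_bound)
    show "integrable M (\<lambda>\<omega>. \<bar>f 0\<bar> + C1 * \<bar>Z \<omega>\<bar>)" using that by simp
    show "AE \<omega> in M. norm (f (Z \<omega>)) \<le> norm (\<bar>f 0\<bar> + C1 * \<bar>Z \<omega>\<bar>)"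
      using f_linear_growth by (intro AE_I2) (auto intro: order_trans[OF _ abs_ge_self])
  qed (use that in measurable)
  show fT: "integrable M (\<lambda>\<omega>. f (X T \<omega>))" using T by (intro fX X_integrable) auto
  have yi: "integrable M (\<lambda>\<omega>. y \<omega> n i)" if "i < Suc n" for n i
  proof -
    have "t n i \<in> {0..T}" "t n (Suc i) \<in> {0..T}" using that by (auto simp: gridI)
    then show ?thesis
      unfolding y_def using step[of n i] h[of n]
      by (intro Bochner_Integration.integrable_add X_integrable integrable_mult_right increment_moments(1)) auto
  qed
  define S where "S n \<omega> = (\<Sum>i<Suc n. gaussian_increment f \<epsilon> (h n) (X (t n i) \<omega>))" for n \<omega>
  define R where "R n \<omega> = (\<Sum>i<Suc n. f (X (t n (Suc i)) \<omega>) - f (y \<omega> n i))" for n \<omega>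
  have Xm [measurable]: "X (t n i) \<in> borel_measurable M" if "i \<le> Suc n" for n i
    by (rule X_measurable[OF grid[OF that]])
  have Sm: "S n \<in> borel_measurable M" for n
    unfolding S_def by (intro borel_measurable_sum measurable_compose[OF Xm gaussian_increment_measurable]) auto
  have Rint: "integrable M (R n)" for n
    unfolding R_def
    by (intro Bochner_Integration.integrable_sum Bochner_Integration.integrable_diff fX yi X_integrable grid) auto
  have Sb: "\<bar>S n \<omega>\<bar> \<le> C2 * \<epsilon>\<^sup>2 / 2 * T" for n \<omega>
  proof -
    have "\<bar>S n \<omega>\<bar> \<le> (\<Sum>i<Suc n. C2 * \<epsilon>\<^sup>2 / 2 * h n)"
      unfolding S_def using h[of n]
      by (intro order_trans[OF sum_abs] sum_mono gaussian_increment_bound) auto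
    also have "\<dots> = C2 * \<epsilon>\<^sup>2 / 2 * T" by (simp add: h_def del: of_nat_Suc)
    finally show ?thesis .
  qed
  have Sint: "integrable M (S n)" for n
    by (rule integrable_const_bound[of _ "C2 * \<epsilon>\<^sup>2 / 2 * T"]) (use Sb Sm in auto)
  have telescope: "expectation (\<lambda>\<omega>. f (X T \<omega>)) - f 0 = expectation (S n) + expectation (R n)" for n
  proof -
    have each: "expectation (\<lambda>\<omega>. f (y \<omega> n i)) - expectation (\<lambda>\<omega>. f (X (t n i) \<omega>))
        = expectation (\<lambda>\<omega>. gaussian_increment f \<epsilon> (h n) (X (t n i) \<omega>))" if i: "i < Suc n" for i
    proof -
      let ?H = "\<lambda>(x, z). f (x + \<epsilon> * sqrt (h n) * z) - f x"
      have ti: "0 \<le> t n i" "t n i < t n (Suc i)" "t n (Suc i) \<le> T"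
        using grid[of i n] grid[of "Suc i" n] i step[of n i] h[of n] by auto
      have hn: "t n (Suc i) - t n i = h n" using step by simp
      have yeq: "f (y \<omega> n i) - f (X (t n i) \<omega>) =
          ?H (X (t n i) \<omega>, (W (t n (Suc i)) \<omega> - W (t n i) \<omega>) / sqrt (t n (Suc i) - t n i))" for \<omega>
        using h[of n] by (simp add: y_def hn)
      have ints: "integrable M (\<lambda>\<omega>. f (y \<omega> n i))" "integrable M (\<lambda>\<omega>. f (X (t n i) \<omega>))"
        using i by (auto intro!: fX yi X_integrable simp: gridI)
      have "expectation (\<lambda>\<omega>. f (y \<omega> n i)) - expectation (\<lambda>\<omega>. f (X (t n i) \<omega>))
          = expectation (\<lambda>\<omega>. f (y \<omega> n i) - f (X (t n i) \<omega>))"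
        by (rule Bochner_Integration.integral_diff[OF ints, symmetric])
      also have "\<dots> = expectation (\<lambda>\<omega>. \<integral>z. ?H (X (t n i) \<omega>, z) \<partial>std_normal_distribution)"
        unfolding yeq
      proof (rule expectation_freeze[OF _ ti])
        show "X (t n i) \<in> borel_measurable (F (t n i))" using i by (intro X_adapted grid) auto
        show "?H \<in> borel_measurable (borel \<Otimes>\<^sub>M borel)" by measurable
        show "integrable M (\<lambda>\<omega>. ?H (X (t n i) \<omega>, (W (t n (Suc i)) \<omega> - W (t n i) \<omega>) / sqrt (t n (Suc i) - t n i)))"
          unfolding yeq[symmetric] by (rule Bochner_Integration.integrable_diff[OF ints])
      qed
      finally show ?thesis by (simp add: gaussian_increment_def)
    qed
    have "expectation (R n) = (\<Sum>i<Suc n. expectation (\<lambda>\<omega>. f (X (t n (Suc i)) \<omega>)) - expectation (\<lambda>\<omega>. f (y \<omega> n i)))"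
      unfolding R_def
      by (subst Bochner_Integration.integral_sum)
        (auto intro!: sum.cong Bochner_Integration.integral_diff Bochner_Integration.integrable_diff fX yi X_integrable simp: gridI simp del: sum.lessThan_Suc)
    moreover have "expectation (S n) = (\<Sum>i<Suc n. expectation (\<lambda>\<omega>. gaussian_increment f \<epsilon> (h n) (X (t n i) \<omega>)))"
      unfolding S_def
    proof (rule Bochner_Integration.integral_sum)
      fix i assume i: "i \<in> {..<Suc n}"
      show "integrable M (\<lambda>\<omega>. gaussian_increment f \<epsilon> (h n) (X (t n i) \<omega>))"
        using h[of n]
        by (intro integrable_const_bound[of _ "C2 * \<epsilon>\<^sup>2 / 2 * h n"] AE_I2 measurable_compose[OF Xm gaussian_increment_measurable])
          (use gaussian_increment_bound[OF less_imp_le[OF h[of n]], of \<epsilon>] i in auto)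
    qed
    moreover have "(\<Sum>i<Suc n. expectation (\<lambda>\<omega>. gaussian_increment f \<epsilon> (h n) (X (t n i) \<omega>)))
        = (\<Sum>i<Suc n. expectation (\<lambda>\<omega>. f (y \<omega> n i)) - expectation (\<lambda>\<omega>. f (X (t n i) \<omega>)))"
      by (intro sum.cong refl each[symmetric]) auto
    ultimately have "expectation (S n) + expectation (R n) =
       (\<Sum>i<Suc n. expectation (\<lambda>\<omega>. f (X (t n (Suc i)) \<omega>)) - expectation (\<lambda>\<omega>. f (X (t n i) \<omega>)))"
      by (simp only: sum.distrib[symmetric]) (intro sum.cong, auto)
    also have "\<dots> = expectation (\<lambda>\<omega>. f (X (t n (Suc n)) \<omega>)) - expectation (\<lambda>\<omega>. f (X (t n 0) \<omega>))"
      by (rule sum_lessThan_telescope)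
    also have "expectation (\<lambda>\<omega>. f (X (t n 0) \<omega>)) = expectation (\<lambda>\<omega>. f 0)"
      by (intro Bochner_Integration.integral_cong) (auto simp: t0 X_start)
    finally show ?thesis by (simp add: tT prob_space)
  qed
  obtain Y where Y: "integrable M Y" "\<And>\<omega>. 0 \<le> Y \<omega>" "AE \<omega> in M. \<forall>t\<in>{0..T}. \<bar>X t \<omega>\<bar> \<le> Y \<omega>"
    using X_dominated by blast
  define LS where "LS \<omega> = (LBINT s:{0..T}. \<epsilon>\<^sup>2 / 2 * f'' (X s \<omega>))" for \<omega>
  define LR where "LR \<omega> = (LBINT s:{0..T}. drift \<gamma> (X s \<omega>) * f' (X s \<omega>))" for \<omega>
  have LSm: "LS \<in> borel_measurable M" unfolding LS_def
    by (rule path_integral_measurable[of "\<lambda>x. \<epsilon>\<^sup>2 / 2 * f'' x"]) measurable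
  have LRm: "LR \<in> borel_measurable M" unfolding LR_def
    by (rule path_integral_measurable[of "\<lambda>x. drift \<gamma> x * f' x"]) measurable
  have S_lim: "AE \<omega> in M. (\<lambda>n. S n \<omega>) \<longlonglongrightarrow> LS \<omega>"
  proof (rule AE_I2)
    fix \<omega> assume "\<omega> \<in> space M"
    from gaussian_increments_limit[OF T X_continuous[OF this], of \<epsilon>] show "(\<lambda>n. S n \<omega>) \<longlonglongrightarrow> LS \<omega>"
      by (simp only: S_def LS_def h_def t_def)
  qed
  have AE_space: "AE \<omega> in M. \<omega> \<in> space M" by simp
  have incr: "X (t n (Suc i)) \<omega> - y \<omega> n i = (LBINT s:{t n i..t n (Suc i)}. drift \<gamma> (X s \<omega>))"
    if \<omega>: "\<omega> \<in> space M" and eq: "\<forall>t\<in>{0..T}. X t \<omega> = (LBINT s:{0..t}. drift \<gamma> (X s \<omega>)) + \<epsilon> * W t \<omega>"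
      and i: "i < Suc n" for \<omega> n i
  proof -
    have ti: "t n i \<in> {0..T}" "t n (Suc i) \<in> {0..T}" "t n i \<le> t n (Suc i)"
      using i step[of n i] h[of n] gridI[of n i] gridI[of n "Suc i"] gridI(2)[of i n] gridI(2)[of "Suc i" n] by auto
    have "set_integrable lborel {0..t n (Suc i)} (\<lambda>s. drift \<gamma> (X s \<omega>))"
      using ti by (intro set_integrable_drift \<gamma> continuous_on_subset[OF X_continuous[OF \<omega>]]) auto
    then have "(LBINT s:{0..t n (Suc i)}. drift \<gamma> (X s \<omega>)) =
        (LBINT s:{0..t n i}. drift \<gamma> (X s \<omega>)) + (LBINT s:{t n i..t n (Suc i)}. drift \<gamma> (X s \<omega>))"
      using ti by (intro LBINT_Icc_split) auto
    with eq[rule_format, OF ti(1)] eq[rule_format, OF ti(2)] show ?thesis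
      by (simp add: y_def algebra_simps)
  qed
  have R_lim: "AE \<omega> in M. (\<lambda>n. R n \<omega>) \<longlonglongrightarrow> LR \<omega>"
    using X_equation AE_space
  proof eventually_elim
    case (elim \<omega>)
    have "(\<lambda>n. \<Sum>i<Suc n. f (X (T * real (Suc i) / real (Suc n)) \<omega>) - f (y \<omega> n i)) \<longlonglongrightarrow> LR \<omega>"
      unfolding LR_def
      by (rule drift_increments_limit[OF \<gamma> T X_continuous[OF elim(2)]]) (rule incr[OF elim(2,1), unfolded t_def])
    then show ?case by (simp only: R_def t_def)
  qed
  have drift_sum: "(\<Sum>i<Suc n. C1 * \<bar>X (t n (Suc i)) \<omega> - y \<omega> n i\<bar>) \<le> C1 * (T * (1 + Y \<omega>))"
    if \<omega>: "\<omega> \<in> space M" and eq: "\<forall>t\<in>{0..T}. X t \<omega> = (LBINT s:{0..t}. drift \<gamma> (X s \<omega>)) + \<epsilon> * W t \<omega>"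
      and bd: "\<forall>t\<in>{0..T}. \<bar>X t \<omega>\<bar> \<le> Y \<omega>" for \<omega> n
  proof -
    have "\<bar>X (t n (Suc i)) \<omega> - y \<omega> n i\<bar> \<le> h n * (1 + Y \<omega>)" if i: "i < Suc n" for i
    proof -
      have ti: "t n i \<in> {0..T}" "t n (Suc i) \<in> {0..T}" "t n i \<le> t n (Suc i)"
        using i step[of n i] h[of n] gridI[of n i] gridI[of n "Suc i"] gridI(2)[of i n] gridI(2)[of "Suc i" n] by auto
      let ?J = "{t n i..t n (Suc i)}"
      have bi: "set_integrable lborel ?J (\<lambda>s. drift \<gamma> (X s \<omega>))"
        using ti by (intro set_integrable_drift \<gamma> continuous_on_subset[OF X_continuous[OF \<omega>]]) auto
      have "\<bar>LBINT s:?J. drift \<gamma> (X s \<omega>)\<bar> \<le> (1 + Y \<omega>) * (t n (Suc i) - t n i)"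
      proof (rule abs_LBINT_Icc_le[OF bi ti(3)])
        fix s assume "s \<in> ?J"
        then have "\<bar>X s \<omega>\<bar> \<le> Y \<omega>" using bd ti by auto
        then show "\<bar>drift \<gamma> (X s \<omega>)\<bar> \<le> 1 + Y \<omega>" using abs_drift_le[OF \<gamma>, of "X s \<omega>"] by linarith
      qed
      also have "\<dots> = h n * (1 + Y \<omega>)" using step[of n i] by simp
      finally show ?thesis by (simp only: incr[OF \<omega> eq i])
    qed
    then have "(\<Sum>i<Suc n. C1 * \<bar>X (t n (Suc i)) \<omega> - y \<omega> n i\<bar>) \<le> (\<Sum>i<Suc n. C1 * (h n * (1 + Y \<omega>)))"
      by (intro sum_mono mult_left_mono C1_nonneg) auto
    also have "\<dots> = C1 * (T * (1 + Y \<omega>))" by (simp add: h_def del: of_nat_Suc)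
    finally show ?thesis .
  qed
  have R_bd: "AE \<omega> in M. norm (R n \<omega>) \<le> C1 * (T * (1 + Y \<omega>))" for n
    using X_equation AE_space Y(3)
  proof eventually_elim
    case (elim \<omega>)
    have "\<bar>R n \<omega>\<bar> \<le> (\<Sum>i<Suc n. C1 * \<bar>X (t n (Suc i)) \<omega> - y \<omega> n i\<bar>)"
      unfolding R_def by (rule order_trans[OF sum_abs]) (intro sum_mono f_Lipschitz)
    with drift_sum[OF elim(2,1,3), of n] show ?case by simp
  qed
  have Yint: "integrable M (\<lambda>\<omega>. C1 * (T * (1 + Y \<omega>)))" using Y(1) by simp
  have cint: "integrable M (\<lambda>_. C2 * \<epsilon>\<^sup>2 / 2 * T)" by simp
  have Sb': "AE \<omega> in M. norm (S n \<omega>) \<le> C2 * \<epsilon>\<^sup>2 / 2 * T" for n using Sb by simp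
  have Rm: "R n \<in> borel_measurable M" for n using Rint by (rule borel_measurable_integrable)
  have LSi: "integrable M LS" by (rule integrable_dominated_convergence[OF LSm Sm cint S_lim Sb'])
  have LRi: "integrable M LR" by (rule integrable_dominated_convergence[OF LRm Rm Yint R_lim R_bd])
  have split: "(LBINT s:{0..T}. L (X s \<omega>)) = LR \<omega> + LS \<omega>" if "\<omega> \<in> space M" for \<omega>
    unfolding L_def LR_def LS_def
  proof (rule set_integral_add)
    show "set_integrable lborel {0..T} (\<lambda>s. drift \<gamma> (X s \<omega>) * f' (X s \<omega>))"
      by (rule set_integrable_drift_mult[OF \<gamma> X_continuous[OF that] f_measurable(2) f'_bound])
    show "set_integrable lborel {0..T} (\<lambda>s. \<epsilon>\<^sup>2 / 2 * f'' (X s \<omega>))"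
      by (intro set_integrable_mult_right set_integrable_comp_bounded[OF X_continuous[OF that] f_measurable(3) f''_bound])
  qed
  show "integrable M (\<lambda>\<omega>. LBINT s:{0..T}. L (X s \<omega>))"
    using Bochner_Integration.integrable_add[OF LRi LSi] split
    by (simp cong: Bochner_Integration.integrable_cong)
  have "(\<lambda>n. expectation (S n) + expectation (R n)) \<longlonglongrightarrow> expectation LS + expectation LR"
    by (intro tendsto_add integral_dominated_convergence[OF LSm Sm cint S_lim Sb']
         integral_dominated_convergence[OF LRm Rm Yint R_lim R_bd])
  then have "expectation (\<lambda>\<omega>. f (X T \<omega>)) - f 0 = expectation LS + expectation LR"
    by (simp only: telescope[symmetric] LIMSEQ_const_iff)
  also have "\<dots> = expectation (\<lambda>\<omega>. LR \<omega> + LS \<omega>)"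
    by (subst Bochner_Integration.integral_add[OF LRi LSi]) simp
  also have "\<dots> = expectation (\<lambda>\<omega>. LBINT s:{0..T}. L (X s \<omega>))"
    using split by (intro Bochner_Integration.integral_cong) auto
  finally show "expectation (\<lambda>\<omega>. f (X T \<omega>)) = f 0 + expectation (\<lambda>\<omega>. LBINT s:{0..T}. L (X s \<omega>))" by simp
qed

end

section \<open>The paths are nearly extremal, with balanced signs\<close>

lemma bounded_C2_exit_function:
  assumes "0 \<le> \<gamma>" "\<gamma> < 1" "0 < c"
  shows "bounded_C2 (exit_function \<gamma> c) (exit_slope \<gamma> c)
    (\<lambda>x. c * (1 - drift \<gamma> x * exit_slope \<gamma> c x)) (c + 2) c"
proof
  fix x
  show "(exit_function \<gamma> c has_real_derivative exit_slope \<gamma> c x) (at x)"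
    "(exit_slope \<gamma> c has_real_derivative c * (1 - drift \<gamma> x * exit_slope \<gamma> c x)) (at x)"
    "\<bar>exit_slope \<gamma> c x\<bar> \<le> c + 2"
    using assms by (rule DERIV_exit_function DERIV_exit_slope exit_slope_bounded)+
  show "continuous_on UNIV (\<lambda>x. c * (1 - drift \<gamma> x * exit_slope \<gamma> c x))"
    by (intro continuous_intros continuous_drift_exit_slope assms)
  have "\<bar>1 - drift \<gamma> x * exit_slope \<gamma> c x\<bar> \<le> 1"
    using drift_exit_slope_bounds[OF assms, of x] by linarith
  then show "\<bar>c * (1 - drift \<gamma> x * exit_slope \<gamma> c x)\<bar> \<le> c"
    using assms by (simp add: abs_mult)
qed

lemma bounded_C2_smooth_scale_function:
  assumes \<gamma>: "0 \<le> \<gamma>" "\<gamma> < 1" and c: "0 < c" and \<delta>: "0 < \<delta>"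
  shows "bounded_C2 (smooth_scale_function \<gamma> c \<delta>) (\<lambda>x. exp (- c * smooth_potential \<gamma> \<delta> x))
    (\<lambda>x. - c * smooth_drift \<gamma> \<delta> x * exp (- c * smooth_potential \<gamma> \<delta> x)) 1 (c * ((1 + 2 / c) * exp (c / 2)))"
proof
  fix x
  show "(smooth_scale_function \<gamma> c \<delta> has_real_derivative exp (- c * smooth_potential \<gamma> \<delta> x)) (at x)"
    by (rule DERIV_smooth_scale_function[OF \<gamma> c \<delta>])
  show "((\<lambda>x. exp (- c * smooth_potential \<gamma> \<delta> x)) has_real_derivative
     - c * smooth_drift \<gamma> \<delta> x * exp (- c * smooth_potential \<gamma> \<delta> x)) (at x)"
    by (auto intro!: derivative_eq_intros DERIV_smooth_potential[OF \<gamma> \<delta>])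
  show "continuous_on UNIV (\<lambda>x. - c * smooth_drift \<gamma> \<delta> x * exp (- c * smooth_potential \<gamma> \<delta> x))"
    by (intro continuous_intros continuous_smooth_drift continuous_smooth_potential \<gamma> \<delta>)
  have pos: "0 \<le> smooth_potential \<gamma> \<delta> x"
    using smooth_potential_bounds(1)[OF \<gamma> \<delta>, of x] potential_nonneg[OF \<gamma>(1), of x] by linarith
  then show "\<bar>exp (- c * smooth_potential \<gamma> \<delta> x)\<bar> \<le> 1" using c by simp
  let ?y = "\<bar>x\<bar>"
  (* A linear lower bound on the potential: the exponential beats the growth of the drift. *)
  have "(?y - 1) / 2 \<le> potential \<gamma> x"
  proof (cases "?y \<le> 1")
    case False
    have "(?y - 1) / 2 \<le> ?y powr 1 / 2" using False by simp
    also have "\<dots> \<le> ?y powr (1 + \<gamma>) / (1 + \<gamma>)"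
      using False \<gamma> by (intro frac_le powr_mono) auto
    finally show ?thesis by (simp add: potential_def)
  next
    case True
    then have "(?y - 1) / 2 \<le> 0" by simp
    then show ?thesis using potential_nonneg[OF \<gamma>(1), of x] by linarith
  qed
  then have "(?y - 1) / 2 \<le> smooth_potential \<gamma> \<delta> x"
    using smooth_potential_bounds(1)[OF \<gamma> \<delta>, of x] by linarith
  then have "c * ((?y - 1) / 2) \<le> c * smooth_potential \<gamma> \<delta> x" using c by (intro mult_left_mono) auto
  then have e: "exp (- c * smooth_potential \<gamma> \<delta> x) \<le> exp (c / 2) * exp (- (c * ?y / 2))"
    by (simp add: exp_add[symmetric] field_simps)
  have "c * ?y / 2 \<le> exp (c * ?y / 2)"
    using exp_ge_add_one_self[of "c * ?y / 2"] by linarith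
  then have "?y \<le> 2 / c * exp (c * ?y / 2)" using c by (simp add: field_simps)
  moreover have "1 \<le> exp (c * ?y / 2)" using c by simp
  ultimately have y: "1 + ?y \<le> (1 + 2 / c) * exp (c * ?y / 2)" unfolding distrib_right mult_1_left by linarith
  have "\<bar>smooth_drift \<gamma> \<delta> x\<bar> * exp (- c * smooth_potential \<gamma> \<delta> x) \<le>
      ((1 + 2 / c) * exp (c * ?y / 2)) * (exp (c / 2) * exp (- (c * ?y / 2)))"
  proof (intro mult_mono e)
    show "\<bar>smooth_drift \<gamma> \<delta> x\<bar> \<le> (1 + 2 / c) * exp (c * ?y / 2)"
      using smooth_drift_bounds(1)[OF \<gamma> \<delta>, of x] abs_drift_le[OF \<gamma>, of x] y by linarith
  qed (use c in auto)
  also have "\<dots> = (1 + 2 / c) * exp (c / 2) * (exp (c * ?y / 2) * exp (- (c * ?y / 2)))" by (simp only: mult_ac)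
  also have "exp (c * ?y / 2) * exp (- (c * ?y / 2)) = 1" by (simp add: exp_add[symmetric])
  finally show "\<bar>- c * smooth_drift \<gamma> \<delta> x * exp (- c * smooth_potential \<gamma> \<delta> x)\<bar> \<le> c * ((1 + 2 / c) * exp (c / 2))"
    using c by (simp add: abs_mult)
qed

text \<open>Uniform continuity of \<open>H \<gamma>\<close> turns closeness of travel times into closeness of \<open>\<bar>x\<bar>\<close> to \<open>H \<gamma>\<close>. From time
  \<open>\<delta>\<close> on the travel time is positive, so that \<open>x\<close> has no zero and keeps its sign; before that, \<open>x\<close> and
  \<open>H \<gamma>\<close> are both small.\<close>

lemma near_H_or_minus_H:
  assumes \<gamma>: "0 \<le> \<gamma>" "\<gamma> < 1" and T: "0 < T" and r: "0 < r"
  obtains \<delta> where "0 < \<delta>"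
    "\<And>x. continuous_on {0..T} x \<Longrightarrow> (\<And>t. t \<in> {0..T} \<Longrightarrow> \<bar>travel_time \<gamma> \<bar>x t\<bar> - t\<bar> < \<delta>) \<Longrightarrow>
      (\<forall>t\<in>{0..T}. \<bar>x t - H \<gamma> t\<bar> < r) \<or> (\<forall>t\<in>{0..T}. \<bar>x t + H \<gamma> t\<bar> < r)"
proof -
  have "uniformly_continuous_on {0..T + 1} (H \<gamma>)"
    by (intro compact_uniformly_continuous continuous_on_H \<gamma>) simp
  moreover have "0 < r / 4" using r by simp
  ultimately obtain d where d: "0 < d"
    "\<And>s t. s \<in> {0..T + 1} \<Longrightarrow> t \<in> {0..T + 1} \<Longrightarrow> \<bar>t - s\<bar> < d \<Longrightarrow> \<bar>H \<gamma> t - H \<gamma> s\<bar> < r / 4"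
    unfolding uniformly_continuous_on_def dist_real_def by metis
  define \<delta> where "\<delta> = min d (min 1 T)"
  have \<delta>: "0 < \<delta>" "\<delta> \<le> d" "\<delta> \<le> 1" "\<delta> \<le> T" using d(1) T by (auto simp: \<delta>_def)
  show thesis
  proof (rule that[OF \<delta>(1)])
    fix x assume x: "continuous_on {0..T} x"
      and near: "\<And>t. t \<in> {0..T} \<Longrightarrow> \<bar>travel_time \<gamma> \<bar>x t\<bar> - t\<bar> < \<delta>"
    have abs_near: "\<bar>\<bar>x t\<bar> - H \<gamma> t\<bar> < r / 4" if t: "t \<in> {0..T}" for t
    proof -
      have "\<bar>H \<gamma> (travel_time \<gamma> \<bar>x t\<bar>) - H \<gamma> t\<bar> < r / 4"
        using near[OF t] t \<delta> travel_time_nonneg[OF \<gamma>(2), of "\<bar>x t\<bar>"] by (intro d(2)) auto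
      then show ?thesis by (simp add: H_travel_time[OF \<gamma>(2)])
    qed
    have small: "\<bar>x t\<bar> + H \<gamma> t < r" if t: "t \<in> {0..T}" "t < \<delta>" for t
    proof -
      have "\<bar>H \<gamma> t - H \<gamma> 0\<bar> < r / 4" using t \<delta> T by (intro d(2)) auto
      then have "H \<gamma> t < r / 4" by simp
      then show ?thesis using abs_near[OF t(1)] r by linarith
    qed
    have nz: "x t \<noteq> 0" if t: "t \<in> {\<delta>..T}" for t
    proof
      assume "x t = 0"
      then show False using near[of t] t \<delta> by simp
    qed
    have xc: "continuous_on {\<delta>..T} x" using \<delta> by (intro continuous_on_subset[OF x]) auto
    have sign: "0 < x t * x T" if t: "t \<in> {\<delta>..T}" for t
    proof (rule ccontr)
      assume "\<not> 0 < x t * x T"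
      then have "(x t \<le> 0 \<and> 0 \<le> x T) \<or> (0 \<le> x t \<and> x T \<le> 0)"
        by (auto simp: zero_less_mult_iff not_less)
      moreover have c: "continuous_on {t..T} x" using t by (intro continuous_on_subset[OF xc]) auto
      ultimately have "\<exists>s. t \<le> s \<and> s \<le> T \<and> x s = 0"
        using IVT'[of x t 0 T] IVT2'[of x T 0 t] t by auto
      then show False using nz t by fastforce
    qed
    show "(\<forall>t\<in>{0..T}. \<bar>x t - H \<gamma> t\<bar> < r) \<or> (\<forall>t\<in>{0..T}. \<bar>x t + H \<gamma> t\<bar> < r)"
    proof (cases "0 < x T")
      case True
      have "\<bar>x t - H \<gamma> t\<bar> < r" if t: "t \<in> {0..T}" for t
      proof (cases "t < \<delta>")
        case True
        then show ?thesis using small[OF t] H_nonneg[of \<gamma> t] by linarith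
      next
        case False
        then have "0 < x t" using sign[of t] t \<open>0 < x T\<close> by (simp add: zero_less_mult_iff)
        then show ?thesis using abs_near[OF t] r by linarith
      qed
      then show ?thesis by blast
    next
      case False
      have "\<bar>x t + H \<gamma> t\<bar> < r" if t: "t \<in> {0..T}" for t
      proof (cases "t < \<delta>")
        case True
        then show ?thesis using small[OF t] H_nonneg[of \<gamma> t] by linarith
      next
        case False
        then have "x t < 0" using sign[of t] t \<open>\<not> 0 < x T\<close> by (simp add: zero_less_mult_iff)
        then show ?thesis using abs_near[OF t] r by linarith
      qed
      then show ?thesis by blast
    qed
  qed
qed

context small_noise_solution
begin

text \<open>The parameter \<open>c\<close> of the functions above for which \<open>f'' / c\<close> is the second-order part of \<open>L f\<close>.\<close>

definition inverse_noise :: real where "inverse_noise = 2 / \<epsilon>\<^sup>2"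

lemma inverse_noise_pos: "0 < inverse_noise" and inverse_noise_eq: "\<epsilon>\<^sup>2 / 2 * inverse_noise = 1"
  using \<epsilon> by (simp_all add: inverse_noise_def)

lemma expectation_exit_function:
  "integrable M (\<lambda>\<omega>. exit_function \<gamma> inverse_noise (X T \<omega>))"
  "expectation (\<lambda>\<omega>. exit_function \<gamma> inverse_noise (X T \<omega>)) = T"
proof -
  note D = Dynkin_formula[OF bounded_C2_exit_function[OF \<gamma> inverse_noise_pos]]
  show "integrable M (\<lambda>\<omega>. exit_function \<gamma> inverse_noise (X T \<omega>))" by (rule D)
  have "drift \<gamma> x * exit_slope \<gamma> inverse_noise x + \<epsilon>\<^sup>2 / 2 * (inverse_noise * (1 - drift \<gamma> x * exit_slope \<gamma> inverse_noise x)) = 1" for x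
    by (simp only: mult.assoc[symmetric] inverse_noise_eq) simp
  then show "expectation (\<lambda>\<omega>. exit_function \<gamma> inverse_noise (X T \<omega>)) = T"
    unfolding D(3) using T
    by (simp add: exit_function_0[OF \<gamma> inverse_noise_pos] set_lebesgue_integral_def prob_space)
qed

text \<open>For the approximations \<open>L \<psi> = (b - smooth_drift) \<psi>'\<close>, which is bounded by \<open>\<bar>b\<bar>\<close> and tends to \<open>0\<close> at every
  point as \<open>\<delta>\<close> tends to \<open>0\<close>. Two dominated convergences, along the path and over the paths, give the claim.\<close>

lemma expectation_scale_function:
  "integrable M (\<lambda>\<omega>. scale_function \<gamma> inverse_noise (X T \<omega>))"
  "expectation (\<lambda>\<omega>. scale_function \<gamma> inverse_noise (X T \<omega>)) = 0"
proof -
  let ?c = inverse_noise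
  define d where "d n = 1 / real (Suc n)" for n
  have d: "0 < d n" for n by (simp add: d_def)
  let ?\<psi> = "\<lambda>n. smooth_scale_function \<gamma> ?c (d n)" and ?e = "\<lambda>n x. exp (- ?c * smooth_potential \<gamma> (d n) x)"
  let ?g = "\<lambda>n x. (drift \<gamma> x - smooth_drift \<gamma> (d n) x) * ?e n x"
  define I where "I n \<omega> = (LBINT s:{0..T}. drift \<gamma> (X s \<omega>) * ?e n (X s \<omega>) +
    \<epsilon>\<^sup>2 / 2 * (- ?c * smooth_drift \<gamma> (d n) (X s \<omega>) * ?e n (X s \<omega>)))" for n \<omega>
  note D = Dynkin_formula[OF bounded_C2_smooth_scale_function[OF \<gamma> inverse_noise_pos d], folded I_def]
  have gen: "drift \<gamma> x * ?e n x + \<epsilon>\<^sup>2 / 2 * (- ?c * smooth_drift \<gamma> (d n) x * ?e n x)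
      = ?g n x" for n x
  proof -
    have "\<epsilon>\<^sup>2 / 2 * (- ?c * smooth_drift \<gamma> (d n) x * ?e n x) = - (\<epsilon>\<^sup>2 / 2 * ?c) * (smooth_drift \<gamma> (d n) x * ?e n x)"
      by (simp only: mult_minus_left mult_minus_right mult.assoc)
    then show ?thesis by (simp only: inverse_noise_eq) (simp add: algebra_simps)
  qed
  have I: "I n \<omega> = (LBINT s:{0..T}. ?g n (X s \<omega>))" for n \<omega>
    unfolding I_def gen ..
  have e1: "0 \<le> ?e n x" "?e n x \<le> 1" for n x
    using inverse_noise_pos potential_nonneg[OF \<gamma>(1), of x] smooth_potential_bounds(1)[OF \<gamma> d, of x n]
    by auto
  have gb: "\<bar>?g n x\<bar> \<le> \<bar>drift \<gamma> x\<bar>" for n x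
  proof -
    have "\<bar>?g n x\<bar> \<le> \<bar>drift \<gamma> x\<bar> * 1"
      unfolding abs_mult using e1[of n x] smooth_drift_bounds(2)[OF \<gamma> d, of x n]
      by (intro mult_mono) auto
    then show ?thesis by simp
  qed
  have gm: "?g n \<in> borel_measurable borel" for n
  proof -
    have [measurable]: "smooth_drift \<gamma> (d n) \<in> borel_measurable borel" "smooth_potential \<gamma> (d n) \<in> borel_measurable borel"
      by (intro borel_measurable_continuous_onI continuous_smooth_drift[OF \<gamma> d] continuous_smooth_potential[OF \<gamma> d])+
    show ?thesis by measurable
  qed
  obtain Y where Y: "integrable M Y" "\<And>\<omega>. 0 \<le> Y \<omega>" "AE \<omega> in M. \<forall>t\<in>{0..T}. \<bar>X t \<omega>\<bar> \<le> Y \<omega>"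
    using X_dominated by blast
  have I_lim: "(\<lambda>n. I n \<omega>) \<longlonglongrightarrow> 0" if \<omega>: "\<omega> \<in> space M" for \<omega>
  proof -
    have abs_int: "set_integrable lborel {0..T} (\<lambda>s. \<bar>drift \<gamma> (X s \<omega>)\<bar>)"
      by (intro set_integrable_abs set_integrable_drift[OF \<gamma> X_continuous[OF \<omega>]])
    obtain K where K: "\<And>s. s \<in> {0..T} \<Longrightarrow> \<bar>drift \<gamma> (X s \<omega>)\<bar> \<le> 1 + K"
      using bounded_drift_path[OF \<gamma> X_continuous[OF \<omega>]] by blast
    have "(\<lambda>n. I n \<omega>) \<longlonglongrightarrow> (\<integral>s. (0::real) \<partial>(lborel :: real measure))"
      unfolding I set_lebesgue_integral_def
    proof (rule integral_dominated_convergence)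
      show "integrable lborel (\<lambda>s. indicator {0..T} s *\<^sub>R \<bar>drift \<gamma> (X s \<omega>)\<bar>)"
        using abs_int by (simp add: set_integrable_def)
      show "(\<lambda>s. indicator {0..T} s *\<^sub>R (?g n (X s \<omega>))) \<in> borel_measurable lborel" for n
      proof -
        have "set_integrable lborel {0..T} (\<lambda>s. ?g n (X s \<omega>))"
          by (rule set_integrable_comp_bounded[OF X_continuous[OF \<omega>], where g="?g n" and C="1 + K"])
            (use K gb gm in \<open>auto intro: order_trans\<close>)
        then show ?thesis unfolding set_integrable_def by (rule borel_measurable_integrable)
      qed
      show "AE s in lborel. (\<lambda>n. indicator {0..T} s *\<^sub>R (?g n (X s \<omega>))) \<longlonglongrightarrow> 0"
      proof (rule AE_I2)
        fix s
        have "(\<lambda>n. drift \<gamma> (X s \<omega>) - smooth_drift \<gamma> (d n) (X s \<omega>)) \<longlonglongrightarrow> drift \<gamma> (X s \<omega>) - drift \<gamma> (X s \<omega>)"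
          unfolding d_def by (intro tendsto_diff tendsto_const smooth_drift_tendsto \<gamma>)
        then have lim: "(\<lambda>n. \<bar>drift \<gamma> (X s \<omega>) - smooth_drift \<gamma> (d n) (X s \<omega>)\<bar>) \<longlonglongrightarrow> 0"
          by (simp add: tendsto_rabs_zero)
        have "(\<lambda>n. ?g n (X s \<omega>)) \<longlonglongrightarrow> 0"
          by (rule Lim_null_comparison[OF _ lim])
            (use e1 in \<open>auto simp: abs_mult intro!: always_eventually mult_left_le\<close>)
        then show "(\<lambda>n. indicator {0..T} s *\<^sub>R (?g n (X s \<omega>))) \<longlonglongrightarrow> 0"
          by (cases "s \<in> {0..T}") auto
      qed
      show "AE s in lborel. norm (indicator {0..T} s *\<^sub>R (?g n (X s \<omega>)))
          \<le> indicator {0..T} s *\<^sub>R \<bar>drift \<gamma> (X s \<omega>)\<bar>" for n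
      proof (rule AE_I2)
        fix s
        show "norm (indicator {0..T} s *\<^sub>R (?g n (X s \<omega>)))
          \<le> indicator {0..T} s *\<^sub>R \<bar>drift \<gamma> (X s \<omega>)\<bar>"
          using gb[of "X s \<omega>" n] by (cases "s \<in> {0..T}") simp_all
      qed
    qed simp
    then show ?thesis by simp
  qed
  have I_bd: "AE \<omega> in M. norm (I n \<omega>) \<le> T * (1 + Y \<omega>)" for n
    using Y(3) AE_space
  proof eventually_elim
    case (elim \<omega>)
    have b: "\<bar>?g n (X s \<omega>)\<bar> \<le> 1 + Y \<omega>" if "s \<in> {0..T}" for s
      using gb[of "X s \<omega>" n] abs_drift_le[OF \<gamma>, of "X s \<omega>"] elim(1) that by force
    have i: "set_integrable lborel {0..T} (\<lambda>s. ?g n (X s \<omega>))"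
      by (rule set_integrable_comp_bounded[OF X_continuous[OF elim(2)], where g="?g n" and C="1 + Y \<omega>"])
        (use b gm in auto)
    have "norm (I n \<omega>) \<le> (1 + Y \<omega>) * (T - 0)"
      unfolding I real_norm_def using T b by (intro abs_LBINT_Icc_le[OF i]) auto
    also have "\<dots> = T * (1 + Y \<omega>)" by simp
    finally show ?case .
  qed
  have "(\<lambda>n. expectation (I n)) \<longlonglongrightarrow> expectation (\<lambda>\<omega>. 0)"
  proof (rule integral_dominated_convergence)
    show "I n \<in> borel_measurable M" for n using D(2) by (rule borel_measurable_integrable)
    show "integrable M (\<lambda>\<omega>. T * (1 + Y \<omega>))" using Y(1) by simp
  qed (use I_lim I_bd in auto)
  then have E1: "(\<lambda>n. expectation (\<lambda>\<omega>. ?\<psi> n (X T \<omega>))) \<longlonglongrightarrow> 0"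
    unfolding D(3) by (simp add: smooth_scale_function_0[OF \<gamma> inverse_noise_pos d])
  have XT: "integrable M (\<lambda>\<omega>. \<bar>X T \<omega>\<bar>)" using T by (intro integrable_abs X_integrable) auto
  have sm: "(\<lambda>\<omega>. scale_function \<gamma> ?c (X T \<omega>)) \<in> borel_measurable M"
  proof (rule measurable_compose[of "X T" M borel])
    show "X T \<in> borel_measurable M" using T by (intro X_measurable) auto
    show "scale_function \<gamma> ?c \<in> borel_measurable borel"
      using DERIV_isCont[OF DERIV_scale_function[OF \<gamma> inverse_noise_pos]]
      by (intro borel_measurable_continuous_onI continuous_at_imp_continuous_on) blast
  qed
  have lim: "AE \<omega> in M. (\<lambda>n. ?\<psi> n (X T \<omega>)) \<longlonglongrightarrow> scale_function \<gamma> ?c (X T \<omega>)"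
    unfolding d_def by (intro AE_I2 smooth_scale_function_tendsto \<gamma> inverse_noise_pos)
  have bd: "AE \<omega> in M. norm (?\<psi> n (X T \<omega>)) \<le> \<bar>X T \<omega>\<bar>" for n
    using abs_smooth_scale_function_le[OF \<gamma> inverse_noise_pos d] by simp
  have m: "(\<lambda>\<omega>. ?\<psi> n (X T \<omega>)) \<in> borel_measurable M" for n
    using D(1) by (rule borel_measurable_integrable)
  show "integrable M (\<lambda>\<omega>. scale_function \<gamma> ?c (X T \<omega>))"
    by (rule integrable_dominated_convergence[OF sm m XT lim bd])
  have "(\<lambda>n. expectation (\<lambda>\<omega>. ?\<psi> n (X T \<omega>))) \<longlonglongrightarrow> expectation (\<lambda>\<omega>. scale_function \<gamma> ?c (X T \<omega>))"
    by (rule integral_dominated_convergence[OF sm m XT lim bd])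
  with E1 show "expectation (\<lambda>\<omega>. scale_function \<gamma> ?c (X T \<omega>)) = 0"
    by (rule LIMSEQ_unique[THEN sym])
qed

text \<open>Let \<open>q = exp (- c * potential \<gamma> x0)\<close> and \<open>m = 1 / (1 - q)\<close>. The variable \<open>\<sigma> s(X T) / s(x0)\<close> has mean \<open>0\<close>, is
  at least \<open>1\<close> on \<open>U\<close>, and is never below \<open>- m\<close>. Hence \<open>prob U \<le> m (1 - prob U)\<close>, and
  \<open>m / (1 + m) = 1 / (2 - q)\<close>.\<close>

lemma prob_one_sided_le:
  assumes x0: "0 < x0" and U: "U \<in> events" and \<sigma>: "\<sigma> = 1 \<or> \<sigma> = - 1"
    and far: "\<And>\<omega>. \<omega> \<in> U \<Longrightarrow> x0 \<le> \<sigma> * X T \<omega>"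
  shows "prob U \<le> 1 / (2 - exp (- inverse_noise * potential \<gamma> x0))"
proof -
  let ?s = "scale_function \<gamma> inverse_noise"
  define q where "q = exp (- inverse_noise * potential \<gamma> x0)"
  define m where "m = 1 / (1 - q)"
  have "0 < inverse_noise * potential \<gamma> x0" using inverse_noise_pos potential_pos[OF \<gamma>(1), of x0] x0 by simp
  then have q: "0 < q" "q < 1" by (auto simp: q_def)
  have m: "0 < m" using q by (simp add: m_def)
  have s0: "0 < ?s x0" by (rule scale_function_pos[OF \<gamma> inverse_noise_pos x0])
  have bd: "\<bar>?s x\<bar> / ?s x0 \<le> m" for x
    using scale_function_upper[OF \<gamma> inverse_noise_pos x0, of x] q s0 unfolding q_def[symmetric] m_def
    by (simp add: field_simps)
  have low: "(1 + m) * indicator U \<omega> - m \<le> \<sigma> * ?s (X T \<omega>) / ?s x0" for \<omega>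
  proof (cases "\<omega> \<in> U")
    case True
    have "?s x0 \<le> ?s (\<sigma> * X T \<omega>)" using far[OF True] by (rule scale_function_mono[OF \<gamma> inverse_noise_pos])
    also have "\<dots> = \<sigma> * ?s (X T \<omega>)" using \<sigma> scale_function_minus[OF \<gamma> inverse_noise_pos] by auto
    finally show ?thesis using True s0 by (simp add: field_simps)
  next
    case False
    have "- (\<sigma> * ?s (X T \<omega>)) / ?s x0 \<le> \<bar>?s (X T \<omega>)\<bar> / ?s x0"
      using \<sigma> s0 by (intro divide_right_mono) auto
    then show ?thesis using False bd[of "X T \<omega>"] by simp
  qed
  have "expectation (\<lambda>\<omega>. (1 + m) * indicator U \<omega> - m) \<le> expectation (\<lambda>\<omega>. \<sigma> * ?s (X T \<omega>) / ?s x0)"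
    using low expectation_scale_function(1) U by (intro integral_mono) (auto simp: emeasure_eq_measure)
  also have "\<dots> = 0" using expectation_scale_function(2) by simp
  also have "expectation (\<lambda>\<omega>. (1 + m) * indicator U \<omega> - m) = (1 + m) * prob U - m"
    using U by (simp add: emeasure_eq_measure prob_space)
  finally have "prob U \<le> m / (1 + m)" using m by (simp add: field_simps)
  also have "m / (1 + m) = 1 / (2 - q)" using q by (simp add: m_def field_simps)
  finally show ?thesis by (simp only: q_def)
qed

text \<open>Off an event of small probability both \<open>P = \<phi>(2 \<epsilon> V)\<close> and \<open>Z = T + P - u(X T)\<close> are below \<open>\<delta>\<close>. The
  first yields \<open>\<phi>(\<bar>X t\<bar>) < t + \<delta>\<close>. The second yields \<open>\<phi>(\<bar>X T\<bar>) > T + P - \<delta>\<close>, and then the speed limit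
  between \<open>t\<close> and \<open>T\<close> gives \<open>\<phi>(\<bar>X t\<bar>) > t - \<delta>\<close>. Markov's inequality is applied to \<open>Z\<close> and to \<open>P\<close>, whose
  expectations agree; this is the factor \<open>2\<close>. The crude \<open>V powr (1 - \<gamma>) \<le> 2 + V\<^sup>2\<close> makes the bound uniform
  over all Brownian motions.\<close>

lemma prob_not_extremal_le:
  assumes \<delta>: "0 < \<delta>" and G: "G \<in> events"
    and imp: "\<And>\<omega>. \<omega> \<in> space M \<Longrightarrow> (\<And>t. t \<in> {0..T} \<Longrightarrow> \<bar>travel_time \<gamma> \<bar>X t \<omega>\<bar> - t\<bar> < \<delta>) \<Longrightarrow> \<omega> \<in> G"
  shows "1 - prob G \<le> 2 * ((2 * \<epsilon>) powr (1 - \<gamma>) * (2 + 8 * T) / (1 - \<gamma>)) / \<delta>"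
proof -
  obtain V where V: "V \<in> borel_measurable M" "\<And>\<omega>. 0 \<le> V \<omega>"
    "integrable M (\<lambda>\<omega>. (V \<omega>)\<^sup>2)" "expectation (\<lambda>\<omega>. (V \<omega>)\<^sup>2) \<le> 8 * T"
    "AE \<omega> in M. \<forall>s t. 0 \<le> s \<longrightarrow> s \<le> t \<longrightarrow> t \<le> T \<longrightarrow>
       travel_time \<gamma> \<bar>X t \<omega>\<bar> \<le> travel_time \<gamma> \<bar>X s \<omega>\<bar> + travel_time \<gamma> (2 * \<epsilon> * V \<omega>) + (t - s)"
    using path_noise_bound by blast
  note [measurable] = V(1)
  define \<kappa> where "\<kappa> = (2 * \<epsilon>) powr (1 - \<gamma>) * (2 + 8 * T) / (1 - \<gamma>)"
  define P where "P \<omega> = travel_time \<gamma> (2 * \<epsilon> * V \<omega>)" for \<omega>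
  let ?u = "\<lambda>\<omega>. exit_function \<gamma> inverse_noise (X T \<omega>)"
  define Z where "Z \<omega> = T + P \<omega> - ?u \<omega>" for \<omega>
  have Pm [measurable]: "P \<in> borel_measurable M" unfolding P_def travel_time_def by measurable
  have P0: "0 \<le> P \<omega>" for \<omega> unfolding P_def by (rule travel_time_nonneg[OF \<gamma>(2)])
  have Pb: "P \<omega> \<le> (2 * \<epsilon>) powr (1 - \<gamma>) / (1 - \<gamma>) * (2 + (V \<omega>)\<^sup>2)" for \<omega>
  proof -
    have "V \<omega> powr (1 - \<gamma>) \<le> 1 + V \<omega>" using \<gamma> V(2) by (intro powr_le_one_plus) auto
    also have "\<dots> \<le> 2 + (V \<omega>)\<^sup>2"
      using zero_le_power2[of "V \<omega> - 1"] V(2)[of \<omega>] by (simp add: power2_diff)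
    finally have "(2 * \<epsilon>) powr (1 - \<gamma>) / (1 - \<gamma>) * V \<omega> powr (1 - \<gamma>) \<le> (2 * \<epsilon>) powr (1 - \<gamma>) / (1 - \<gamma>) * (2 + (V \<omega>)\<^sup>2)"
      using \<gamma> by (intro mult_left_mono) auto
    moreover have "P \<omega> = (2 * \<epsilon>) powr (1 - \<gamma>) / (1 - \<gamma>) * V \<omega> powr (1 - \<gamma>)"
      using \<epsilon> V(2) by (simp add: P_def travel_time_def powr_mult)
    ultimately show ?thesis by simp
  qed
  have i: "integrable M (\<lambda>\<omega>. (2 * \<epsilon>) powr (1 - \<gamma>) / (1 - \<gamma>) * (2 + (V \<omega>)\<^sup>2))" using V(3) by simp
  have Pi: "integrable M P"
    by (rule Bochner_Integration.integrable_bound[OF i Pm]) (use order_trans[OF Pb abs_ge_self] P0 in \<open>simp only: real_norm_def abs_of_nonneg, simp\<close>)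
  have "expectation P \<le> expectation (\<lambda>\<omega>. (2 * \<epsilon>) powr (1 - \<gamma>) / (1 - \<gamma>) * (2 + (V \<omega>)\<^sup>2))"
    by (rule integral_mono[OF Pi i Pb])
  also have "\<dots> = (2 * \<epsilon>) powr (1 - \<gamma>) / (1 - \<gamma>) * (2 + expectation (\<lambda>\<omega>. (V \<omega>)\<^sup>2))"
    using V(3) by (simp add: prob_space)
  also have "\<dots> \<le> (2 * \<epsilon>) powr (1 - \<gamma>) / (1 - \<gamma>) * (2 + 8 * T)"
    using V(4) \<gamma> by (intro mult_left_mono) auto
  finally have PE: "expectation P \<le> \<kappa>" by (simp add: \<kappa>_def)
  note u = expectation_exit_function
  have Zi: "integrable M Z" unfolding Z_def using Pi u(1) by simp
  have ZE: "expectation Z = expectation P"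
    unfolding Z_def using Pi u by (simp add: prob_space)
  have Z0: "AE \<omega> in M. 0 \<le> Z \<omega>"
    using V(5) AE_space
  proof eventually_elim
    case (elim \<omega>)
    have "?u \<omega> \<le> travel_time \<gamma> \<bar>X T \<omega>\<bar>" by (rule exit_function_le_travel_time[OF \<gamma> inverse_noise_pos])
    also have "\<dots> \<le> P \<omega> + T" using elim(1)[rule_format, of 0 T] T X_start[OF elim(2)] by (simp add: P_def)
    finally show ?case by (simp add: Z_def)
  qed
  have pZ: "prob {\<omega> \<in> space M. \<delta> \<le> Z \<omega>} \<le> \<kappa> / \<delta>"
    using integral_Markov_inequality_measure[OF Zi sets.top Z0 \<delta>] PE ZE \<delta>
    by (simp add: divide_right_mono order_trans)
  have pP: "prob {\<omega> \<in> space M. \<delta> \<le> P \<omega>} \<le> \<kappa> / \<delta>"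
    using integral_Markov_inequality_measure[OF Pi sets.top AE_I2 \<delta>] P0 PE \<delta>
    by (simp add: divide_right_mono order_trans)
  have [measurable]: "Z \<in> borel_measurable M" using Zi by (rule borel_measurable_integrable)
  let ?B = "{\<omega> \<in> space M. \<delta> \<le> Z \<omega>} \<union> {\<omega> \<in> space M. \<delta> \<le> P \<omega>}"
  have "AE \<omega> in M. \<omega> \<in> space M - G \<longrightarrow> \<omega> \<in> ?B"
    using V(5) AE_space
  proof eventually_elim
    case (elim \<omega>)
    show ?case
    proof (rule impI, rule ccontr)
      assume "\<omega> \<in> space M - G" "\<omega> \<notin> ?B"
      then have \<omega>: "\<omega> \<notin> G" "Z \<omega> < \<delta>" "P \<omega> < \<delta>" using elim(2) by auto
      have "\<omega> \<in> G"
      proof (rule imp[OF elim(2)])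
        fix t assume t: "t \<in> {0..T}"
        have "travel_time \<gamma> \<bar>X t \<omega>\<bar> \<le> P \<omega> + t"
          using elim(1)[rule_format, of 0 t] t X_start[OF elim(2)] by (simp add: P_def)
        moreover have "travel_time \<gamma> \<bar>X T \<omega>\<bar> \<le> travel_time \<gamma> \<bar>X t \<omega>\<bar> + P \<omega> + (T - t)"
          using elim(1)[rule_format, of t T] t by (simp add: P_def)
        moreover have "?u \<omega> \<le> travel_time \<gamma> \<bar>X T \<omega>\<bar>" by (rule exit_function_le_travel_time[OF \<gamma> inverse_noise_pos])
        ultimately show "\<bar>travel_time \<gamma> \<bar>X t \<omega>\<bar> - t\<bar> < \<delta>" using \<omega>(2,3) by (simp add: Z_def abs_less_iff)
      qed
      with \<omega>(1) show False by simp
    qed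
  qed
  then have "prob (space M - G) \<le> prob ?B" using G by (intro finite_measure_mono_AE) auto
  also have "\<dots> \<le> \<kappa> / \<delta> + \<kappa> / \<delta>"
    by (rule order_trans[OF measure_Un_le]) (use pZ pP in auto)
  finally show ?thesis using prob_compl[OF G] by (simp add: \<kappa>_def mult.commute)
qed

end

section \<open>Measurability and weak convergence on the path space\<close>

lemma space_borel_of [simp]: "space (borel_of S) = topspace S"
  unfolding borel_of_def by (rule space_measure_of) (auto dest: openin_subset)

lemma sets_borel_of: "sets (borel_of S) = sigma_sets (topspace S) {U. openin S U}"
  unfolding borel_of_def by (rule sets_measure_of) (auto dest: openin_subset)

lemma openin_sets_borel_of: "openin S U \<Longrightarrow> U \<in> sets (borel_of S)"
  unfolding sets_borel_of by (rule sigma_sets.Basic) simp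

lemma measurable_borel_of:
  assumes "f \<in> space M \<rightarrow> topspace S" "\<And>U. openin S U \<Longrightarrow> f -` U \<inter> space M \<in> sets M"
  shows "f \<in> M \<rightarrow>\<^sub>M borel_of S"
  by (rule measurable_sigma_sets[OF sets_borel_of]) (use assms in \<open>auto dest: openin_subset\<close>)

lemma continuous_map_borel_measurable:
  assumes "continuous_map S euclideanreal f"
  shows "f \<in> borel_measurable (borel_of S)"
proof (rule borel_measurableI)
  fix U :: "real set" assume "open U"
  then have "openin S {x \<in> topspace S. f x \<in> U}"
    using openin_continuous_map_preimage[OF assms, of U] by simp
  moreover have "{x \<in> topspace S. f x \<in> U} = f -` U \<inter> space (borel_of S)" by auto
  ultimately show "f -` U \<inter> space (borel_of S) \<in> sets (borel_of S)"
    using openin_sets_borel_of by metis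
qed

lemma openin_mball_of: "openin (mtopology_of m) (mball_of m x r)"
  by (simp add: mtopology_of_def mball_of_def Metric_space.openin_mball)

definition two_point_measure :: "'a topology \<Rightarrow> 'a \<Rightarrow> 'a \<Rightarrow> 'a measure" where
  "two_point_measure S a b = add_measure (scale_measure (1 / 2) (return (borel_of S) a))
     (scale_measure (1 / 2) (return (borel_of S) b))"

text \<open>A coin toss realises the measure, which reduces integrals to those of a Bernoulli variable.\<close>

lemma two_point_measure_eq_distr:
  assumes "a \<in> topspace S" "b \<in> topspace S"
  shows "two_point_measure S a b = distr (measure_pmf (bernoulli_pmf (1/2))) (borel_of S) (\<lambda>c. if c then a else b)"
proof (rule measure_eqI)
  let ?D = "distr (measure_pmf (bernoulli_pmf (1/2))) (borel_of S) (\<lambda>c. if c then a else b)"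
  have m: "(\<lambda>c. if c then a else b) \<in> measure_pmf (bernoulli_pmf (1/2)) \<rightarrow>\<^sub>M borel_of S"
    using assms by (auto simp: measurable_def)
  show "sets (two_point_measure S a b) = sets ?D" by (simp add: two_point_measure_def)
  fix A assume "A \<in> sets (two_point_measure S a b)"
  then have A: "A \<in> sets (borel_of S)" by (simp add: two_point_measure_def)
  have "emeasure ?D A = (\<integral>\<^sup>+y. indicator A y \<partial>?D)" using A by simp
  also have "\<dots> = (\<integral>\<^sup>+c. indicator A (if c then a else b) \<partial>measure_pmf (bernoulli_pmf (1/2)))"
    by (rule nn_integral_distr[OF m]) (use A in measurable)
  also have "\<dots> = indicator A a * ennreal (1/2) + indicator A b * ennreal (1 - 1/2)"
    by (subst nn_integral_bernoulli_pmf) auto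
  also have "\<dots> = ennreal (1/2) * indicator A a + ennreal (1/2) * indicator A b"
    by (simp add: mult.commute)
  also have "ennreal (1/2) = 1/2" using divide_ennreal[of 1 2] by simp
  finally show "emeasure (two_point_measure S a b) A = emeasure ?D A"
    using A unfolding two_point_measure_def by (subst emeasure_add_measure) auto
qed

text \<open>A continuous function is nearly constant on small balls around \<open>a\<close> and \<open>b\<close>. These are disjoint for
  radii below half the distance, and the mass outside them tends to \<open>0\<close>.\<close>

lemma weak_convergence_two_point:
  assumes ab: "a \<in> mspace m" "b \<in> mspace m" "a \<noteq> b"
    and \<nu>: "\<forall>\<^sub>F i in G. prob_space (\<nu> i) \<and> sets (\<nu> i) = sets (borel_of (mtopology_of m))"
    and la: "\<And>r. 0 < r \<Longrightarrow> r < mdist m a b / 2 \<Longrightarrow> ((\<lambda>i. measure (\<nu> i) (mball_of m a r)) \<longlongrightarrow> 1 / 2) G"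
    and lb: "\<And>r. 0 < r \<Longrightarrow> r < mdist m a b / 2 \<Longrightarrow> ((\<lambda>i. measure (\<nu> i) (mball_of m b r)) \<longlongrightarrow> 1 / 2) G"
  shows "weak_convergence (mtopology_of m) \<nu> (two_point_measure (mtopology_of m) a b) G"
proof -
  let ?S = "mtopology_of m"
  let ?D = "distr (measure_pmf (bernoulli_pmf (1/2))) (borel_of ?S) (\<lambda>c. if c then a else b)"
  have ab': "a \<in> topspace ?S" "b \<in> topspace ?S" using ab by simp_all
  have meas: "(\<lambda>c. if c then a else b) \<in> measure_pmf (bernoulli_pmf (1/2)) \<rightarrow>\<^sub>M borel_of ?S"
    using ab' by (auto simp: measurable_def)
  have D: "two_point_measure ?S a b = ?D" by (rule two_point_measure_eq_distr[OF ab'])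
  have "prob_space ?D" by (intro measure_pmf.prob_space_distr meas)
  moreover have "((\<lambda>i. \<integral>x. f x \<partial>\<nu> i) \<longlongrightarrow> (\<integral>x. f x \<partial>?D)) G"
    if f: "continuous_map ?S euclideanreal f" "bounded (f ` topspace ?S)" for f
  proof -
    have fm: "f \<in> borel_measurable (borel_of ?S)" by (rule continuous_map_borel_measurable[OF f(1)])
    obtain K where K: "0 < K" "\<And>x. x \<in> topspace ?S \<Longrightarrow> \<bar>f x\<bar> \<le> K"
      using f(2) unfolding bounded_pos by auto
    have lim: "(\<integral>x. f x \<partial>?D) = (f a + f b) / 2"
      by (subst integral_distr[OF meas fm]) (simp add: integral_bernoulli_pmf)
    have near: "\<exists>r>0. r < mdist m a b / 2 \<and> (\<forall>y\<in>mball_of m x r. \<bar>f y - f x\<bar> < e)"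
      if "x \<in> mspace m" "0 < e" for x e
    proof -
      have "openin ?S {y \<in> topspace ?S. f y \<in> ball (f x) e}"
        using openin_continuous_map_preimage[OF f(1), of "ball (f x) e"] by simp
      moreover have "x \<in> {y \<in> topspace ?S. f y \<in> ball (f x) e}" using that by simp
      ultimately obtain r where r: "0 < r" "mball_of m x r \<subseteq> {y \<in> topspace ?S. f y \<in> ball (f x) e}"
        unfolding mtopology_of_def mball_of_def
        by (metis (no_types, lifting) Metric_space.openin_mtopology Metric_space_mspace_mdist)
      have "0 < mdist m a b" using ab Metric_space.mdist_pos_less[OF Metric_space_mspace_mdist] by metis
      then show ?thesis
        using r by (intro exI[of _ "min r (mdist m a b / 4)"]) (auto simp: dist_real_def abs_minus_commute)
    qed
    show ?thesis unfolding lim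
    proof (rule tendstoI)
      fix e :: real assume e: "0 < e"
      obtain ra where ra: "0 < ra" "ra < mdist m a b / 2" "\<And>y. y \<in> mball_of m a ra \<Longrightarrow> \<bar>f y - f a\<bar> < e / 2"
        using near[OF ab(1), of "e / 2"] e by auto
      obtain rb where rb: "0 < rb" "rb < mdist m a b / 2" "\<And>y. y \<in> mball_of m b rb \<Longrightarrow> \<bar>f y - f b\<bar> < e / 2"
        using near[OF ab(2), of "e / 2"] e by auto
      let ?A = "mball_of m a ra" and ?B = "mball_of m b rb"
      have disj: "?A \<inter> ?B = {}"
      proof (rule equals0I)
        fix y assume "y \<in> ?A \<inter> ?B"
        then have "mdist m a y < mdist m a b / 2" "mdist m b y < mdist m a b / 2" "y \<in> mspace m"
          using ra rb by auto
        moreover have "mdist m a b \<le> mdist m a y + mdist m y b" using ab \<open>y \<in> mspace m\<close> by (intro mdist_triangle)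
        ultimately show False by (simp add: mdist_commute)
      qed
      define p where "p i = measure (\<nu> i) ?A" for i
      define q where "q i = measure (\<nu> i) ?B" for i
      have "((\<lambda>i. \<bar>f a * (p i - 1/2)\<bar> + \<bar>f b * (q i - 1/2)\<bar> + K * (1 - p i - q i) + e / 2) \<longlongrightarrow>
          \<bar>f a * (1/2 - 1/2)\<bar> + \<bar>f b * (1/2 - 1/2)\<bar> + K * (1 - 1/2 - 1/2) + e / 2) G"
        unfolding p_def q_def by (intro tendsto_intros la lb ra rb)
      then have "\<forall>\<^sub>F i in G. \<bar>f a * (p i - 1/2)\<bar> + \<bar>f b * (q i - 1/2)\<bar> + K * (1 - p i - q i) + e / 2 < e"
        by (rule order_tendstoD(2)) (use e in simp)
      with \<nu> show "\<forall>\<^sub>F i in G. dist (\<integral>x. f x \<partial>\<nu> i) ((f a + f b) / 2) < e"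
      proof eventually_elim
        case (elim i)
        interpret prob_space "\<nu> i" using elim by simp
        have s: "sets (\<nu> i) = sets (borel_of ?S)" using elim by simp
        then have sp: "space (\<nu> i) = mspace m" using sets_eq_imp_space_eq[OF s] by simp
        have AB: "?A \<in> sets (\<nu> i)" "?B \<in> sets (\<nu> i)"
          unfolding s by (intro openin_sets_borel_of openin_mball_of)+
        have fi: "integrable (\<nu> i) f"
          by (rule integrable_const_bound[of _ K]) (use K sp fm s in \<open>auto cong: measurable_cong_sets\<close>)
        let ?g = "\<lambda>x. f a * indicator ?A x + f b * indicator ?B x"
        have gi: "integrable (\<nu> i) ?g" using AB by (simp add: emeasure_eq_measure)
        have gI: "(\<integral>x. ?g x \<partial>\<nu> i) = f a * p i + f b * q i"
          using AB by (simp add: p_def q_def emeasure_eq_measure)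
        let ?h = "\<lambda>x. e / 2 + K * (1 - indicator ?A x - indicator ?B x)"
        have hi: "integrable (\<nu> i) ?h" using AB by (simp add: emeasure_eq_measure)
        have hI: "(\<integral>x. ?h x \<partial>\<nu> i) = e / 2 + K * (1 - p i - q i)"
          using AB by (simp add: p_def q_def emeasure_eq_measure prob_space)
        have "\<bar>(\<integral>x. f x \<partial>\<nu> i) - (\<integral>x. ?g x \<partial>\<nu> i)\<bar> = \<bar>\<integral>x. f x - ?g x \<partial>\<nu> i\<bar>"
          by (subst Bochner_Integration.integral_diff[OF fi gi]) simp
        also have "\<dots> \<le> (\<integral>x. \<bar>f x - ?g x\<bar> \<partial>\<nu> i)" by (rule integral_abs_bound)
        also have "\<dots> \<le> (\<integral>x. ?h x \<partial>\<nu> i)"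
        proof (rule integral_mono)
          show "integrable (\<nu> i) (\<lambda>x. \<bar>f x - ?g x\<bar>)" using fi gi by (intro integrable_abs Bochner_Integration.integrable_diff)
          fix x assume "x \<in> space (\<nu> i)"
          then have "\<bar>f x\<bar> \<le> K" using K(2) sp by simp
          moreover have "x \<notin> ?B" if "x \<in> ?A" using disj that by blast
          ultimately show "\<bar>f x - ?g x\<bar> \<le> ?h x"
            using ra(3)[of x] rb(3)[of x] K(1) e by (cases "x \<in> ?A"; cases "x \<in> ?B") (auto simp: less_imp_le simp del: in_mball_of)
        qed (fact hi)
        finally have 1: "\<bar>(\<integral>x. f x \<partial>\<nu> i) - (f a * p i + f b * q i)\<bar> \<le> e / 2 + K * (1 - p i - q i)"
          by (simp only: gI hI)
        have "(\<integral>x. f x \<partial>\<nu> i) - (f a + f b) / 2 = ((\<integral>x. f x \<partial>\<nu> i) - (f a * p i + f b * q i))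
            + f a * (p i - 1/2) + f b * (q i - 1/2)" by (simp add: field_simps)
        then show ?case using 1 elim(2) unfolding dist_real_def by linarith
      qed
    qed
  qed
  ultimately show ?thesis
    unfolding weak_convergence_def D using \<nu> by simp
qed

text \<open>Bernstein polynomials with rational coefficients are a countable set that is dense in the
  continuous functions; a list contains the coefficients, its length fixes the degree.\<close>

lemma Bernstein_approximation:
  assumes T: "0 < T" and f: "continuous_on {0..T} f" and e: "0 < e"
  shows "\<exists>cs :: rat list. \<forall>t\<in>{0..T}. \<bar>f t - (\<Sum>k<length cs. of_rat (cs ! k) * Bernstein (length cs - 1) k (t / T))\<bar> < e"
proof -
  have "continuous_on {0..1} (\<lambda>x. f (T * x))"
    using T by (intro continuous_on_compose2[OF f] continuous_intros) (auto simp: mult_left_le)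
  from Bernstein_Weierstrass[OF this, of "e / 2"] e obtain N where
    N: "\<And>n x. N \<le> n \<Longrightarrow> x \<in> {0..1} \<Longrightarrow> \<bar>f (T * x) - (\<Sum>k\<le>n. f (T * (k / n)) * Bernstein n k x)\<bar> < e / 2"
    by auto
  have "\<exists>q. \<bar>of_rat q - f (T * (real k / N))\<bar> < e / 2" for k :: nat
  proof -
    obtain q where "f (T * (k / N)) - e / 2 < of_rat q" "of_rat q < f (T * (k / N)) + e / 2"
      using of_rat_dense[of "f (T * (k / N)) - e / 2" "f (T * (k / N)) + e / 2"] e by auto
    then show ?thesis by (intro exI[of _ q]) linarith
  qed
  then obtain q :: "nat \<Rightarrow> rat" where q: "\<And>k. \<bar>of_rat (q k) - f (T * (real k / N))\<bar> < e / 2" by metis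
  show ?thesis
  proof (intro exI[of _ "map q [0..<Suc N]"] ballI)
    fix t assume t: "t \<in> {0..T}"
    define x where "x = t / T"
    have x: "x \<in> {0..1}" "T * x = t" using t T by (auto simp: x_def)
    have "\<bar>(\<Sum>k\<le>N. f (T * (k / N)) * Bernstein N k x) - (\<Sum>k\<le>N. of_rat (q k) * Bernstein N k x)\<bar>
        = \<bar>\<Sum>k\<le>N. (f (T * (k / N)) - of_rat (q k)) * Bernstein N k x\<bar>"
      by (simp only: sum_subtractf left_diff_distrib)
    also have "\<dots> \<le> (\<Sum>k\<le>N. e / 2 * Bernstein N k x)"
    proof (rule order_trans[OF sum_abs sum_mono])
      fix k
      show "\<bar>(f (T * (k / N)) - of_rat (q k)) * Bernstein N k x\<bar> \<le> e / 2 * Bernstein N k x"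
        using mult_right_mono[OF less_imp_le[OF q[of k]] Bernstein_nonneg[of x N k]] x Bernstein_nonneg[of x N k]
        by (simp add: abs_mult abs_minus_commute)
    qed
    also have "\<dots> = e / 2" by (simp only: sum_distrib_left[symmetric] sum_Bernstein mult_1_right)
    finally have "\<bar>f t - (\<Sum>k\<le>N. of_rat (q k) * Bernstein N k x)\<bar> < e"
      using N[OF order_refl x(1)] unfolding x(2) by linarith
    moreover have "(\<Sum>k<length (map q [0..<Suc N]). of_rat (map q [0..<Suc N] ! k) * Bernstein (length (map q [0..<Suc N]) - 1) k x)
       = (\<Sum>k\<le>N. of_rat (q k) * Bernstein N k x)"
      by (intro sum.cong) (auto simp del: upt_Suc)
    ultimately show "\<bar>f t - (\<Sum>k<length (map q [0..<Suc N]). of_rat (map q [0..<Suc N] ! k) * Bernstein (length (map q [0..<Suc N]) - 1) k (t / T))\<bar> < e"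
      by (simp only: x_def)
  qed
qed

lemma sets_Collect_countable_Ball_set:
  assumes "countable I" "\<And>i. i \<in> I \<Longrightarrow> {x \<in> space M. P i x} \<in> sets M"
  shows "{x \<in> space M. \<forall>i\<in>I. P i x} \<in> sets M"
proof -
  have "{x \<in> space M. \<forall>i\<in>I. P i x} = space M - (\<Union>i\<in>I. space M - {x \<in> space M. P i x})" by auto
  also have "\<dots> \<in> sets M" using assms by (intro sets.Diff sets.countable_UN') auto
  finally show ?thesis .
qed

text \<open>By separability an open set is a countable union of sets \<open>C (cs, n)\<close>, closed balls around rational Bernstein
  polynomials. Such a ball is determined by the values at rational times. Its centre need not
  vanish at \<open>0\<close>, and so need not belong to the space itself.\<close>

lemma path_map_measurable:
  assumes T: "0 < T" and x: "\<And>\<omega>. \<omega> \<in> space M \<Longrightarrow> x \<omega> \<in> mspace (C0_space T)"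
    and meas: "\<And>t. t \<in> {0..T} \<Longrightarrow> (\<lambda>\<omega>. x \<omega> t) \<in> borel_measurable M"
  shows "x \<in> M \<rightarrow>\<^sub>M borel_of (C0_topology T)"
proof (rule measurable_borel_of)
  show "x \<in> space M \<rightarrow> topspace (C0_topology T)" using x by simp
  fix U assume U: "openin (C0_topology T) U"
  define P where "P cs t = (\<Sum>k<length cs. of_rat (cs ! k) * Bernstein (length cs - 1) k (t / T))" for cs :: "rat list" and t
  have Pcont: "continuous_on A (P cs)" for cs A
    unfolding P_def Bernstein_def by (intro continuous_intros) (use T in auto)
  define C where "C p = {f \<in> mspace (C0_space T). \<forall>t\<in>{0..T}. \<bar>f t - P (fst p) t\<bar> \<le> 1 / real (Suc (snd p))}" for p :: "rat list \<times> nat"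
  have C0: "f \<in> mspace (C0_space T) \<longleftrightarrow> f \<in> extensional {0..T} \<and> continuous_on {0..T} f \<and> f 0 = 0" for f
    using mspace_C0_space[of T] T by auto
  have "U = (\<Union>p\<in>{p. C p \<subseteq> U}. C p)"
  proof (intro equalityI subsetI)
    fix f assume f: "f \<in> U"
    have fS: "f \<in> mspace (C0_space T)" using openin_subset[OF U] f by auto
    obtain r where r: "0 < r" "mball_of (C0_space T) f r \<subseteq> U"
      using U f unfolding mtopology_of_def mball_of_def
      by (metis (no_types, lifting) Metric_space.openin_mtopology Metric_space_mspace_mdist)
    obtain n where n: "inverse (real (Suc n)) < r / 3" using reals_Archimedean[of "r / 3"] r by auto
    obtain cs where cs: "\<And>t. t \<in> {0..T} \<Longrightarrow> \<bar>f t - P cs t\<bar> < 1 / real (Suc n)"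
      using Bernstein_approximation[OF T, of f "1 / real (Suc n)"] fS C0 unfolding P_def by fastforce
    have "C (cs, n) \<subseteq> mball_of (C0_space T) f r"
    proof
      fix g assume g: "g \<in> C (cs, n)"
      then have gS: "g \<in> mspace (C0_space T)" by (simp add: C_def)
      have "mdist (C0_space T) f g = (SUP t\<in>{0..T}. \<bar>f t - g t\<bar>)"
        using T by (intro mdist_C0_space fS gS) simp
      also have "\<dots> \<le> 2 * r / 3"
      proof (rule cSUP_least)
        fix t assume t: "t \<in> {0..T}"
        have "\<bar>g t - P cs t\<bar> \<le> 1 / real (Suc n)" using g t by (simp add: C_def)
        then have "\<bar>f t - g t\<bar> \<le> 2 * (1 / real (Suc n))" using cs[OF t] by linarith
        then show "\<bar>f t - g t\<bar> \<le> 2 * r / 3" using n by (simp add: inverse_eq_divide)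
      qed (use T in auto)
      also have "\<dots> < r" using r by simp
      finally show "g \<in> mball_of (C0_space T) f r" using fS gS by simp
    qed
    then have "C (cs, n) \<subseteq> U" using r by blast
    moreover have "f \<in> C (cs, n)" using fS cs by (auto simp: C_def less_imp_le)
    ultimately show "f \<in> (\<Union>p\<in>{p. C p \<subseteq> U}. C p)" by blast
  qed blast
  then have eq: "x -` U \<inter> space M = (\<Union>p\<in>{p. C p \<subseteq> U}. x -` C p \<inter> space M)" by blast
  have C_sets: "x -` C p \<inter> space M \<in> sets M" for p
  proof -
    let ?Q = "{0..T} \<inter> \<rat>"
    have dense: "(\<forall>t\<in>{0..T}. \<bar>f t - P cs t\<bar> \<le> c) \<longleftrightarrow> (\<forall>t\<in>?Q. \<bar>f t - P cs t\<bar> \<le> c)"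
      if f: "continuous_on {0..T} f" for f cs c
    proof (intro iffI ballI)
      fix t assume Q: "\<forall>t\<in>?Q. \<bar>f t - P cs t\<bar> \<le> c" and t: "t \<in> {0..T}"
      have "closure ({0<..<T} \<inter> \<rat>) = closure {0<..<T}"
        by (rule closure_open_Int_superset) (auto simp: Rats_closure_real)
      then have t': "t \<in> closure ({0<..<T} \<inter> \<rat>)" using t T by simp
      show "\<bar>f t - P cs t\<bar> \<le> c"
      proof (rule continuous_le_on_closure[OF _ t'])
        have "closure ({0<..<T} \<inter> \<rat>) \<subseteq> {0..T}" by (rule closure_minimal) auto
        then show "continuous_on (closure ({0<..<T} \<inter> \<rat>)) (\<lambda>t. \<bar>f t - P cs t\<bar>)"
          by (intro continuous_intros Pcont continuous_on_subset[OF f])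
      qed (use Q in auto)
    qed auto
    have "x -` C p \<inter> space M = {\<omega> \<in> space M. \<forall>t\<in>?Q. \<bar>x \<omega> t - P (fst p) t\<bar> \<le> 1 / real (Suc (snd p))}"
    proof -
      have "x \<omega> \<in> C p \<longleftrightarrow> (\<forall>t\<in>?Q. \<bar>x \<omega> t - P (fst p) t\<bar> \<le> 1 / real (Suc (snd p)))" if "\<omega> \<in> space M" for \<omega>
        using x[OF that] dense[of "x \<omega>" "fst p" "1 / real (Suc (snd p))"] C0 unfolding C_def by blast
      then show ?thesis by blast
    qed
    also have "\<dots> \<in> sets M"
    proof (rule sets_Collect_countable_Ball_set)
      show "countable ?Q" by (intro countable_Int2 countable_rat)
      fix t assume "t \<in> ?Q"
      then have [measurable]: "(\<lambda>\<omega>. x \<omega> t) \<in> borel_measurable M" using meas by auto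
      show "{\<omega> \<in> space M. \<bar>x \<omega> t - P (fst p) t\<bar> \<le> 1 / real (Suc (snd p))} \<in> sets M" by measurable
    qed
    finally show ?thesis .
  qed
  show "x -` U \<inter> space M \<in> sets M"
    unfolding eq by (intro sets.countable_UN' countableI_type) (use C_sets in blast)
qed

section \<open>The limit of the path laws\<close>

lemma restrict_in_C0:
  assumes "0 \<le> T" "continuous_on {0..T} f" "f 0 = 0"
  shows "restrict f {0..T} \<in> mspace (C0_space T)"
proof -
  have "continuous_on {0..T} (restrict f {0..T}) \<longleftrightarrow> continuous_on {0..T} f"
    by (rule continuous_on_cong) auto
  then show ?thesis using assms unfolding mspace_C0_space[OF assms(1)] by simp
qed

definition H_path :: "real \<Rightarrow> real \<Rightarrow> real \<Rightarrow> real \<Rightarrow> real" where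
  "H_path T \<gamma> \<sigma> = restrict (\<lambda>t. \<sigma> * H \<gamma> t) {0..T}"

lemma H_path_in_C0: "\<gamma> < 1 \<Longrightarrow> 0 < T \<Longrightarrow> H_path T \<gamma> \<sigma> \<in> mspace (C0_space T)"
  unfolding H_path_def
  by (intro restrict_in_C0 continuous_intros continuous_on_H) auto

lemma mdist_C0_ge:
  assumes "0 \<le> T" "f \<in> mspace (C0_space T)" "g \<in> mspace (C0_space T)" "t \<in> {0..T}"
  shows "\<bar>f t - g t\<bar> \<le> mdist (C0_space T) f g"
proof -
  have "continuous_on {0..T} (\<lambda>t. \<bar>f t - g t\<bar>)"
    using assms(2,3) by (intro continuous_intros) (simp_all add: mspace_C0_space[OF assms(1)])
  then have "bdd_above ((\<lambda>t. \<bar>f t - g t\<bar>) ` {0..T})"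
    by (intro bounded_imp_bdd_above compact_imp_bounded compact_continuous_image) auto
  then show ?thesis
    unfolding mdist_C0_space[OF assms(1-3)] using assms(4) by (intro cSUP_upper)
qed

lemma mdist_C0_le:
  assumes "0 \<le> T" "f \<in> mspace (C0_space T)" "g \<in> mspace (C0_space T)"
    and "\<And>t. t \<in> {0..T} \<Longrightarrow> \<bar>f t - g t\<bar> \<le> c"
  shows "mdist (C0_space T) f g \<le> c"
  unfolding mdist_C0_space[OF assms(1-3)] using assms(1,4) by (intro cSUP_least) auto

lemma mdist_H_paths:
  assumes "\<gamma> < 1" "0 < T"
  shows "mdist (C0_space T) (H_path T \<gamma> 1) (H_path T \<gamma> (-1)) \<le> 2 * H \<gamma> T"
proof (rule mdist_C0_le)
  fix t assume "t \<in> {0..T}"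
  then show "\<bar>H_path T \<gamma> 1 t - H_path T \<gamma> (- 1) t\<bar> \<le> 2 * H \<gamma> T"
    using H_mono[OF assms(1), of t T] H_nonneg[of \<gamma> t] by (simp add: H_path_def)
qed (use assms H_path_in_C0 in auto)

context small_noise_solution
begin

definition path :: "'a \<Rightarrow> real \<Rightarrow> real" where
  "path \<omega> = restrict (\<lambda>t. X t \<omega>) {0..T}"

lemma path_in_C0: "\<omega> \<in> space M \<Longrightarrow> path \<omega> \<in> mspace (C0_space T)"
  unfolding path_def using T by (intro restrict_in_C0 X_continuous X_start) auto

lemma path_measurable: "path \<in> M \<rightarrow>\<^sub>M borel_of (C0_topology T)"
  by (rule path_map_measurable[OF T path_in_C0]) (auto simp: path_def intro: X_measurable)

lemma path_law_eq: "path_law T M X = distr M (borel_of (C0_topology T)) path"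
  by (simp add: path_law_def path_def[abs_def])

lemma prob_space_path_law: "prob_space (path_law T M X)"
  unfolding path_law_eq by (rule prob_space_distr[OF path_measurable])

text \<open>A path in the ball around \<open>\<sigma> H \<gamma>\<close> ends beyond \<open>\<sigma> (H \<gamma> T - r)\<close>, which gives the upper bound. The lower
  bound subtracts from \<open>1\<close> the probability of missing both balls and the upper bound for the other ball.\<close>

lemma path_law_ball_bounds:
  fixes r \<delta> :: real
  assumes r: "0 < r" "r < H \<gamma> T" and \<delta>: "0 < \<delta>"
    and near: "\<And>x. continuous_on {0..T} x \<Longrightarrow>
      (\<And>t. t \<in> {0..T} \<Longrightarrow> \<bar>travel_time \<gamma> \<bar>x t\<bar> - t\<bar> < \<delta>) \<Longrightarrow>
      (\<forall>t\<in>{0..T}. \<bar>x t - H \<gamma> t\<bar> < r / 2) \<or> (\<forall>t\<in>{0..T}. \<bar>x t + H \<gamma> t\<bar> < r / 2)"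
    and \<sigma>: "\<sigma> = 1 \<or> \<sigma> = - 1"
  defines "up \<equiv> 1 / (2 - exp (- (2 / \<epsilon>\<^sup>2) * potential \<gamma> (H \<gamma> T - r)))"
  shows "measure (path_law T M X) (mball_of (C0_space T) (H_path T \<gamma> \<sigma>) r) \<le> up"
    and "1 - 2 * ((2 * \<epsilon>) powr (1 - \<gamma>) * (2 + 8 * T) / (1 - \<gamma>)) / \<delta> - up
      \<le> measure (path_law T M X) (mball_of (C0_space T) (H_path T \<gamma> \<sigma>) r)"
proof -
  define U where "U \<tau> = path -` mball_of (C0_space T) (H_path T \<gamma> \<tau>) r \<inter> space M" for \<tau>
  have ball: "mball_of (C0_space T) (H_path T \<gamma> \<tau>) r \<in> sets (borel_of (C0_topology T))" for \<tau>
    by (intro openin_sets_borel_of openin_mball_of)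
  have U_events: "U \<tau> \<in> events" for \<tau>
    unfolding U_def by (rule measurable_sets[OF path_measurable ball])
  have law: "measure (path_law T M X) (mball_of (C0_space T) (H_path T \<gamma> \<tau>) r) = prob (U \<tau>)" for \<tau>
    unfolding path_law_eq U_def by (rule measure_distr[OF path_measurable ball])
  have C0: "H_path T \<gamma> \<tau> \<in> mspace (C0_space T)" for \<tau>
    by (rule H_path_in_C0[OF \<gamma>(2) T])
  have far: "H \<gamma> T - r \<le> \<tau> * X T \<omega>" if "\<omega> \<in> U \<tau>" "\<tau> = 1 \<or> \<tau> = - 1" for \<tau> \<omega>
  proof -
    have "\<omega> \<in> space M" "mdist (C0_space T) (H_path T \<gamma> \<tau>) (path \<omega>) < r" using that by (auto simp: U_def)
    then have "\<bar>H_path T \<gamma> \<tau> T - path \<omega> T\<bar> < r"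
      using mdist_C0_ge[OF _ C0 path_in_C0, of \<omega> T \<tau>] T by simp
    then show ?thesis using that(2) T by (auto simp: H_path_def path_def)
  qed
  have upper: "prob (U \<tau>) \<le> up" if "\<tau> = 1 \<or> \<tau> = - 1" for \<tau>
    using prob_one_sided_le[OF _ U_events that far[OF _ that]] r unfolding up_def inverse_noise_def by simp
  show "measure (path_law T M X) (mball_of (C0_space T) (H_path T \<gamma> \<sigma>) r) \<le> up"
    unfolding law by (rule upper[OF \<sigma>])
  have "1 - prob (U 1 \<union> U (- 1)) \<le> 2 * ((2 * \<epsilon>) powr (1 - \<gamma>) * (2 + 8 * T) / (1 - \<gamma>)) / \<delta>"
  proof (rule prob_not_extremal_le[OF \<delta>])
    show "U 1 \<union> U (- 1) \<in> events" using U_events by blast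
    fix \<omega> assume \<omega>: "\<omega> \<in> space M" and close: "\<And>t. t \<in> {0..T} \<Longrightarrow> \<bar>travel_time \<gamma> \<bar>X t \<omega>\<bar> - t\<bar> < \<delta>"
    have in_U: "\<omega> \<in> U \<tau>" if "\<And>t. t \<in> {0..T} \<Longrightarrow> \<bar>\<tau> * H \<gamma> t - X t \<omega>\<bar> \<le> r / 2" for \<tau>
    proof -
      have "mdist (C0_space T) (H_path T \<gamma> \<tau>) (path \<omega>) \<le> r / 2"
        using T that by (intro mdist_C0_le C0 path_in_C0[OF \<omega>]) (auto simp: H_path_def path_def)
      then show ?thesis using \<omega> C0 path_in_C0[OF \<omega>] r by (auto simp: U_def)
    qed
    from near[OF X_continuous[OF \<omega>] close] show "\<omega> \<in> U 1 \<union> U (- 1)"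
    proof
      assume *: "\<forall>t\<in>{0..T}. \<bar>X t \<omega> - H \<gamma> t\<bar> < r / 2"
      have "\<omega> \<in> U 1"
      proof (rule in_U)
        fix t assume "t \<in> {0..T}"
        with * have "\<bar>X t \<omega> - H \<gamma> t\<bar> < r / 2" by blast
        then show "\<bar>1 * H \<gamma> t - X t \<omega>\<bar> \<le> r / 2" by linarith
      qed
      then show ?thesis by blast
    next
      assume *: "\<forall>t\<in>{0..T}. \<bar>X t \<omega> + H \<gamma> t\<bar> < r / 2"
      have "\<omega> \<in> U (- 1)"
      proof (rule in_U)
        fix t assume "t \<in> {0..T}"
        with * have "\<bar>X t \<omega> + H \<gamma> t\<bar> < r / 2" by blast
        then show "\<bar>- 1 * H \<gamma> t - X t \<omega>\<bar> \<le> r / 2" by linarith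
      qed
      then show ?thesis by blast
    qed
  qed
  moreover have "prob (U 1 \<union> U (- 1)) \<le> prob (U 1) + prob (U (- 1))"
    by (rule measure_Un_le[OF U_events U_events])
  ultimately show "1 - 2 * ((2 * \<epsilon>) powr (1 - \<gamma>) * (2 + 8 * T) / (1 - \<gamma>)) / \<delta> - up
      \<le> measure (path_law T M X) (mball_of (C0_space T) (H_path T \<gamma> \<sigma>) r)"
    unfolding law using upper[of 1] upper[of "- 1"] \<sigma> by auto
qed

end

lemma noise_error_tendsto_0:
  assumes "\<gamma> < 1"
  shows "((\<lambda>\<epsilon>::real. (2 * \<epsilon>) powr (1 - \<gamma>)) \<longlongrightarrow> 0) (at_right 0)"
proof -
  have "((\<lambda>\<epsilon>::real. (2 * \<epsilon>) powr (1 - \<gamma>)) \<longlongrightarrow> (2 * 0) powr (1 - \<gamma>)) (at_right 0)"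
    using assms by (intro tendsto_powr' tendsto_intros) (auto intro: eventually_mono[OF eventually_at_right_less])
  then show ?thesis by simp
qed

lemma exp_inverse_square_tendsto_0:
  assumes p: "0 < p"
  shows "((\<lambda>\<epsilon>. exp (- (2 / \<epsilon>\<^sup>2) * p)) \<longlongrightarrow> 0) (at_right (0::real))"
proof (rule tendsto_sandwich[OF _ _ tendsto_const])
  show "\<forall>\<^sub>F \<epsilon> in at_right (0::real). 0 \<le> exp (- (2 / \<epsilon>\<^sup>2) * p)" by simp
  show "\<forall>\<^sub>F \<epsilon> in at_right (0::real). exp (- (2 / \<epsilon>\<^sup>2) * p) \<le> \<epsilon>\<^sup>2 / (2 * p)"
    using eventually_at_right_less[of "0::real"]
  proof eventually_elim
    case (elim \<epsilon>)
    have y: "0 < 2 / \<epsilon>\<^sup>2 * p" using elim p by simp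
    have "2 / \<epsilon>\<^sup>2 * p \<le> exp (2 / \<epsilon>\<^sup>2 * p)" using exp_ge_add_one_self[of "2 / \<epsilon>\<^sup>2 * p"] by linarith
    then have "inverse (exp (2 / \<epsilon>\<^sup>2 * p)) \<le> inverse (2 / \<epsilon>\<^sup>2 * p)" using y by (intro le_imp_inverse_le)
    then show ?case by (simp add: exp_minus field_simps)
  qed
  have "((\<lambda>\<epsilon>::real. \<epsilon>\<^sup>2 / (2 * p)) \<longlongrightarrow> 0\<^sup>2 / (2 * p)) (at_right 0)"
    using p by (intro tendsto_intros) auto
  then show "((\<lambda>\<epsilon>::real. \<epsilon>\<^sup>2 / (2 * p)) \<longlongrightarrow> 0) (at_right 0)" by simp
qed

theorem corollary1p2:
  fixes \<gamma> T :: real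
    and M :: "real \<Rightarrow> 'w measure" and F :: "real \<Rightarrow> real \<Rightarrow> 'w measure"
    and W X :: "real \<Rightarrow> real \<Rightarrow> 'w \<Rightarrow> real"
    and \<mu> :: "real \<Rightarrow> (real \<Rightarrow> real) measure"
  assumes "0 \<le> \<gamma>" and "\<gamma> < 1" and "0 < T"
    and "\<And>\<epsilon>. 0 < \<epsilon> \<Longrightarrow> weak_solution (M \<epsilon>) (F \<epsilon>) T (W \<epsilon>) \<gamma> \<epsilon> (X \<epsilon>)"
    and "\<And>\<epsilon>. 0 < \<epsilon> \<Longrightarrow> \<mu> \<epsilon> = path_law T (M \<epsilon>) (X \<epsilon>)"
  shows "weak_convergence (C0_topology T) \<mu>
    (add_measure (scale_measure (1 / 2) (dirac_C0 T (H \<gamma>)))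
                 (scale_measure (1 / 2) (dirac_C0 T (\<lambda>s. - H \<gamma> s))))
    (at_right 0)"
proof -
  note \<gamma> = assms(1,2) and T = assms(3)
  have sol: "small_noise_solution (M \<epsilon>) (F \<epsilon>) T (W \<epsilon>) \<gamma> \<epsilon> (X \<epsilon>)" if "0 < \<epsilon>" for \<epsilon>
    using assms(4)[OF that] \<gamma> T that
    by (simp add: small_noise_solution_def small_noise_solution_axioms_def)
  have pos: "\<forall>\<^sub>F \<epsilon> in at_right (0::real). 0 < \<epsilon>" by (rule eventually_at_right_less)
  let ?h = "H_path T \<gamma>"
  have mass: "((\<lambda>\<epsilon>. measure (\<mu> \<epsilon>) (mball_of (C0_space T) (?h \<sigma>) r)) \<longlongrightarrow> 1 / 2) (at_right 0)"
    if r: "0 < r" "r < mdist (C0_space T) (?h 1) (?h (- 1)) / 2" and \<sigma>: "\<sigma> = 1 \<or> \<sigma> = - 1" for r \<sigma>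
  proof -
    (* The two limit paths are at most 2 H(T) apart, so that the ball stays away from 0 at time T. *)
    have rH: "r < H \<gamma> T" using r(2) mdist_H_paths[OF \<gamma>(2) T] by linarith
    obtain \<delta> where \<delta>: "0 < \<delta>"
      "\<And>x. continuous_on {0..T} x \<Longrightarrow> (\<And>t. t \<in> {0..T} \<Longrightarrow> \<bar>travel_time \<gamma> \<bar>x t\<bar> - t\<bar> < \<delta>) \<Longrightarrow>
        (\<forall>t\<in>{0..T}. \<bar>x t - H \<gamma> t\<bar> < r / 2) \<or> (\<forall>t\<in>{0..T}. \<bar>x t + H \<gamma> t\<bar> < r / 2)"
      using near_H_or_minus_H[OF \<gamma> T, of "r / 2"] r(1) by (metis half_gt_zero)
    define up where "up \<epsilon> = 1 / (2 - exp (- (2 / \<epsilon>\<^sup>2) * potential \<gamma> (H \<gamma> T - r)))" for \<epsilon> :: real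
    define err where "err \<epsilon> = 2 * ((2 * \<epsilon>) powr (1 - \<gamma>) * (2 + 8 * T) / (1 - \<gamma>)) / \<delta>" for \<epsilon>
    have bounds: "measure (\<mu> \<epsilon>) (mball_of (C0_space T) (?h \<sigma>) r) \<le> up \<epsilon>"
      "1 - err \<epsilon> - up \<epsilon> \<le> measure (\<mu> \<epsilon>) (mball_of (C0_space T) (?h \<sigma>) r)" if "0 < \<epsilon>" for \<epsilon>
      unfolding assms(5)[OF that] up_def err_def
      by (rule small_noise_solution.path_law_ball_bounds[OF sol[OF that] r(1) rH \<delta> \<sigma>]; assumption)+
    have "(up \<longlongrightarrow> 1 / (2 - 0)) (at_right 0)"
      unfolding up_def using rH potential_pos[OF \<gamma>(1)]
      by (intro tendsto_intros exp_inverse_square_tendsto_0) auto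
    then have up: "(up \<longlongrightarrow> 1 / 2) (at_right 0)" by simp
    have "(err \<longlongrightarrow> 2 * (0 * (2 + 8 * T) / (1 - \<gamma>)) / \<delta>) (at_right 0)"
      unfolding err_def using \<gamma> \<delta>(1) by (intro tendsto_intros noise_error_tendsto_0) auto
    then have "((\<lambda>\<epsilon>. 1 - err \<epsilon> - up \<epsilon>) \<longlongrightarrow> 1 - 0 - 1 / 2) (at_right 0)"
      by (intro tendsto_intros up) simp
    then have low: "((\<lambda>\<epsilon>. 1 - err \<epsilon> - up \<epsilon>) \<longlongrightarrow> 1 / 2) (at_right 0)" by simp
    show ?thesis
      by (rule tendsto_sandwich[OF _ _ low up])
        (use bounds in \<open>auto intro: eventually_mono[OF pos]\<close>)
  qed
  have ne: "?h 1 \<noteq> ?h (- 1)"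
  proof
    assume "?h 1 = ?h (- 1)"
    then have "?h 1 T = ?h (- 1) T" by simp
    then show False using T H_pos[OF \<gamma>(2) T] by (simp add: H_path_def)
  qed
  have "weak_convergence (C0_topology T) \<mu> (two_point_measure (C0_topology T) (?h 1) (?h (- 1))) (at_right 0)"
  proof (rule weak_convergence_two_point[OF H_path_in_C0[OF \<gamma>(2) T] H_path_in_C0[OF \<gamma>(2) T] ne])
    show "\<forall>\<^sub>F \<epsilon> in at_right 0. prob_space (\<mu> \<epsilon>) \<and> sets (\<mu> \<epsilon>) = sets (borel_of (C0_topology T))"
      using pos
    proof eventually_elim
      case (elim \<epsilon>)
      then show ?case
        using small_noise_solution.prob_space_path_law[OF sol[OF elim]] by (simp add: assms(5) path_law_def)
    qed
  qed (use mass in auto)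
  then show ?thesis
    by (simp add: two_point_measure_def dirac_C0_def H_path_def)
qed

end
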